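(* Assume the Riemann hypothesis is true. Then there is an absolute constant $A>0$ such that, for integers $m>k\ge 2$ and real $x\ge 3$, $$\sum_{r\le x}q^*_{k,m}(r)=\frac{x\,\alpha_{k,m}\,\zeta(m)}{\zeta(k)}+O\!\left(x^{\frac{2}{2k+1}}\,\omega(x)\right)$$ uniformly in $x$ and $k$ (i.e. the implied constant depends neither on $x$ nor on $k$; it may depend on $m$), where the sum is over positive integers $r\le x$, $$\alpha_{k,m}=\prod_p\left(1-\frac{1}{p^{m-k+1}+p^{m-k+2}+\cdots+p^m}\right)$$ (product over all primes $p$), and $$\omega(x)=\exp\left\{A\,\log x\,(\log\log x)^{-1}\right\}.$$
   Context: $\zeta$ is the Riemann zeta function. For integers $1<k<m$, the set $Q^*_{k,m}$ consists of the positive integers $n$ such that for every prime $p$ dividing $n$, the exponent of $p$ in the factorization of $n$ leaves a remainder between $1$ and $k-1$ (inclusive) upon division by $m$; in particular $1\in Q^*_{k,m}$. The function $q^*_{k,m}$ is the characteristic function of $Q^*_{k,m}$: $q^*_{k,m}(n)=1$ if $n\in Q^*_{k,m}$ and $0$ otherwise. *)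

theory Defs
  imports
    "HOL-Complex_Analysis.Complex_Analysis"
    "HOL-Computational_Algebra.Computational_Algebra"
begin

(* The last clause only fixes a junk value at the pole; without it the continuation would not be
   determined as a total function. *)
definition zeta :: "complex \<Rightarrow> complex" where
  "zeta = (THE f. f holomorphic_on (- {1}) \<and>
                  (\<forall>s. Re s > 1 \<longrightarrow> (\<lambda>n. of_nat (Suc n) powr (- s)) sums f s) \<and>
                  f 1 = 0)"

definition riemann_hypothesis :: bool where
  "riemann_hypothesis \<longleftrightarrow> (\<forall>s. zeta s = 0 \<and> 0 < Re s \<and> Re s < 1 \<longrightarrow> Re s = 1 / 2)"

definition Qstar :: "nat \<Rightarrow> nat \<Rightarrow> nat set" where
  "Qstar k m = {n. n > 0 \<and> (\<forall>p. prime p \<and> p dvd n \<longrightarrow> multiplicity p n mod m \<in> {1..k - 1})}"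

definition qstar :: "nat \<Rightarrow> nat \<Rightarrow> nat \<Rightarrow> real" where
  "qstar k m n = indicator (Qstar k m) n"

definition alpha :: "nat \<Rightarrow> nat \<Rightarrow> real" where
  "alpha k m = prodinf (\<lambda>p. if prime p then 1 - 1 / (\<Sum>i = m - k + 1..m. real p ^ i) else 1)"

definition omega :: "real \<Rightarrow> real \<Rightarrow> real" where
  "omega A x = exp (A * ln x * inverse (ln (ln x)))"

(* Existence of the continuation. With dtail s = sum over n >= 2 of n^(-s), telescoping
   (n+1)^(1-s) - n^(1-s) and expanding (1 + 1/n)^(1-s) binomially expresses (s - 1) * dtail s
   through its values at s+1, s+2, ... and a remainder that converges further to the left. *)

lemma pochhammer_nonneg_real: "pochhammer (x :: real) j \<ge> 0" if "x \<ge> 0"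
  using that by (induction j) (auto simp: pochhammer_Suc)

lemma norm_gbinomial_le:
  fixes a :: complex
  shows "norm (a gchoose j) \<le> pochhammer (norm a) j / fact j"
proof -
  have "norm (pochhammer (- a) j) \<le> pochhammer (norm a) j"
  proof (induction j)
    case (Suc j)
    have "norm (- a + of_nat j) \<le> norm a + real j"
      by (rule order.trans[OF norm_triangle_ineq]) simp
    then show ?case
      using Suc unfolding pochhammer_Suc norm_mult
      by (intro mult_mono pochhammer_nonneg_real) auto
  qed auto
  then show ?thesis
    by (simp add: gbinomial_pochhammer norm_divide norm_mult norm_power divide_right_mono)
qed

lemma binomial_tail_bound:
  fixes a :: complex and x :: real
  assumes "0 \<le> x" "x \<le> 1 / 2"
  shows "norm ((1 + of_real x) powr a - (\<Sum>j<N. (a gchoose j) * of_real x ^ j))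
           \<le> (2 * x) ^ N * 2 powr norm a"
proof -
  define b where "b = (\<lambda>j. pochhammer (norm a) j / fact j * (1 / 2 :: real) ^ j)"
  have b_nonneg: "b j \<ge> 0" for j
    by (auto simp: b_def intro!: mult_nonneg_nonneg divide_nonneg_nonneg pochhammer_nonneg_real)
  have "(\<lambda>n. ((- norm a) gchoose n) * (- 1 / 2) ^ n) sums (1 + (- 1 / 2)) powr (- norm a)"
    by (rule gen_binomial_real) auto
  moreover have "((- norm a) gchoose n) * (- 1 / 2) ^ n = b n" for n
  proof -
    have "(- 1 :: real) ^ n * (- 1 / 2) ^ n = (1 / 2) ^ n"
      by (simp flip: power_mult_distrib)
    then show ?thesis
      by (simp add: b_def gbinomial_pochhammer)
  qed
  moreover have "(1 + (- 1 / 2)) powr (- norm a) = 2 powr norm a"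
    by (simp add: powr_minus powr_divide)
  ultimately have b: "b sums (2 powr norm a)"
    by simp
  have b_tail: "summable (\<lambda>j. b (j + N))" "(\<Sum>j. b (j + N)) \<le> 2 powr norm a"
    using b b_nonneg suminf_split_initial_segment[of b N] sum_nonneg[of "{..<N}" b]
    by (auto simp: sums_iff summable_iff_shift)
  have "(\<lambda>n. (a gchoose n) * of_real x ^ n) sums (1 + of_real x) powr a"
    by (rule gen_binomial_complex) (use assms in auto)
  then have t: "(\<lambda>j. (a gchoose (j + N)) * of_real x ^ (j + N)) sums
      ((1 + of_real x) powr a - (\<Sum>j<N. (a gchoose j) * of_real x ^ j))"
    by (rule sums_split_initial_segment)
  have le: "norm ((a gchoose (j + N)) * of_real x ^ (j + N)) \<le> (2 * x) ^ N * b (j + N)" for j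
  proof -
    have "norm ((a gchoose (j + N)) * of_real x ^ (j + N))
          \<le> pochhammer (norm a) (j + N) / fact (j + N) * x ^ (j + N)"
      using assms norm_gbinomial_le[of a "j + N"]
      unfolding norm_mult norm_power by (intro mult_mono) (auto simp: pochhammer_nonneg_real)
    also have "\<dots> = (2 * x) ^ j * ((2 * x) ^ N * b (j + N))"
      by (simp add: b_def power_add power_divide field_simps)
    also have "\<dots> \<le> 1 * ((2 * x) ^ N * b (j + N))"
      using assms b_nonneg by (intro mult_right_mono power_le_one) auto
    finally show ?thesis by simp
  qed
  have "norm (\<Sum>j. (a gchoose (j + N)) * of_real x ^ (j + N)) \<le> (\<Sum>j. (2 * x) ^ N * b (j + N))"
    by (rule norm_suminf_le[OF le]) (intro summable_mult b_tail)
  also have "\<dots> = (2 * x) ^ N * (\<Sum>j. b (j + N))"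
    by (rule suminf_mult) (rule b_tail)
  also have "\<dots> \<le> (2 * x) ^ N * 2 powr norm a"
    using assms b_tail by (intro mult_left_mono) auto
  finally show ?thesis
    using t by (simp add: sums_iff)
qed

definition zrem_term :: "nat \<Rightarrow> nat \<Rightarrow> complex \<Rightarrow> complex" where
  "zrem_term N n s = of_nat (n + 2) powr (1 - s) *
     ((1 + of_real (1 / real (n + 2))) powr (1 - s)
        - (\<Sum>j<N. ((1 - s) gchoose j) * of_real (1 / real (n + 2)) ^ j))"

lemma norm_zrem_term_le:
  assumes "\<sigma> \<le> Re s" "norm (1 - s) \<le> B"
  shows "norm (zrem_term N n s) \<le> 2 ^ N * 2 powr B * real (n + 2) powr (1 - \<sigma> - real N)"
proof -
  have "norm (zrem_term N n s) \<le> real (n + 2) powr (1 - Re s) *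
          ((2 * (1 / real (n + 2))) ^ N * 2 powr norm (1 - s))"
    unfolding zrem_term_def norm_mult
    by (intro mult_mono binomial_tail_bound) (auto simp: norm_powr_real_powr)
  also have "\<dots> \<le> real (n + 2) powr (1 - \<sigma>) * ((2 * (1 / real (n + 2))) ^ N * 2 powr B)"
    using assms by (intro mult_mono powr_mono) auto
  also have "\<dots> = 2 ^ N * 2 powr B * real (n + 2) powr (1 - \<sigma> - real N)"
    using powr_realpow[of "real (n + 2)" N] by (simp add: powr_diff power_divide)
  finally show ?thesis .
qed

lemma summable_shift2_powr:
  assumes "e < -1"
  shows "summable (\<lambda>n. real (n + 2) powr e)"
  using assms summable_iff_shift[of "\<lambda>n. real n powr e" 2] by (simp add: summable_real_powr_iff)

lemma zrem_holomorphic: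
  "(\<lambda>s. \<Sum>n. zrem_term N n s) holomorphic_on {s. Re s > 2 - real N}"
    and zrem_summable: "Re s > 2 - real N \<Longrightarrow> summable (\<lambda>n. zrem_term N n s)"
proof -
  let ?S = "{s. Re s > 2 - real N}"
  have op: "open ?S" by (rule open_halfspace_Re_gt)
  show "(\<lambda>s. \<Sum>n. zrem_term N n s) holomorphic_on ?S"
  proof (rule holomorphic_uniform_sequence[OF op])
    show "(\<lambda>s. \<Sum>n<k. zrem_term N n s) holomorphic_on ?S" for k
      unfolding zrem_term_def gbinomial_prod_rev
      by (intro holomorphic_intros) (auto simp: complex_nonpos_Reals_iff)
  next
    fix s assume s: "s \<in> ?S"
    define d where "d = (Re s - (2 - real N)) / 2"
    have d: "d > 0" using s by (simp add: d_def)
    have re: "Re s - d \<le> Re w" if "w \<in> cball s d" for w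
      using that abs_Re_le_cmod[of "s - w"] by (simp add: dist_norm)
    have "uniform_limit (cball s d) (\<lambda>k s. \<Sum>n<k. zrem_term N n s)
            (\<lambda>s. \<Sum>n. zrem_term N n s) sequentially"
    proof (rule Weierstrass_m_test)
      fix n w assume w: "w \<in> cball s d"
      have "norm (1 - w) \<le> norm (1 - s) + d"
        using w norm_triangle_ineq[of "1 - s" "s - w"] by (simp add: dist_norm)
      then show "norm (zrem_term N n w) \<le> 2 ^ N * 2 powr (norm (1 - s) + d) *
          real (n + 2) powr (1 - (Re s - d) - real N)"
        by (intro norm_zrem_term_le re w)
    next
      show "summable (\<lambda>n. 2 ^ N * 2 powr (norm (1 - s) + d) *
          real (n + 2) powr (1 - (Re s - d) - real N))"
        using s by (intro summable_mult summable_shift2_powr) (simp add: d_def field_simps)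
    qed
    moreover have "cball s d \<subseteq> ?S"
    proof
      fix w assume "w \<in> cball s d"
      with re[of w] d show "w \<in> ?S" by (simp add: d_def field_simps)
    qed
    ultimately show "\<exists>d>0. cball s d \<subseteq> ?S \<and> uniform_limit (cball s d)
        (\<lambda>k s. \<Sum>n<k. zrem_term N n s) (\<lambda>s. \<Sum>n. zrem_term N n s) sequentially"
      using d by blast
  qed
  show "summable (\<lambda>n. zrem_term N n s)" if "Re s > 2 - real N" for s
    by (rule summable_comparison_test'[OF summable_mult[OF summable_shift2_powr]
          norm_zrem_term_le[OF order.refl order.refl]]) (use that in auto)
qed

lemma zrem_term_0: "zrem_term 0 n s = of_nat (n + 3) powr (1 - s)"
proof -
  have "real (n + 3) = real (n + 2) * (1 + 1 / real (n + 2))"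
    by (simp add: field_simps)
  then have "of_nat (n + 3) = of_real (real (n + 2)) * (of_real (1 + 1 / real (n + 2)) :: complex)"
    by (metis of_real_mult of_real_of_nat_eq)
  then have "of_nat (n + 3) powr (1 - s) =
    of_real (real (n + 2)) powr (1 - s) * (of_real (1 + 1 / real (n + 2)) :: complex) powr (1 - s)"
    by (simp only:) (rule powr_times_real; simp)
  then show ?thesis by (simp add: zrem_term_def)
qed

definition dtail :: "complex \<Rightarrow> complex" where
  "dtail s = (\<Sum>n. of_nat (n + 2) powr (- s))"

lemma dtail_sums: "Re s > 1 \<Longrightarrow> (\<lambda>n. of_nat (n + 2) powr (- s)) sums dtail s"
  unfolding dtail_def
  by (rule summable_sums, rule summable_norm_cancel)
     (use summable_shift2_powr[of "- Re s"] in \<open>simp add: norm_powr_real_powr\<close>)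

lemma dtail_holomorphic: "dtail holomorphic_on {s. Re s > 1}"
proof -
  have *: "dtail s = 2 powr (- s) + (\<Sum>n. zrem_term 0 n (s + 1))" if "Re s > 1" for s
    using dtail_sums[OF that] suminf_split_initial_segment[of "\<lambda>n. of_nat (n + 2) powr (- s)" 1]
    by (simp add: sums_iff zrem_term_0 add.commute numeral_eq_Suc)
  have "(\<lambda>s. 2 powr (- s) + ((\<lambda>s. \<Sum>n. zrem_term 0 n s) \<circ> (\<lambda>s. s + 1)) s)
          holomorphic_on {s. Re s > 1}"
    by (intro holomorphic_intros holomorphic_on_compose_gen[OF _ zrem_holomorphic]) auto
  then show ?thesis
    by (rule holomorphic_transform) (simp add: *)
qed

lemma dtail_recurrence:
  assumes s: "Re s > 1"
  shows "(s - 1) * dtail s = 2 powr (1 - s)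
           + (\<Sum>j=2..<M+2. ((1 - s) gchoose j) * dtail (s + of_nat j - 1))
           + (\<Sum>n. zrem_term (M + 2) n s)"
proof -
  have expand: "zrem_term 0 n s - of_nat (n + 2) powr (1 - s) =
      (\<Sum>j=1..<M+2. ((1 - s) gchoose j) * of_nat (n + 2) powr (- (s + of_nat j - 1)))
      + zrem_term (M + 2) n s" for n
  proof -
    have "zrem_term 0 n s = zrem_term N n s + (\<Sum>j<N. ((1 - s) gchoose j) *
            (of_nat (n + 2) powr (1 - s) * of_real (1 / real (n + 2)) ^ j))" for N
      by (simp add: zrem_term_def right_diff_distrib sum_distrib_left mult_ac)
    note this[of "M + 2"]
    also have "(\<Sum>j<M+2. ((1 - s) gchoose j) *
            (of_nat (n + 2) powr (1 - s) * of_real (1 / real (n + 2)) ^ j)) =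
          (\<Sum>j<M+2. ((1 - s) gchoose j) * of_nat (n + 2) powr (- (s + of_nat j - 1)))"
    proof (intro sum.cong refl arg_cong2[where f = "(*)"])
      fix j
      have "of_nat (n + 2) powr (- (s + of_nat j - 1)) =
              of_nat (n + 2) powr ((1 - s) - of_nat j)" by (simp add: algebra_simps)
      also have "\<dots> = of_nat (n + 2) powr (1 - s) / of_nat (n + 2) ^ j"
        using of_nat_eq_0_iff[of "n + 2", where 'a = complex]
        by (subst powr_diff) (simp add: powr_complexpow del: of_nat_add)
      finally show "of_nat (n + 2) powr (1 - s) * of_real (1 / real (n + 2)) ^ j =
          (of_nat (n + 2) powr (- (s + of_nat j - 1)) :: complex)"
        by (simp add: power_divide)
    qed
    also have "{..<M + 2} = insert 0 {1..<M + 2}" by auto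
    finally show ?thesis by (simp add: algebra_simps)
  qed
  have lim: "(\<lambda>n. of_nat (n + 2) powr (1 - s) :: complex) \<longlonglongrightarrow> 0"
  proof (rule tendsto_norm_zero_cancel)
    have "(\<lambda>n. real (n + 2) powr (1 - Re s)) \<longlonglongrightarrow> 0"
      using s by real_asymp
    then show "(\<lambda>n. norm (of_nat (n + 2) powr (1 - s) :: complex)) \<longlonglongrightarrow> 0"
      by (simp add: norm_powr_real_powr)
  qed
  have "(\<lambda>n. of_nat (Suc n + 2) powr (1 - s) - of_nat (n + 2) powr (1 - s)) sums
          (0 - (of_nat (0 + 2) powr (1 - s) :: complex))"
    by (rule telescope_sums[OF lim])
  then have L: "(\<lambda>n. zrem_term 0 n s - of_nat (n + 2) powr (1 - s)) sums (- (2 powr (1 - s)))"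
    by (simp add: zrem_term_0 add.commute numeral_eq_Suc)
  have "(\<lambda>n. (\<Sum>j=1..<M+2. ((1 - s) gchoose j) * of_nat (n + 2) powr (- (s + of_nat j - 1)))
          + zrem_term (M + 2) n s) sums
        ((\<Sum>j=1..<M+2. ((1 - s) gchoose j) * dtail (s + of_nat j - 1))
          + (\<Sum>n. zrem_term (M + 2) n s))"
    using s by (intro sums_add sums_sum sums_mult dtail_sums summable_sums zrem_summable) auto
  from sums_unique2[OF L[unfolded expand] this]
  have "- (2 powr (1 - s)) = (\<Sum>j=1..<M+2. ((1 - s) gchoose j) * dtail (s + of_nat j - 1))
          + (\<Sum>n. zrem_term (M + 2) n s)" .
  also have "{1..<M+2} = insert 1 {2..<M+2}" by auto
  finally show ?thesis by (simp add: algebra_simps)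
qed

lemma dtail_continuation:
  "\<exists>F. F holomorphic_on {s. Re s > 1 - real M} \<and> (\<forall>s. Re s > 1 \<longrightarrow> F s = (s - 1) * dtail s)"
proof (induction M)
  case 0
  have "(\<lambda>s. (s - 1) * dtail s) holomorphic_on {s. Re s > 1}"
    by (intro holomorphic_intros dtail_holomorphic)
  then show ?case by auto
next
  case (Suc M)
  then obtain F where F: "F holomorphic_on {s. Re s > 1 - real M}"
    and F_eq: "\<And>s. Re s > 1 \<Longrightarrow> F s = (s - 1) * dtail s" by blast
  define G where "G = (\<lambda>s. 2 powr (1 - s)
    + (\<Sum>j=2..<M+2. - ((1 - s) gchoose (j - 1)) / of_nat j * (F \<circ> (\<lambda>s. s + of_nat j - 1)) s)
    + (\<Sum>n. zrem_term (M + 2) n s))"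
  have "G holomorphic_on {s. Re s > 1 - real (Suc M)}"
    unfolding G_def gbinomial_prod_rev
    by (intro holomorphic_intros holomorphic_on_compose_gen[OF _ F]
          holomorphic_on_subset[OF zrem_holomorphic]) auto
  moreover have "G s = (s - 1) * dtail s" if s: "Re s > 1" for s
  proof -
    have "- ((1 - s) gchoose (j - 1)) / of_nat j * F (s + of_nat j - 1) =
            ((1 - s) gchoose j) * dtail (s + of_nat j - 1)" if j: "j \<in> {2..<M+2}" for j
    proof -
      obtain i where i: "j = Suc i" using j by (cases j) auto
      have G: "of_nat j * ((1 - s) gchoose j) = ((1 - s) - of_nat i) * ((1 - s) gchoose i)"
        using gbinomial_mult_1[of "1 - s" i] unfolding i by (simp only: left_diff_distrib) simp
      have D: "F (s + of_nat j - 1) = (s + of_nat j - 2) * dtail (s + of_nat j - 1)"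
        using s j by (subst F_eq) (auto simp: algebra_simps)
      have "- ((1 - s) gchoose i) * F (s + of_nat j - 1) =
              (((1 - s) - of_nat i) * ((1 - s) gchoose i)) * dtail (s + of_nat j - 1)"
        unfolding D by (simp add: i algebra_simps)
      also have "\<dots> = (of_nat j * ((1 - s) gchoose j)) * dtail (s + of_nat j - 1)"
        by (simp only: G)
      finally have "- ((1 - s) gchoose i) * F (s + of_nat j - 1) =
          (of_nat j * ((1 - s) gchoose j)) * dtail (s + of_nat j - 1)" .
      moreover have "of_nat j \<noteq> (0 :: complex)" using j by simp
      moreover have "j - 1 = i" by (simp add: i)
      ultimately show ?thesis by (simp only:) (simp add: nonzero_divide_eq_eq divide_simps mult_ac)
    qed
    then show ?thesis
      unfolding dtail_recurrence[OF s, of M] G_def by simp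
  qed
  ultimately show ?case by blast
qed

lemma zeta_continuation_exists:
  "\<exists>f. f holomorphic_on (- {1}) \<and>
       (\<forall>s. Re s > 1 \<longrightarrow> (\<lambda>n. of_nat (Suc n) powr (- s)) sums f s) \<and> f (1::complex) = 0"
proof -
  obtain F where F: "\<And>M. F M holomorphic_on {s. Re s > 1 - real M}"
    and F_eq: "\<And>M s. Re s > 1 \<Longrightarrow> F M s = (s - 1) * dtail s"
    using dtail_continuation by metis
  have agree: "F M s = F N s" if "Re s > 1 - real M" "M \<le> N" for M N s
  proof (rule analytic_continuation_open[of "{s. Re s > 1}" "{s. Re s > 1 - real M}" "F M" "F N"])
    show "{s. Re s > 1} \<noteq> {}" by (auto intro!: exI[of _ 2])
    show "connected {s. Re s > 1 - real M}"
      by (intro convex_connected convex_halfspace_Re_gt)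
    show "F N holomorphic_on {s. Re s > 1 - real M}"
      by (rule holomorphic_on_subset[OF F]) (use that in auto)
  qed (use that F F_eq in \<open>auto simp: open_halfspace_Re_gt\<close>)
  define m where "m = (\<lambda>s::complex. nat (\<lceil>\<bar>Re s\<bar>\<rceil> + 2))"
  define H where "H = (\<lambda>s. F (m s) s)"
  have m: "Re s > 1 - real (m s)" for s by (simp add: m_def) linarith
  have H: "H s = F M s" if "Re s > 1 - real M" for s M
    using agree[OF that] agree[OF m[of s]] unfolding H_def by (metis linear)
  have "H holomorphic_on (\<Union>M. {s. Re s > 1 - real M})"
    by (intro holomorphic_on_UN_open open_halfspace_Re_gt holomorphic_transform[OF F])
       (simp add: H)
  moreover have "(\<Union>M. {s. Re s > 1 - real M}) = UNIV"
    using m by blast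
  ultimately have Hh: "H holomorphic_on UNIV" by simp
  have H_eq: "H s = (s - 1) * dtail s" if "Re s > 1" for s
    using that F_eq H[of 0 s] by simp
  define f where "f = (\<lambda>s. if s = 1 then 0 else 1 + H s / (s - 1))"
  have "(\<lambda>s. 1 + H s / (s - 1)) holomorphic_on (- {1})"
    by (intro holomorphic_intros holomorphic_on_subset[OF Hh]) auto
  then have "f holomorphic_on (- {1})"
    by (rule holomorphic_transform) (auto simp: f_def)
  moreover have "(\<lambda>n. of_nat (Suc n) powr (- s)) sums f s" if "Re s > 1" for s
  proof -
    have "f s = dtail s + 1" using that H_eq[OF that] by (auto simp: f_def)
    then show ?thesis
      using sums_Suc_iff[of "\<lambda>n. of_nat (Suc n) powr (- s)" "dtail s"] dtail_sums[OF that]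
      by (simp add: add_ac)
  qed
  ultimately show ?thesis by (intro exI[of _ f]) (auto simp: f_def)
qed

lemma zeta_continuation_unique:
  assumes "f holomorphic_on (- {1})" "g holomorphic_on (- {1})"
  assumes "\<And>s. Re s > 1 \<Longrightarrow> (\<lambda>n. of_nat (Suc n) powr (- s)) sums f s"
  assumes "\<And>s. Re s > 1 \<Longrightarrow> (\<lambda>n. of_nat (Suc n) powr (- s)) sums g s"
  assumes "f 1 = g (1::complex)"
  shows "f = g"
proof
  fix s
  show "f s = g s"
  proof (cases "s = 1")
    case False
    show ?thesis
    proof (rule analytic_continuation_open[of "{s. Re s > 1}" "- {1}" f g])
      show "{s. Re s > 1} \<noteq> {}" by (auto intro!: exI[of _ 2])
      show "connected (- {1 :: complex})"
        by (rule connected_punctured_universe) simp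
      show "f z = g z" if "z \<in> {s. Re s > 1}" for z
        using that assms(3,4) sums_unique2 by blast
    qed (use False assms in \<open>auto simp: open_halfspace_Re_gt\<close>)
  qed (use assms in simp)
qed

theorem
  shows zeta_holomorphic: "zeta holomorphic_on (- {1})"
    and zeta_sums: "Re s > 1 \<Longrightarrow> (\<lambda>n. of_nat (Suc n) powr (- s)) sums zeta s"
    and zeta_1: "zeta 1 = 0"
proof -
  have "\<exists>!f. f holomorphic_on (- {1}) \<and>
       (\<forall>s. Re s > 1 \<longrightarrow> (\<lambda>n. of_nat (Suc n) powr (- s)) sums f s) \<and> f (1::complex) = 0"
  proof (rule ex_ex1I[OF zeta_continuation_exists])
    fix f g :: "complex \<Rightarrow> complex"
    assume "f holomorphic_on (- {1}) \<and>
       (\<forall>s. Re s > 1 \<longrightarrow> (\<lambda>n. of_nat (Suc n) powr (- s)) sums f s) \<and> f (1::complex) = 0"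
      "g holomorphic_on (- {1}) \<and>
       (\<forall>s. Re s > 1 \<longrightarrow> (\<lambda>n. of_nat (Suc n) powr (- s)) sums g s) \<and> g (1::complex) = 0"
    then show "f = g" by (intro zeta_continuation_unique) auto
  qed
  from theI'[OF this, folded zeta_def]
  show "zeta holomorphic_on (- {1})"
    "Re s > 1 \<Longrightarrow> (\<lambda>n. of_nat (Suc n) powr (- s)) sums zeta s" "zeta 1 = 0"
    by auto
qed

end

theory Submission
  imports Defs
begin

text \<open>
  The Dirichlet series of \<open>q*\<close> is \<open>\<zeta>(s) / \<zeta>(k s)\<close> times a series \<open>\<Sum>g(n) n^(-s)\<close> that converges
  absolutely for \<open>Re s > 1/(m+1)\<close>, in particular at \<open>2/(2k+1)\<close>. Hence \<open>q*\<close> is the convolution of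
  \<open>g\<close> with the indicator of the \<open>k\<close>-free numbers, and it suffices to count the latter. Writing that
  indicator as \<open>\<Sum>\<mu>(d)\<close> over \<open>d^k | n\<close> and splitting at \<open>d = x^(2/(2k+1))\<close>, partial summation
  reduces the count to the bound \<open>M(x) = O(x^(1/2) exp(C log x / log log x))\<close> for the sum
  of the Moebius function.

  For this bound let \<open>F(s) = (s-1) \<zeta>(s)\<close>. All zeros of \<open>F\<close> near a point to the right of the
  critical line lie to its left, so \<open>Re F'/F \<ge> - C log t\<close> there. The Cayley transform of \<open>F'/F\<close> is
  therefore bounded by 1, and of size \<open>1 / log t\<close> on \<open>Re s = 2\<close>; the three lines theorem then yields
  \<open>F'/F = O(log x exp(- c (\<sigma> - 1/2) log log x))\<close> for \<open>\<sigma> \<ge> 1/2 + 6 / log log x\<close> and \<open>|t| \<le> x^4\<close>.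
  Integrating in \<open>\<sigma>\<close> gives \<open>1/\<zeta> = O(exp(C log x / log log x))\<close> in this region, and
  Perron's formula concludes.
\<close>

section \<open>Multiplicative functions and Euler products\<close>

text \<open>F'/F is known from one side only. A zero rho to the left of s contributes 1/(s - rho),
  of nonnegative real part however close rho is, so a lower bound of order log t for the real part
  persists up to the critical line, while nothing comparable holds from above or for the imaginary
  part. The treatment of 1/zeta is arranged around this half of the information. Decay of the bound
  in \<sigma> is what turns log x into log x / log log x on integration. Stopping 6 / log log x
  short of the line costs x^(6 / log log x), which has the shape of \<open>omega\<close>; the
  logarithm produced by Perron's formula is absorbed in the same way. The Moebius bound is stated
  for all N \<le> x with the exponential taken at x: the convolution applies it at x/d for every d,
  and ln x / ln (ln x) is not monotone for small x. The constant A comes from this bound alone,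
  before k and m are chosen. The other constants depend on k and m, and uniformity in k holds
  because a given m leaves finitely many k.\<close>

definition mult_fn :: "(nat \<Rightarrow> 'a :: comm_semiring_1) \<Rightarrow> bool" where
  "mult_fn f \<longleftrightarrow> f 1 = 1 \<and> (\<forall>p j n. prime p \<longrightarrow> \<not> p dvd n \<longrightarrow> f (p ^ j * n) = f (p ^ j) * f n)"

lemma mult_fn_1: "mult_fn f \<Longrightarrow> f (Suc 0) = 1"
  and mult_fn_mult: "mult_fn f \<Longrightarrow> prime p \<Longrightarrow> \<not> p dvd n \<Longrightarrow> f (p ^ j * n) = f (p ^ j) * f n"
  by (auto simp: mult_fn_def)

lemma mult_fn_times: "mult_fn f \<Longrightarrow> mult_fn g \<Longrightarrow> mult_fn (\<lambda>n. f n * g n)"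
  by (auto simp: mult_fn_def mult_ac)

lemma mult_fn_norm: "mult_fn f \<Longrightarrow> mult_fn (\<lambda>n. norm (f n :: 'a :: real_normed_field))"
  by (auto simp: mult_fn_def norm_mult)

lemma prime_power_decompose:
  fixes n :: nat
  assumes "n > 1"
  obtains p j m where "prime p" "\<not> p dvd m" "n = p ^ j * m" "0 < m" "m < n"
proof -
  obtain p where p: "prime p" "p dvd n"
    using prime_factor_nat[of n] assms by auto
  obtain m where m: "n = p ^ multiplicity p n * m" "\<not> p dvd m"
    using multiplicity_decompose'[of n p] p assms not_prime_unit[of p] by (metis not_one_less_zero)
  have "multiplicity p n > 0"
    using p assms by (intro multiplicity_gt_zero_iff[THEN iffD2]) auto
  then have "p ^ multiplicity p n > 1"
    using p by (intro one_less_power prime_gt_1_nat)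
  moreover have "m > 0" using m(2) by (intro Nat.gr0I) (metis dvd_0_right)
  ultimately have "m < n" by (subst m(1)) simp
  with that p m \<open>m > 0\<close> show ?thesis by blast
qed

text \<open>Strong induction that peels off one full prime power per step, the use for which
  \<open>mult_fn\<close> has its form. The convolution identities below are thereby checked on prime
  powers only. Values at 0 are left free, since every prime divides 0.\<close>

lemma mult_fn_cong:
  assumes "mult_fn f" "mult_fn g" "\<And>p j. prime p \<Longrightarrow> f (p ^ j) = g (p ^ j)" "n > 0"
  shows "f n = g n"
  using \<open>n > 0\<close>
proof (induction n rule: less_induct)
  case (less n)
  show ?case
  proof (cases "n = 1")
    case False
    then have "n > 1" using less.prems by simp
    then obtain p j m where "prime p" "\<not> p dvd m" "n = p ^ j * m" "0 < m" "m < n"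
      using prime_power_decompose[of n] by metis
    then show ?thesis using less assms by (simp add: mult_fn_mult)
  qed (use assms in \<open>simp add: mult_fn_1\<close>)
qed

text \<open>The local value depends on the exponent alone and not on the prime; \<open>mu\<close>,
  \<open>kfree\<close>, \<open>mu_pow\<close>, \<open>qstar\<close> and \<open>gfun\<close> are all
  of this shape. The empty product makes \<open>mfun c 0\<close> equal to 1.\<close>

definition mfun :: "(nat \<Rightarrow> 'a :: comm_semiring_1) \<Rightarrow> nat \<Rightarrow> 'a" where
  "mfun c n = (\<Prod>p\<in>prime_factors n. c (multiplicity p n))"

lemma
  assumes "c 0 = 1"
  shows mult_fn_mfun: "mult_fn (mfun c)"
    and mfun_prime_power: "prime p \<Longrightarrow> mfun c (p ^ j) = c j"
proof -
  show pp: "mfun c (p ^ j) = c j" if "prime p" for p j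
    using assms that by (cases "j = 0") (auto simp: mfun_def prime_factorization_prime_power)
  show "mult_fn (mfun c)"
    unfolding mult_fn_def
  proof (intro conjI allI impI)
    fix p j n :: nat assume p: "prime p" and n: "\<not> p dvd n"
    have n0: "n \<noteq> 0" using n by (metis dvd_0_right)
    show "mfun c (p ^ j * n) = mfun c (p ^ j) * mfun c n"
    proof (cases "j = 0")
      case False
      have "prime_factors (p ^ j * n) = insert p (prime_factors n)"
        using p n0 False by (simp add: prime_factors_product prime_factorization_prime_power)
      moreover have "p \<notin> prime_factors n" using n by auto
      moreover have "multiplicity p (p ^ j * n) = j"
        using p n n0 by (simp add: multiplicity_prime_elem_times_other prime_elem_multiplicity_mult_distrib
            not_dvd_imp_multiplicity_0)
      moreover have "multiplicity q (p ^ j * n) = multiplicity q n" if "q \<in> prime_factors n" for q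
      proof -
        have "q \<noteq> p" "prime q" using that n by auto
        then have "\<not> q dvd p ^ j" using p by (meson prime_dvd_power primes_dvd_imp_eq)
        then show ?thesis
          using \<open>prime q\<close> n0 p by (simp add: prime_elem_multiplicity_mult_distrib not_dvd_imp_multiplicity_0)
      qed
      ultimately show ?thesis
        unfolding pp[OF p] by (simp add: mfun_def cong: prod.cong)
    qed (simp add: mfun_def)
  qed (simp add: mfun_def)
qed

section \<open>Dirichlet convolution\<close>

definition dconv :: "(nat \<Rightarrow> 'a :: comm_semiring_1) \<Rightarrow> (nat \<Rightarrow> 'a) \<Rightarrow> nat \<Rightarrow> 'a" where
  "dconv f g n = (\<Sum>d | d dvd n. f d * g (n div d))"

text \<open>If p does not divide n, the divisors of p^j n are the products p^i d with i \<le> j and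
  d | n, each obtained once, and the cofactors split in the same way; the sum becomes a product.
  Multiplicativity of a convolution and its values at prime powers both follow.\<close>

lemma dconv_prime_power_mult:
  assumes f: "mult_fn f" and g: "mult_fn g" and p: "prime p" "\<not> p dvd n"
  shows "dconv f g (p ^ j * n) = (\<Sum>i\<le>j. f (p ^ i) * g (p ^ (j - i))) * dconv f g n"
proof -
  have n0: "n > 0" using p by (intro Nat.gr0I) (metis dvd_0_right)
  have nd: "\<not> p dvd d" if "d dvd n" for d using that p by (meson dvd_trans)
  let ?h = "\<lambda>(i, d). p ^ i * d"
  have inj: "inj_on ?h ({..j} \<times> {d. d dvd n})"
  proof (rule inj_onI, clarsimp)
    fix i d i' d' assume "d dvd n" "d' dvd n" and eq: "p ^ i * d = p ^ i' * d'"
    then have nd: "\<not> p dvd d" "\<not> p dvd d'" using nd by auto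
    then have "d \<noteq> 0" "d' \<noteq> 0" by (metis dvd_0_right)+
    then have "multiplicity p (p ^ i * d) = i" "multiplicity p (p ^ i' * d') = i'"
      using p nd by (simp_all add: prime_elem_multiplicity_mult_distrib not_dvd_imp_multiplicity_0)
    with eq have "i = i'" by simp
    with eq p show "i = i' \<and> d = d'" by (auto simp: prime_gt_0_nat)
  qed
  have img: "{d. d dvd p ^ j * n} = ?h ` ({..j} \<times> {d. d dvd n})"
  proof (intro equalityI subsetI)
    fix e assume "e \<in> {d. d dvd p ^ j * n}"
    then obtain b d where e: "e = b * d" "b dvd p ^ j" "d dvd n"
      using division_decomp by blast
    then obtain i where "i \<le> j" "b = p ^ i" using p by (auto simp: divides_primepow_nat)
    with e show "e \<in> ?h ` ({..j} \<times> {d. d dvd n})" by force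
  qed (auto intro: mult_dvd_mono le_imp_power_dvd)
  have "dconv f g (p ^ j * n) = (\<Sum>(i, d)\<in>{..j} \<times> {d. d dvd n}. f (p ^ i * d) * g (p ^ j * n div (p ^ i * d)))"
    unfolding dconv_def img sum.reindex[OF inj] by (simp add: case_prod_unfold)
  also have "\<dots> = (\<Sum>(i, d)\<in>{..j} \<times> {d. d dvd n}. (f (p ^ i) * g (p ^ (j - i))) * (f d * g (n div d)))"
  proof (intro sum.cong refl, clarsimp)
    fix i d assume i: "i \<le> j" and d: "d dvd n"
    have q: "p ^ j * n div (p ^ i * d) = p ^ (j - i) * (n div d)"
      using i d p by (simp add: div_mult_div_if_dvd le_imp_power_dvd power_diff prime_gt_0_nat)
    have nd': "\<not> p dvd n div d"
      using p d by (metis dvd_div_mult_self dvd_mult2)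
    show "f (p ^ i * d) * g (p ^ j * n div (p ^ i * d)) =
        f (p ^ i) * g (p ^ (j - i)) * (f d * g (n div d))"
      unfolding q mult_fn_mult[OF f p(1) nd[OF d]] mult_fn_mult[OF g p(1) nd'] by (simp add: mult_ac)
  qed
  also have "\<dots> = (\<Sum>i\<le>j. f (p ^ i) * g (p ^ (j - i))) * dconv f g n"
    unfolding dconv_def by (simp add: sum_product sum.cartesian_product)
  finally show ?thesis .
qed

lemma dconv_prime_power:
  assumes "mult_fn f" "mult_fn g" "prime p"
  shows "dconv f g (p ^ j) = (\<Sum>i\<le>j. f (p ^ i) * g (p ^ (j - i)))"
  using dconv_prime_power_mult[OF assms, of 1 j] assms
  prime_gt_1_nat[of p] by (simp add: dconv_def mult_fn_1)

lemma mult_fn_dconv: "mult_fn f \<Longrightarrow> mult_fn g \<Longrightarrow> mult_fn (dconv f g)"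
  unfolding mult_fn_def[of "dconv f g"]
  by (auto simp: dconv_prime_power_mult dconv_prime_power) (simp add: dconv_def mult_fn_1)

section \<open>Finite and infinite Euler products\<close>

definition smooth :: "nat set \<Rightarrow> nat set" where
  "smooth P = {n. n > 0 \<and> prime_factors n \<subseteq> P}"

text \<open>Induction on P: an integer with all primes in \<open>insert p P\<close> is p^i d in
  exactly one way with d free of p, so the sum is a product of two absolutely convergent sums.
  Unordered sums are used because this bijection does not respect the order of the integers.\<close>

lemma euler_product_finite:
  fixes f :: "nat \<Rightarrow> 'a :: {real_normed_field, banach}"
  assumes "finite P" "\<And>p. p \<in> P \<Longrightarrow> prime p" and f: "mult_fn f"
    and "\<And>p. p \<in> P \<Longrightarrow> (\<lambda>j. norm (f (p ^ j))) summable_on UNIV"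
  shows "(\<lambda>n. norm (f n)) summable_on smooth P \<and> infsum f (smooth P) = (\<Prod>p\<in>P. \<Sum>\<^sub>\<infinity>j. f (p ^ j))"
  using assms(1,2,4)
proof (induction P rule: finite_induct)
  case empty
  have "smooth {} = {1}"
  proof (intro equalityI subsetI)
    fix n assume n: "n \<in> smooth {}"
    have "n = 1"
    proof (rule ccontr)
      assume "n \<noteq> 1"
      then obtain p where "prime p" "p dvd n" using prime_factor_nat by blast
      moreover have "n > 0" using n by (simp add: smooth_def)
      ultimately have "p \<in> prime_factors n" by (simp add: in_prime_factors_iff)
      then show False using n unfolding smooth_def by blast
    qed
    then show "n \<in> {1}" by simp
  qed (simp add: smooth_def)
  then show ?case using f by (simp add: mult_fn_1)
next
  case (insert p P)
  have p: "prime p" using insert.prems by auto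
  have P: "\<And>q. q \<in> P \<Longrightarrow> prime q" using insert.prems by auto
  have nd: "\<not> p dvd n" "n > 0" if "n \<in> smooth P" for n
    using that p insert.hyps by (auto simp: smooth_def prime_factors_dvd)
  let ?h = "\<lambda>(i, d). p ^ i * d"
  have inj: "inj_on ?h (UNIV \<times> smooth P)"
  proof (rule inj_onI, clarsimp)
    fix i d i' d' assume d: "d \<in> smooth P" "d' \<in> smooth P" and eq: "p ^ i * d = p ^ i' * d'"
    have "multiplicity p (p ^ i * d) = i" "multiplicity p (p ^ i' * d') = i'"
      using p nd[OF d(1)] nd[OF d(2)]
      by (simp_all add: prime_elem_multiplicity_mult_distrib not_dvd_imp_multiplicity_0)
    with eq have "i = i'" by simp
    with eq p show "i = i' \<and> d = d'" by (auto simp: prime_gt_0_nat)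
  qed
  have img: "?h ` (UNIV \<times> smooth P) = smooth (insert p P)"
  proof (intro equalityI subsetI)
    fix n assume n: "n \<in> smooth (insert p P)"
    then have n0: "n > 0" by (simp add: smooth_def)
    obtain i m where m: "n = p ^ i * m" "\<not> p dvd m"
    proof (rule multiplicity_decompose'[of n p])
      show "n \<noteq> 0" "\<not> is_unit p" using n0 p not_prime_unit by auto
    qed blast
    have m0: "m > 0" using m(2) by (intro Nat.gr0I) (metis dvd_0_right)
    have "m dvd n" using m(1) by simp
    then have "prime_factors m \<subseteq> prime_factors n"
      using n0 by (intro dvd_prime_factors) auto
    moreover have "p \<notin> prime_factors m" using m(2) by auto
    ultimately have "m \<in> smooth P"
      using n m0 unfolding smooth_def by blast
    then show "n \<in> ?h ` (UNIV \<times> smooth P)" using m(1) by (intro image_eqI[of _ _ "(i, m)"]) auto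
  next
    fix n assume "n \<in> ?h ` (UNIV \<times> smooth P)"
    then obtain i d where "n = p ^ i * d" "d \<in> smooth P" by auto
    then show "n \<in> smooth (insert p P)"
      using p by (cases "i = 0") (auto simp: smooth_def prime_factors_product prime_factorization_prime_power
          prime_gt_0_nat)
  qed
  have fh: "f (?h x) = f (p ^ fst x) * f (snd x)" if "x \<in> UNIV \<times> smooth P" for x
    using that nd p f by (auto simp: mult_fn_mult)
  have IH: "(\<lambda>n. norm (f n)) summable_on smooth P" "infsum f (smooth P) = (\<Prod>p\<in>P. \<Sum>\<^sub>\<infinity>j. f (p ^ j))"
    using insert P by auto
  have loc: "(\<lambda>j. norm (f (p ^ j))) summable_on UNIV" using insert.prems by auto
  have "(\<lambda>x. norm (case x of (i, d) \<Rightarrow> f (p ^ i) * f d)) summable_on UNIV \<times> smooth P"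
  proof (rule Infinite_Sum.abs_summable_on_Sigma_iff[where f = "\<lambda>(i, d). f (p ^ i) * f d" and A = UNIV
        and B = "\<lambda>_. smooth P", THEN iffD2],
      intro conjI ballI)
    show "(\<lambda>d. norm (case (i, d) of (i, d) \<Rightarrow> f (p ^ i) * f d)) summable_on smooth P" for i
      using IH(1) by (auto simp: norm_mult intro!: summable_on_cmult_right)
    have "(\<lambda>i. norm (f (p ^ i)) * (\<Sum>\<^sub>\<infinity>d\<in>smooth P. norm (f d))) summable_on UNIV"
      by (intro summable_on_cmult_left loc)
    then show "(\<lambda>i. norm (\<Sum>\<^sub>\<infinity>d\<in>smooth P. norm (case (i, d) of (i, d) \<Rightarrow> f (p ^ i) * f d))) summable_on UNIV"
      using IH(1) by (simp add: norm_mult infsum_cmult_right infsum_nonneg)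
  qed
  then have prod_sum: "(\<lambda>x. norm (f (?h x))) summable_on UNIV \<times> smooth P"
    by (rule summable_on_cong[THEN iffD1, rotated]) (use fh in auto)
  have "(\<lambda>n. norm (f n)) summable_on smooth (insert p P)"
    unfolding img[symmetric] using summable_on_reindex[OF inj, of "\<lambda>x. norm (f x)"] prod_sum
    by (simp add: o_def)
  moreover have "infsum f (smooth (insert p P)) = (\<Sum>\<^sub>\<infinity>x\<in>UNIV \<times> smooth P. f (?h x))"
    unfolding img[symmetric] by (subst infsum_reindex[OF inj]) (simp add: o_def)
  moreover have "\<dots> = (\<Sum>\<^sub>\<infinity>i. \<Sum>\<^sub>\<infinity>d\<in>smooth P. f (?h (i, d)))"
    using infsum_Sigma'_banach[of "\<lambda>i d. f (?h (i, d))" UNIV "\<lambda>_. smooth P"]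
      abs_summable_summable[OF prod_sum] by (simp add: case_prod_unfold)
  moreover have "\<dots> = (\<Sum>\<^sub>\<infinity>i. \<Sum>\<^sub>\<infinity>d\<in>smooth P. f (p ^ i) * f d)"
    using fh by (intro infsum_cong) auto
  moreover have "\<dots> = (\<Sum>\<^sub>\<infinity>i. f (p ^ i)) * infsum f (smooth P)"
    using abs_summable_summable[OF IH(1)] abs_summable_summable[OF loc]
    by (simp add: infsum_cmult_right infsum_cmult_left)
  ultimately show ?case using insert.hyps IH(2) by simp
qed

lemma smooth_superset: "{0<..N} \<subseteq> smooth {p. prime p \<and> p \<le> N}"
  by (auto simp: smooth_def in_prime_factors_iff) (meson dvd_imp_le le_trans)

lemma has_sum_pos_imp_LIMSEQ:
  fixes f :: "nat \<Rightarrow> 'a :: real_normed_vector"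
  assumes "(f has_sum s) {0<..}"
  shows "(\<lambda>N. \<Sum>n=1..N. f n) \<longlonglongrightarrow> s"
proof -
  have "((\<lambda>n. if n > 0 then f n else 0) has_sum s) UNIV"
    using assms by (rule has_sum_cong_neutral[THEN iffD1, rotated -1]) auto
  then have "(\<lambda>N. \<Sum>n<Suc N. if n > 0 then f n else 0) \<longlonglongrightarrow> s"
    by (intro LIMSEQ_Suc) (auto dest!: has_sum_imp_sums simp: sums_def)
  moreover have "(\<Sum>n<Suc N. if n > 0 then f n else 0) = (\<Sum>n=1..N. f n)" for N
    by (rule sum.mono_neutral_cong_right) auto
  ultimately show ?thesis by (simp only:)
qed

text \<open>All integers from 1 to N have only prime factors up to N, so the finite product differs
  from the full sum by at most the tail of the absolute series beyond N.\<close>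

lemma euler_product_LIMSEQ:
  fixes f :: "nat \<Rightarrow> 'a :: {real_normed_field, banach}"
  assumes f: "mult_fn f" and abs: "(\<lambda>n. norm (f n)) summable_on {0<..}"
  shows "(\<lambda>N. \<Prod>p | prime p \<and> p \<le> N. \<Sum>\<^sub>\<infinity>j. f (p ^ j)) \<longlonglongrightarrow> infsum f {0<..}"
proof -
  let ?P = "\<lambda>N. {p::nat. prime p \<and> p \<le> N}"
  have fin: "finite (?P N)" for N by simp
  have loc: "(\<lambda>j. norm (f (p ^ j))) summable_on UNIV" if "prime p" for p
  proof -
    have inj: "inj (\<lambda>j. p ^ j)" using prime_gt_1_nat[OF that] by (auto intro!: injI)
    have "(\<lambda>n. norm (f n)) summable_on range (\<lambda>j. p ^ j)"
      using prime_gt_0_nat[OF that] by (intro summable_on_subset_banach[OF abs]) auto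
    then show ?thesis using summable_on_reindex[OF inj, of "\<lambda>x. norm (f x)"] by (simp add: o_def)
  qed
  have eq: "(\<Prod>p\<in>?P N. \<Sum>\<^sub>\<infinity>j. f (p ^ j)) = infsum f (smooth (?P N))" for N
    using euler_product_finite[OF fin _ f, of N] loc by simp
  have sub: "smooth (?P N) \<subseteq> {0<..}" for N by (auto simp: smooth_def)
  have lim: "(\<lambda>N. infsum (\<lambda>n. norm (f n)) {0<..} - infsum (\<lambda>n. norm (f n)) {0<..N}) \<longlonglongrightarrow> 0"
  proof -
    have "(\<lambda>N. \<Sum>n=1..N. norm (f n)) \<longlonglongrightarrow> infsum (\<lambda>n. norm (f n)) {0<..}"
      by (rule has_sum_pos_imp_LIMSEQ[OF has_sum_infsum[OF abs]])
    moreover have "(\<Sum>n=1..N. norm (f n)) = infsum (\<lambda>n. norm (f n)) {0<..N}" for N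
      by (simp add: atLeastSucAtMost_greaterThanAtMost)
    ultimately show ?thesis by (auto intro!: tendsto_eq_intros)
  qed
  have "norm (infsum f (smooth (?P N)) - infsum f {0<..}) \<le>
      infsum (\<lambda>n. norm (f n)) {0<..} - infsum (\<lambda>n. norm (f n)) {0<..N}" for N
  proof -
    have abs': "(\<lambda>n. norm (f n)) summable_on A" if "A \<subseteq> {0<..}" for A
      using that by (rule summable_on_subset_banach[OF abs])
    have "infsum f ({0<..} - smooth (?P N)) = infsum f {0<..} - infsum f (smooth (?P N))"
      using sub by (intro infsum_Diff abs_summable_summable[OF abs']) auto
    then have "norm (infsum f (smooth (?P N)) - infsum f {0<..}) = norm (infsum f ({0<..} - smooth (?P N)))"
      by (simp add: norm_minus_commute)
    also have "\<dots> \<le> infsum (\<lambda>n. norm (f n)) ({0<..} - smooth (?P N))"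
      by (intro norm_infsum_bound abs') auto
    also have "\<dots> \<le> infsum (\<lambda>n. norm (f n)) ({0<..} - {0<..N})"
      using smooth_superset[of N] by (intro infsum_mono2 abs') auto
    also have "\<dots> = infsum (\<lambda>n. norm (f n)) {0<..} - infsum (\<lambda>n. norm (f n)) {0<..N}"
      by (intro infsum_Diff abs') auto
    finally show ?thesis .
  qed
  then have "(\<lambda>N. infsum f (smooth (?P N)) - infsum f {0<..}) \<longlonglongrightarrow> 0"
    by (intro Lim_null_comparison[OF always_eventually lim]) auto
  then show ?thesis unfolding eq by (rule LIM_zero_cancel)
qed

text \<open>A finite set of integers involves finitely many primes, so its sum of norms is at most a
  finite product of local sums, and 1 + \<epsilon> \<le> exp \<epsilon> bounds all these products at
  once. The convergence of the series of g to the left of Re s = 1 rests on this.\<close>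

lemma mult_fn_abs_summable:
  fixes f :: "nat \<Rightarrow> 'a :: {real_normed_field, banach}"
  assumes f: "mult_fn f"
    and loc: "\<And>p. prime p \<Longrightarrow> ((\<lambda>j. norm (f (p ^ j))) has_sum s p) UNIV"
    and le: "\<And>p. prime p \<Longrightarrow> s p \<le> 1 + \<epsilon> p" and \<epsilon>: "summable \<epsilon>" "\<And>p. \<epsilon> p \<ge> 0"
  shows "(\<lambda>n. norm (f n)) summable_on {0<..}"
proof (rule nonneg_bdd_above_summable_on)
  show "bdd_above (sum (\<lambda>n. norm (f n)) ` {F. F \<subseteq> {0<..} \<and> finite F})"
  proof (rule bdd_aboveI2)
    fix F :: "nat set" assume F: "F \<in> {F. F \<subseteq> {0<..} \<and> finite F}"
    define P where "P = {p::nat. prime p \<and> p \<le> Max (insert 0 F)}"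
    have P: "finite P" "\<And>p. p \<in> P \<Longrightarrow> prime p" by (auto simp: P_def)
    have "mult_fn (\<lambda>n. norm (f n))" using f by (rule mult_fn_norm)
    moreover have "(\<lambda>j. norm (norm (f (p ^ j)))) summable_on UNIV" if "p \<in> P" for p
      using has_sum_imp_summable[OF loc[OF P(2)[OF that]]] by simp
    ultimately have sm: "(\<lambda>n. norm (f n)) summable_on smooth P"
      and eq: "(\<Sum>\<^sub>\<infinity>n\<in>smooth P. norm (f n)) = (\<Prod>p\<in>P. \<Sum>\<^sub>\<infinity>j. norm (f (p ^ j)))"
      using euler_product_finite[OF P, of "\<lambda>n. norm (f n)"] by simp_all
    have "F \<subseteq> smooth P"
    proof
      fix n assume "n \<in> F"
      then have "n \<in> {0<..Max (insert 0 F)}" using F by auto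
      then show "n \<in> smooth P" unfolding P_def using smooth_superset by blast
    qed
    then have "(\<Sum>n\<in>F. norm (f n)) \<le> (\<Sum>\<^sub>\<infinity>n\<in>smooth P. norm (f n))"
      using F by (intro finite_sum_le_infsum sm) auto
    also have "\<dots> = (\<Prod>p\<in>P. s p)"
      unfolding eq by (rule prod.cong[OF refl]) (rule infsumI[OF loc[OF P(2)]])
    also have "\<dots> \<le> (\<Prod>p\<in>P. exp (\<epsilon> p))"
    proof (intro prod_mono conjI)
      fix p assume "p \<in> P"
      then show "0 \<le> s p" using has_sum_nonneg[OF loc[OF P(2)], of p] by simp
      show "s p \<le> exp (\<epsilon> p)"
        using le[OF P(2)[OF \<open>p \<in> P\<close>]] exp_ge_add_one_self[of "\<epsilon> p"] by linarith
    qed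
    also have "\<dots> = exp (\<Sum>p\<in>P. \<epsilon> p)" using P by (simp add: exp_sum)
    also have "\<dots> \<le> exp (\<Sum>p. \<epsilon> p)" using sum_le_suminf[OF \<epsilon>(1) P(1)] \<epsilon>(2) by simp
    finally show "(\<Sum>n\<in>F. norm (f n)) \<le> exp (\<Sum>p. \<epsilon> p)" .
  qed
qed auto

section \<open>Lower bounds for logarithmic derivatives\<close>

text \<open>Re f < A means that f is closer to 0 than to 2A, so f / (2A - f) maps the disc into the
  unit disc and fixes 0. Schwarz's lemma bounds it by |z| / r, and solving for f gives the
  estimate.\<close>

lemma borel_caratheodory:
  fixes f :: "complex \<Rightarrow> complex"
  assumes hol: "f holomorphic_on ball 0 r" and f0: "f 0 = 0"
    and Re_le: "\<And>w. w \<in> ball 0 r \<Longrightarrow> Re (f w) < A" and z: "norm z \<le> \<rho>" "0 < \<rho>" "\<rho> < r"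
  shows "norm (f z) \<le> 2 * A * \<rho> / (r - \<rho>)"
proof -
  have A: "A > 0" using Re_le[of 0] f0 z by auto
  define \<psi> where "\<psi> = (\<lambda>w. f (of_real r * w) / (of_real (2 * A) - f (of_real r * w)))"
  have in_ball: "of_real r * w \<in> ball 0 r" if "norm w < 1" for w :: complex
    using that z by (simp add: norm_mult)
  have lt: "norm (f w) < norm (of_real (2 * A) - f w)" if "w \<in> ball 0 r" for w
  proof -
    have "0 < 4 * A * (A - Re (f w))" using A Re_le[OF that] by simp
    then have "(norm (f w))\<^sup>2 < (norm (of_real (2 * A) - f w))\<^sup>2"
      unfolding cmod_power2 by (simp add: power2_eq_square algebra_simps)
    then show ?thesis by (rule power2_less_imp_less) simp
  qed
  have ne: "of_real (2 * A) - f w \<noteq> 0" if "w \<in> ball 0 r" for w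
    using lt[OF that] by (metis norm_not_less_zero norm_zero)
  have "(f \<circ> (\<lambda>w. of_real r * w)) holomorphic_on ball 0 1"
    by (intro holomorphic_on_compose_gen[OF _ hol] holomorphic_intros) (auto intro: in_ball[simplified])
  then have fr: "(\<lambda>w. f (of_real r * w)) holomorphic_on ball 0 1" by (simp add: o_def)
  have "\<psi> holomorphic_on ball 0 1"
    unfolding \<psi>_def using ne in_ball by (intro holomorphic_intros fr) auto
  moreover have "norm (\<psi> w) < 1" if "norm w < 1" for w
    using lt[OF in_ball[OF that]] unfolding \<psi>_def norm_divide
    by (subst divide_less_eq_1) auto
  ultimately have sch: "norm (\<psi> w) \<le> norm w" if "norm w < 1" for w
    using Schwarz_Lemma(1)[of \<psi> w] that f0 by (simp add: \<psi>_def)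
  define t where "t = norm (\<psi> (z / of_real r))"
  have t: "t \<le> \<rho> / r"
  proof -
    have "t \<le> norm (z / of_real r)"
      unfolding t_def by (rule sch) (use z in \<open>simp add: norm_divide\<close>)
    also have "\<dots> \<le> \<rho> / r" using z by (simp add: norm_divide divide_right_mono)
    finally show ?thesis .
  qed
  have "norm (f z) = t * norm (of_real (2 * A) - f z)"
    using ne[of z] z by (simp add: t_def \<psi>_def norm_divide)
  also have "\<dots> \<le> t * (2 * A + norm (f z))"
    using A by (intro mult_left_mono order.trans[OF norm_triangle_ineq4]) (auto simp: t_def)
  also have "\<dots> \<le> \<rho> / r * (2 * A + norm (f z))"
    using A t by (intro mult_right_mono) auto
  finally have "norm (f z) * (r - \<rho>) \<le> 2 * A * \<rho>"
    using z by (simp add: field_simps)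
  then show ?thesis using z by (simp add: field_simps)
qed

lemma holomorphic_logarithm_deriv:
  assumes S: "convex S" "open S" and f: "f holomorphic_on S" "\<And>s. s \<in> S \<Longrightarrow> f s \<noteq> 0" and "z0 \<in> S"
  obtains g where "\<And>s. s \<in> S \<Longrightarrow> exp (g s) = f s"
    "\<And>s. s \<in> S \<Longrightarrow> (g has_field_derivative deriv f s / f s) (at s)"
proof -
  obtain g where g: "g holomorphic_on S" "\<And>s. s \<in> S \<Longrightarrow> exp (g s) = f s"
    using holomorphic_logarithm_exists[OF S f \<open>z0 \<in> S\<close>] by metis
  have "(g has_field_derivative deriv f s / f s) (at s)" if s: "s \<in> S" for s
  proof -
    have d: "(g has_field_derivative deriv g s) (at s)" by (rule holomorphic_derivI[OF g(1) S(2) s])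
    have "(f has_field_derivative exp (g s) * deriv g s) (at s)"
      by (rule has_field_derivative_transform_within_open[OF DERIV_fun_exp[OF d] S(2) s]) (simp add: g)
    then have "deriv f s = f s * deriv g s" using g(2)[OF s] by (simp add: DERIV_imp_deriv)
    then show ?thesis using d f(2)[OF s] by simp
  qed
  with g that show ?thesis by blast
qed

text \<open>On a zero-free disc the growth condition is an upper bound A for the real part of log (f
  / f 0). Borel-Caratheodory bounds this logarithm itself and Cauchy's inequality its
  derivative.\<close>

lemma norm_logderiv_le:
  fixes f :: "complex \<Rightarrow> complex"
  assumes hol: "f holomorphic_on ball 0 r" and nz: "\<And>w. w \<in> ball 0 r \<Longrightarrow> f w \<noteq> 0"
    and le: "\<And>w. w \<in> ball 0 r \<Longrightarrow> norm (f w) < norm (f 0) * exp A"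
    and r: "norm z \<le> r1" "0 < r1" "r1 < r"
  shows "norm (deriv f z / f z) \<le> 4 * A * (r + r1) / (r - r1)\<^sup>2"
proof -
  obtain g where g: "\<And>w. w \<in> ball 0 r \<Longrightarrow> exp (g w) = f w"
      "\<And>w. w \<in> ball 0 r \<Longrightarrow> (g has_field_derivative deriv f w / f w) (at w)"
    using holomorphic_logarithm_deriv[OF convex_ball open_ball hol nz, of 0] r by auto
  define \<phi> where "\<phi> = (\<lambda>w. g w - g 0)"
  have d\<phi>: "(\<phi> has_field_derivative deriv f w / f w) (at w)" if "w \<in> ball 0 r" for w
    unfolding \<phi>_def using DERIV_diff[OF g(2)[OF that] DERIV_const] by simp
  then have hol\<phi>: "\<phi> holomorphic_on ball 0 r"
    unfolding holomorphic_on_open[OF open_ball] by blast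
  \<comment> \<open>Midpoint: half of the gap r - r1 is spent on Borel-Caratheodory, half on
    Cauchy's inequality.\<close>
  define \<rho> where "\<rho> = (r + r1) / 2"
  have Re\<phi>: "Re (\<phi> w) < A" if "w \<in> ball 0 r" for w
  proof -
    have "exp (Re (g w)) < exp (Re (g 0) + A)"
      using le[OF that] g(1)[OF that, symmetric] g(1)[of 0, symmetric] r by (simp add: exp_add)
    then show ?thesis by (simp add: \<phi>_def)
  qed
  have bd: "norm (\<phi> w) \<le> 2 * A * \<rho> / (r - \<rho>)" if "norm w \<le> \<rho>" for w
    using borel_caratheodory[OF hol\<phi> _ Re\<phi> that] r by (simp add: \<rho>_def \<phi>_def)
  have sub: "cball z (\<rho> - r1) \<subseteq> cball 0 \<rho>"
  proof
    fix w assume "w \<in> cball z (\<rho> - r1)"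
    then show "w \<in> cball 0 \<rho>"
      using norm_triangle_ineq[of z "w - z"] r by (simp add: dist_norm norm_minus_commute)
  qed
  have sub2: "cball 0 \<rho> \<subseteq> ball (0::complex) r" using r by (auto simp: \<rho>_def)
  have "norm ((deriv ^^ 1) \<phi> z) \<le> fact 1 * (2 * A * \<rho> / (r - \<rho>)) / (\<rho> - r1) ^ 1"
  proof (rule Cauchy_inequality)
    show "\<phi> holomorphic_on ball z (\<rho> - r1)"
      using sub sub2 by (intro holomorphic_on_subset[OF hol\<phi>]) (meson ball_subset_cball order_trans)
    show "continuous_on (cball z (\<rho> - r1)) \<phi>"
      using sub sub2 by (intro holomorphic_on_imp_continuous_on holomorphic_on_subset[OF hol\<phi>]) auto
    show "norm (\<phi> x) \<le> 2 * A * \<rho> / (r - \<rho>)" if "norm (z - x) = \<rho> - r1" for x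
      using that sub by (intro bd) (auto simp: dist_norm subset_iff)
  qed (use r in \<open>simp add: \<rho>_def\<close>)
  also have "fact 1 * (2 * A * \<rho> / (r - \<rho>)) / (\<rho> - r1) ^ 1 = 4 * A * (r + r1) / (r - r1)\<^sup>2"
  proof -
    have "r - \<rho> = (r - r1) / 2" "\<rho> - r1 = (r - r1) / 2" by (simp_all add: \<rho>_def field_simps)
    then show ?thesis by (simp only:) (simp add: \<rho>_def power2_eq_square)
  qed
  finally have d: "norm (deriv \<phi> z) \<le> 4 * A * (r + r1) / (r - r1)\<^sup>2" by simp
  have "z \<in> ball 0 r" using r by simp
  then show ?thesis using d DERIV_imp_deriv[OF d\<phi>] by simp
qed

text \<open>Each zero in the smaller disc is divided out by a Blaschke factor. This raises
  \<open>|f 0|\<close> by at least the factor \<open>R / r\<close> but not the maximum on the circle, so the number of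
  zeros is controlled without Jensen's formula.\<close>

lemma Re_logderiv_ge:
  fixes f :: "complex \<Rightarrow> complex"
  assumes R: "0 < r1" "r1 < r" "r < R"
    and S: "open S" "cball 0 R \<subseteq> S"
    and hol: "f holomorphic_on S"
    and le: "\<And>w. w \<in> cball 0 R \<Longrightarrow> norm (f w) \<le> M"
    and zeros: "\<And>w. w \<in> cball 0 R \<Longrightarrow> f w = 0 \<Longrightarrow> Re w \<le> \<beta>"
    and n: "M < norm (f 0) * (R / r) ^ n"
    and z: "norm z \<le> r1" "\<beta> < Re z"
  shows "Re (deriv f z / f z) \<ge> - real n * (4 * ln (R / r) * (r + r1) / (r - r1)\<^sup>2 + r / (R\<^sup>2 - R * r))"
  using hol le zeros n
proof (induction n arbitrary: f)
  \<comment> \<open>For n = 0 the hypothesis on M contradicts the bound at the centre. Thus n limits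
    how many zeros can be divided out.\<close>
  case 0
  from 0(2)[of 0] 0(4) R have False by simp
  then show ?case ..
next
  case (Suc n f)
  define c1 where "c1 = 4 * ln (R / r) * (r + r1) / (r - r1)\<^sup>2"
  define c2 where "c2 = r / (R\<^sup>2 - R * r)"
  have c: "c1 \<ge> 0" "c2 \<ge> 0"
    using R by (auto simp: c1_def c2_def power2_eq_square intro!: divide_nonneg_nonneg mult_nonneg_nonneg)
  have M: "M \<ge> 0" using Suc.prems(2)[of 0] R by (auto intro: order.trans[OF norm_ge_zero])
  have f0: "f 0 \<noteq> 0" using Suc.prems(4) M by auto
  show ?case
  proof (cases "\<exists>a. norm a \<le> r \<and> f a = 0")
    case False
    \<comment> \<open>With no zero left in the disc of radius r, the hypothesis on M supplies |f| <
      |f 0| exp A with A = \<open>real (Suc n) * ln (R / r)\<close>.\<close>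
    have "norm (deriv f z / f z) \<le> 4 * (real (Suc n) * ln (R / r)) * (r + r1) / (r - r1)\<^sup>2"
    proof (rule norm_logderiv_le)
      show "f holomorphic_on ball 0 r"
        using R S by (intro holomorphic_on_subset[OF Suc.prems(1)]) force
      fix w :: complex assume w: "w \<in> ball 0 r"
      show "f w \<noteq> 0" using False w by auto
      have "norm (f w) \<le> M" using w R by (intro Suc.prems) auto
      also have "\<dots> < norm (f 0) * (R / r) ^ Suc n" by fact
      also have "(R / r) ^ Suc n = exp (real (Suc n) * ln (R / r))"
        using R by (subst exp_of_nat_mult) auto
      finally show "norm (f w) < norm (f 0) * exp (real (Suc n) * ln (R / r))" .
    qed (use z R in auto)
    also have "\<dots> = real (Suc n) * c1" by (simp add: c1_def)
    also have "\<dots> \<le> real (Suc n) * (c1 + c2)" using c by (intro mult_left_mono) auto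
    finally show ?thesis
      using abs_Re_le_cmod[of "deriv f z / f z"] unfolding c1_def c2_def by linarith
  next
    case True
    then obtain a where a: "norm a \<le> r" "f a = 0" by blast
    have a0: "a \<noteq> 0" using a f0 by auto
    have aS: "a \<in> S" using a R S by auto
    have Rea: "Re a \<le> \<beta>" using a R by (intro Suc.prems) auto
    define k where "k = (\<lambda>w. if w = a then deriv f a else (f w - f a) / (w - a))"
    have holk: "k holomorphic_on S"
      unfolding k_def by (rule pole_lemma_open[OF Suc.prems(1) S(1)])
    have fk: "f w = (w - a) * k w" for w
      using a by (auto simp: k_def)
    \<comment> \<open>\<open>k w * B w\<close> is f divided by the Blaschke factor of a: on |w| = R
      the modulus of \<open>B w\<close> is |w - a|, so the modulus of f is unchanged there.\<close>
    define B where "B = (\<lambda>w. (of_real (R\<^sup>2) - cnj a * w) / of_real R)"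
    have bpos: "norm (of_real (R\<^sup>2) - cnj a * w) \<ge> R\<^sup>2 - r * norm w" for w
    proof -
      have "norm (cnj a * w) \<le> r * norm w" using a by (simp add: norm_mult mult_right_mono)
      moreover have "norm (of_real (R\<^sup>2) - cnj a * w) \<ge> norm (of_real (R\<^sup>2) :: complex) - norm (cnj a * w)"
        by (rule norm_triangle_ineq2)
      ultimately show ?thesis by (simp add: norm_power)
    qed
    have pos: "R\<^sup>2 - r * norm w > 0" if "norm w \<le> R" for w :: complex
    proof -
      have "r * norm w \<le> r * R" using that R by (intro mult_left_mono) auto
      also have "\<dots> < R * R" using R by (intro mult_strict_right_mono) auto
      finally show ?thesis by (simp add: power2_eq_square)
    qed
    have Bne: "B w \<noteq> 0" if "w \<in> cball 0 R" for w
      using bpos[of w] pos[of w] that R by (auto simp: B_def)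
    define g where "g = (\<lambda>w. k w * B w)"
    have holg: "g holomorphic_on S"
      unfolding g_def B_def using R by (intro holomorphic_intros holk) auto
    have "- real n * (4 * ln (R / r) * (r + r1) / (r - r1)\<^sup>2 + r / (R\<^sup>2 - R * r)) \<le> Re (deriv g z / g z)"
    proof (rule Suc.IH[OF holg])
      fix w :: complex assume w: "w \<in> cball 0 R"
      show "norm (g w) \<le> M"
      proof (rule maximum_modulus_frontier[of g "cball 0 R"])
        show "g holomorphic_on interior (cball 0 R)"
          using S by (intro holomorphic_on_subset[OF holg]) auto
        show "continuous_on (closure (cball 0 R)) g"
          using S by (intro holomorphic_on_imp_continuous_on holomorphic_on_subset[OF holg]) auto
        fix v :: complex assume "v \<in> frontier (cball 0 R)"
        then have v: "norm v = R" by simp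
        have "of_real (R\<^sup>2) - cnj a * v = cnj (v - a) * v"
          using complex_norm_square[of v] v by (simp add: algebra_simps)
        then have "norm (B v) = norm (v - a)"
          using v R unfolding B_def by (simp only: norm_divide norm_mult complex_mod_cnj) simp
        then have "norm (g v) = norm (f v)"
          unfolding g_def fk by (simp add: norm_mult)
        then show "norm (g v) \<le> M" using Suc.prems(2)[of v] v by simp
      qed (use w in auto)
      show "Re w \<le> \<beta>" if "g w = 0"
        using that Bne[OF w] w by (intro Suc.prems) (auto simp: g_def fk)
    next
      \<comment> \<open>The modulus at the centre becomes |f 0| R / |a| with |a| \<le> r; this gain
        pays for lowering n by one.\<close>
      have "norm (f 0) * (R / r) \<le> norm (g 0)"
        using a a0 R unfolding g_def B_def fk[of 0]
        by (simp add: norm_mult norm_divide power2_eq_square field_simps mult_right_mono)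
      then have "norm (f 0) * (R / r) * (R / r) ^ n \<le> norm (g 0) * (R / r) ^ n"
        using R by (intro mult_right_mono) auto
      then show "M < norm (g 0) * (R / r) ^ n" using Suc.prems(4) by (simp add: mult.assoc)
    qed
    moreover have "Re (deriv f z / f z) \<ge> Re (deriv g z / g z) - c2"
    proof -
      have zR: "z \<in> cball 0 R" using z R by auto
      have zS: "z \<in> S" using zR S by auto
      have za: "z \<noteq> a" using z Rea by auto
      have fz: "f z \<noteq> 0" using Suc.prems(3)[OF zR] z by auto
      have kz: "k z \<noteq> 0" using fz fk[of z] by auto
      have dk: "(k has_field_derivative deriv k z) (at z)"
        by (rule holomorphic_derivI[OF holk S(1) zS])
      have "((\<lambda>w. (w - a) * k w) has_field_derivative (k z + (z - a) * deriv k z)) (at z)"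
        by (auto intro!: derivative_eq_intros dk)
      then have df: "deriv f z = k z + (z - a) * deriv k z"
        unfolding fk[abs_def] by (rule DERIV_imp_deriv)
      have "(g has_field_derivative (deriv k z * B z + k z * (- cnj a / of_real R))) (at z)"
        unfolding g_def B_def using R by (auto intro!: derivative_eq_intros dk simp: field_simps)
      then have dg: "deriv g z = deriv k z * B z + k z * (- cnj a / of_real R)"
        by (rule DERIV_imp_deriv)
      have e1: "deriv f z / f z = 1 / (z - a) + deriv k z / k z"
        unfolding df fk[of z] using za kz by (simp add: field_simps)
      have e2: "deriv g z / g z = deriv k z / k z - cnj a / of_real R / B z"
        unfolding dg using Bne[OF zR] kz by (simp add: g_def field_simps)
      have e3: "cnj a / of_real R / B z = cnj a / (of_real (R\<^sup>2) - cnj a * z)"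
        using R by (simp add: B_def)
      have eq: "deriv f z / f z = deriv g z / g z + 1 / (z - a) + cnj a / (of_real (R\<^sup>2) - cnj a * z)"
        unfolding e1 e2 e3 by simp
      have "Re (1 / (z - a)) \<ge> 0" using z Rea by (simp add: Re_divide)
      moreover have "norm (cnj a / (of_real (R\<^sup>2) - cnj a * z)) \<le> c2"
        unfolding norm_divide c2_def
      proof (rule frac_le)
        have "R * r \<ge> r * norm z" using z R by simp
        then show "R\<^sup>2 - R * r \<le> norm (of_real (R\<^sup>2) - cnj a * z)" using bpos[of z] by linarith
      qed (use a R in \<open>auto simp: power2_eq_square\<close>)
      ultimately show ?thesis
        unfolding eq using abs_Re_le_cmod[of "cnj a / (of_real (R\<^sup>2) - cnj a * z)"] by simp
    qed
    ultimately show ?thesis using c unfolding c1_def[symmetric] c2_def[symmetric]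
      by (simp add: algebra_simps)
  qed
qed

section \<open>The zeta function to the right of the critical line\<close>

text \<open>This is (s - 1) zeta(s), read off from the recurrence for \<open>dtail\<close> with two
  binomial terms removed. The formula makes sense for Re s > 0 and has no pole at 1, so no case
  distinction is needed there.\<close>

definition zeta_reg :: "complex \<Rightarrow> complex" where
  "zeta_reg s = (s - 1) + 2 powr (1 - s) + (\<Sum>n. zrem_term 2 n s)"

lemma zeta_reg_holomorphic: "zeta_reg holomorphic_on {s. Re s > 0}"
  unfolding zeta_reg_def using zrem_holomorphic[of 2] by (intro holomorphic_intros) auto

lemma zeta_reg_eq:
  assumes "Re s > 0" "s \<noteq> 1"
  shows "zeta_reg s = (s - 1) * zeta s"
proof (rule analytic_continuation_open[of "{s. Re s > 1}" "{s. Re s > 0} - {1}" zeta_reg "\<lambda>s. (s - 1) * zeta s"])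
  show "open ({s. Re s > 0} - {1})" by (intro open_Diff open_halfspace_Re_gt) auto
  show "connected ({s. Re s > 0} - {1 :: complex})"
    by (intro connected_open_delete convex_connected convex_halfspace_Re_gt open_halfspace_Re_gt) simp
  show "zeta_reg holomorphic_on {s. Re s > 0} - {1}"
    by (rule holomorphic_on_subset[OF zeta_reg_holomorphic]) auto
  show "(\<lambda>s. (s - 1) * zeta s) holomorphic_on {s. Re s > 0} - {1}"
    by (intro holomorphic_intros holomorphic_on_subset[OF zeta_holomorphic]) auto
  show "zeta_reg z = (z - 1) * zeta z" if "z \<in> {s. Re s > 1}" for z
  proof -
    have "(\<lambda>n. of_nat (Suc n) powr (- z)) sums (dtail z + 1)"
      using dtail_sums[of z] that sums_Suc_iff[of "\<lambda>n. of_nat (Suc n) powr (- z)" "dtail z"]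
      by (simp add: add_ac)
    then have "zeta z = dtail z + 1"
      using zeta_sums[of z] that sums_unique2 by blast
    then show ?thesis
      using dtail_recurrence[of z 0] that by (simp add: zeta_reg_def algebra_simps numeral_2_eq_2)
  qed
qed (use assms in \<open>auto simp: open_halfspace_Re_gt intro!: exI[of _ 2]\<close>)

lemma zeta_reg_1: "zeta_reg 1 = 1"
proof -
  have "zrem_term 2 n 1 = 0" for n
  proof -
    have "2 + complex_of_nat n \<noteq> 0" by (simp add: complex_eq_iff)
    moreover have "1 + 1 / (2 + complex_of_nat n) \<noteq> 0"
      using calculation by (simp add: field_simps) (simp add: complex_eq_iff)
    ultimately show ?thesis by (simp add: zrem_term_def numeral_2_eq_2)
  qed
  then show ?thesis by (simp add: zeta_reg_def)
qed

text \<open>The general bound \<open>norm_zrem_term_le\<close> grows exponentially in |s|, too fast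
  for controlling zeros. For two removed terms, \<open>zrem_term\<close> is the second-order Taylor
  remainder of z^(1-s) between n+2 and n+3, and the mean value inequality applied twice gives a
  bound polynomial in s.\<close>

lemma norm_zrem_term_2_le:
  assumes "Re s > 0"
  shows "norm (zrem_term 2 n s) \<le> norm s * norm (s - 1) * real (n + 2) powr (- Re s - 1)"
proof -
  define a where "a = real (n + 2)"
  have a: "a > 0" by (simp add: a_def)
  define S where "S = closed_segment (complex_of_real a) (of_real (a + 1))"
  have S: "\<exists>t. z = of_real t \<and> a \<le> t \<and> t \<le> a + 1" if "z \<in> S" for z
    using that unfolding S_def closed_segment_of_real by (auto simp: closed_segment_eq_real_ivl)
  have ends: "of_real a \<in> S" "of_real (a + 1) \<in> S" by (auto simp: S_def)
  have cS: "convex S" by (simp add: S_def)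
  have npowr: "norm (z powr w) \<le> a powr Re w" if "z \<in> S" "Re w \<le> 0" for z w
  proof -
    obtain t where t: "z = of_real t" "a \<le> t" using S[OF \<open>z \<in> S\<close>] by blast
    then have "norm (z powr w) = t powr Re w" using a by (simp add: norm_powr_real_powr)
    also have "\<dots> \<le> a powr Re w" using t a that by (intro powr_mono2') auto
    finally show ?thesis .
  qed
  have npr: "z \<notin> \<real>\<^sub>\<le>\<^sub>0" if "z \<in> S" for z using S[OF that] a by auto
  have b1: "norm (z powr (- s) - of_real a powr (- s)) \<le> norm s * a powr (- Re s - 1)" if z: "z \<in> S" for z
  proof -
    have "norm (z powr (- s) - of_real a powr (- s)) \<le> norm s * a powr (- Re s - 1) * norm (z - of_real a)"
    proof (rule field_differentiable_bound[OF cS _ _ z ends(1)])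
      fix w assume w: "w \<in> S"
      show "((\<lambda>z. z powr (- s)) has_field_derivative (- s) * w powr (- s - 1)) (at w within S)"
        using npr[OF w] by (auto intro!: derivative_eq_intros)
      show "norm ((- s) * w powr (- s - 1)) \<le> norm s * a powr (- Re s - 1)"
        using npowr[OF w, of "- s - 1"] assms by (auto simp: norm_mult intro!: mult_left_mono)
    qed
    also have "\<dots> \<le> norm s * a powr (- Re s - 1) * 1"
      using S[OF z] by (intro mult_left_mono) (auto simp flip: of_real_diff)
    finally show ?thesis by (simp add: mult_left_mono)
  qed
  \<comment> \<open>z^(1-s) minus the linear function of the same slope at a; its increment over the
    unit step is the remainder.\<close>
  define f where "f = (\<lambda>z. z powr (1 - s) - (1 - s) * z * of_real a powr (- s))"
  have "norm (f (of_real (a + 1)) - f (of_real a)) \<le>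
      norm (1 - s) * (norm s * a powr (- Re s - 1)) * norm (of_real (a + 1) - complex_of_real a)"
  proof (rule field_differentiable_bound[OF cS _ _ ends(2,1)])
    fix w assume w: "w \<in> S"
    show "(f has_field_derivative (1 - s) * (w powr (- s) - of_real a powr (- s))) (at w within S)"
      unfolding f_def using npr[OF w] by (auto intro!: derivative_eq_intros simp: algebra_simps)
    show "norm ((1 - s) * (w powr (- s) - of_real a powr (- s))) \<le> norm (1 - s) * (norm s * a powr (- Re s - 1))"
      unfolding norm_mult by (intro mult_left_mono b1 w) auto
  qed
  also have "f (of_real (a + 1)) - f (of_real a) = zrem_term 2 n s"
  proof -
    have "zrem_term 2 n s = zrem_term 0 n s - of_nat (n + 2) powr (1 - s) *
        (1 + (1 - s) * of_real (1 / real (n + 2)))"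
      by (simp add: zrem_term_def numeral_2_eq_2 algebra_simps)
    also have "of_nat (n + 2) = complex_of_real a" by (simp add: a_def)
    also have "zrem_term 0 n s = of_real (a + 1) powr (1 - s)"
      by (simp add: zrem_term_0 a_def add_ac)
    also have "of_real (1 / real (n + 2)) = 1 / complex_of_real a" by (simp add: a_def)
    also have "of_real a powr (1 - s) * (1 + (1 - s) * (1 / complex_of_real a)) =
        of_real a powr (1 - s) + (1 - s) * of_real a powr (- s)"
    proof -
      have "complex_of_real a powr (1 - s) = of_real a * of_real a powr (- s)"
        using a by (simp add: powr_diff powr_minus divide_inverse)
      then show ?thesis using a by (simp add: field_simps)
    qed
    finally show ?thesis by (simp add: f_def algebra_simps)
  qed
  finally show ?thesis by (simp add: a_def norm_minus_commute mult_ac)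
qed

text \<open>The strip starts at 1/4 because the discs of radius 7/4 about 2 + it, on which zeros are
  divided out, reach that far. Polynomial growth is what limits the number of these zeros to O(log
  t).\<close>

lemma norm_zeta_reg_le:
  obtains C where "C > 0" "\<And>s. Re s \<ge> 1 / 4 \<Longrightarrow> norm (zeta_reg s) \<le> C * (norm s + 1) ^ 2"
proof -
  define Z where "Z = (\<Sum>n. real (n + 2) powr (- (5 / 4)))"
  have sm: "summable (\<lambda>n. real (n + 2) powr (- (5 / 4)))"
    by (rule summable_shift2_powr) simp
  have Z: "Z \<ge> 0" unfolding Z_def by (intro suminf_nonneg sm) auto
  have "norm (zeta_reg s) \<le> (3 + Z) * (norm s + 1) ^ 2" if s: "Re s \<ge> 1 / 4" for s
  proof -
    have t: "norm (zrem_term 2 n s) \<le> norm s * norm (s - 1) * real (n + 2) powr (- (5 / 4))" for n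
      by (rule order.trans[OF norm_zrem_term_2_le], use s in simp, intro mult_left_mono powr_mono)
        (use s in auto)
    have "norm (\<Sum>n. zrem_term 2 n s) \<le> (\<Sum>n. norm s * norm (s - 1) * real (n + 2) powr (- (5 / 4)))"
      by (rule norm_suminf_le[OF t]) (intro summable_mult sm)
    also have "\<dots> = norm s * norm (s - 1) * Z"
      unfolding Z_def by (rule suminf_mult[OF sm])
    finally have a: "norm (\<Sum>n. zrem_term 2 n s) \<le> norm s * norm (s - 1) * Z" .
    have b: "norm ((2::complex) powr (1 - s)) \<le> 2"
    proof -
      have "norm ((2::complex) powr (1 - s)) = 2 powr (1 - Re s)"
        using norm_powr_real_powr[of 2 "1 - s"] by simp
      also have "\<dots> \<le> 2 powr 1" using s by (intro powr_mono) auto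
      finally show ?thesis by simp
    qed
    have c: "norm (s - 1) \<le> norm s + 1" using norm_triangle_ineq4[of s 1] by simp
    have "norm (zeta_reg s) \<le> (norm s + 1) + 2 + norm s * norm (s - 1) * Z"
      unfolding zeta_reg_def
      by (intro order.trans[OF norm_triangle_ineq] add_mono a b c)
    also have "\<dots> \<le> (norm s + 1) ^ 2 + 2 * (norm s + 1) ^ 2 + (norm s + 1) * (norm s + 1) * Z"
    proof (intro add_mono mult_right_mono mult_mono)
      have "(1::real) \<le> (norm s + 1)^2" "norm s + 1 \<le> (norm s + 1)^2"
        by (auto simp: power2_eq_square algebra_simps)
      then show "norm s + 1 \<le> (norm s + 1) ^ 2" "2 \<le> 2 * (norm s + 1) ^ 2" by auto
    qed (use c Z in auto)
    also have "\<dots> = (3 + Z) * (norm s + 1) ^ 2" by (simp add: power2_eq_square algebra_simps)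
    finally show ?thesis .
  qed
  with that[of "3 + Z"] Z show ?thesis by auto
qed

section \<open>The Dirichlet series of zeta and of its reciprocal\<close>

lemma mult_fn_powr: "mult_fn (\<lambda>n. of_nat n powr s :: complex)"
  unfolding mult_fn_def
proof (intro conjI allI impI)
  fix p j n :: nat
  show "(of_nat (p ^ j * n) powr s :: complex) = of_nat (p ^ j) powr s * of_nat n powr s"
    using powr_times_real[of "of_nat (p ^ j)" "of_nat n" s] by simp
qed simp

lemma has_sum_geometric_complex:
  fixes z :: complex
  assumes "norm z < 1"
  shows "((\<lambda>j. z ^ j) has_sum 1 / (1 - z)) UNIV"
  using assms geometric_sums[OF assms]
  by (intro norm_summable_imp_has_sum) (auto simp: norm_power intro: summable_geometric)

lemma of_nat_power_powr: "(of_nat (p ^ j) powr s :: complex) = (of_nat p powr s) ^ j"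
proof (induction j)
  case (Suc j)
  then show ?case
    using powr_times_real[of "of_nat p" "of_nat (p ^ j)" s] by simp
qed simp

lemma norm_prime_powr_less_1:
  assumes "prime p" "Re s > 0"
  shows "norm (of_nat p powr (- s) :: complex) < 1"
proof -
  have "norm (of_nat p powr (- s) :: complex) = real p powr (- Re s)"
    by (simp add: norm_powr_real_powr)
  also have "\<dots> < 1" using prime_gt_1_nat[OF assms(1)] assms(2) by (simp add: powr_less_one)
  finally show ?thesis .
qed

lemma powr_summable_on:
  assumes "\<sigma> > 1"
  shows "(\<lambda>n. real n powr (- \<sigma>)) summable_on {0<..}"
proof -
  have "(\<lambda>n. real n powr (- \<sigma>)) summable_on UNIV"
    using assms by (intro norm_summable_imp_summable_on) (simp add: summable_real_powr_iff)
  then show ?thesis by (rule summable_on_subset_banach) auto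
qed

lemma zeta_has_sum:
  assumes "Re s > 1"
  shows "((\<lambda>n. of_nat n powr (- s)) has_sum zeta s) {0<..}"
proof -
  have sm: "summable (\<lambda>n. norm (of_nat n powr (- s) :: complex))"
    using assms by (simp add: norm_powr_real_powr summable_real_powr_iff)
  have "(\<lambda>n. of_nat n powr (- s)) sums (zeta s + of_nat 0 powr (- s))"
    using zeta_sums[OF assms] by (subst (asm) sums_Suc_iff) simp
  then have "((\<lambda>n. of_nat n powr (- s)) has_sum zeta s) UNIV"
    using sm by (intro norm_summable_imp_has_sum) auto
  then show ?thesis
    by (rule has_sum_cong_neutral[THEN iffD1, rotated -1]) auto
qed

lemma zeta_euler_product:
  assumes "Re s > 1"
  shows "(\<lambda>N. \<Prod>p | prime p \<and> p \<le> N. 1 / (1 - of_nat p powr (- s))) \<longlonglongrightarrow> zeta s"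
proof -
  have lim: "(\<lambda>N. \<Prod>p | prime p \<and> p \<le> N. \<Sum>\<^sub>\<infinity>j. of_nat (p ^ j) powr (- s)) \<longlonglongrightarrow>
      (\<Sum>\<^sub>\<infinity>n\<in>{0<..}. of_nat n powr (- s) :: complex)"
    using powr_summable_on[OF assms]
    by (intro euler_product_LIMSEQ mult_fn_powr) (simp add: norm_powr_real_powr)
  have loc: "(\<Sum>\<^sub>\<infinity>j. of_nat (p ^ j) powr (- s) :: complex) = 1 / (1 - of_nat p powr (- s))"
    if "prime p" for p
    using has_sum_geometric_complex[OF norm_prime_powr_less_1[OF that]] assms
    by (subst of_nat_power_powr) (simp add: infsumI)
  have "(\<Prod>p | prime p \<and> p \<le> N. \<Sum>\<^sub>\<infinity>j. of_nat (p ^ j) powr (- s)) =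
      (\<Prod>p | prime p \<and> p \<le> N. 1 / (1 - of_nat p powr (- s) :: complex))" for N
    by (rule prod.cong[OF refl], rule loc) simp
  with lim show ?thesis
    unfolding infsumI[OF zeta_has_sum[OF assms]] by (simp only:)
qed

definition mu :: "nat \<Rightarrow> real" where
  "mu = mfun (\<lambda>j. if j = 0 then 1 else if j = 1 then -1 else 0)"

lemma mult_fn_mu: "mult_fn mu"
  and mu_prime_power: "prime p \<Longrightarrow> mu (p ^ j) = (if j = 0 then 1 else if j = 1 then -1 else 0)"
  unfolding mu_def by (rule mult_fn_mfun mfun_prime_power; simp)+

lemma abs_mu_le: "\<bar>mu n\<bar> \<le> 1"
  unfolding mu_def mfun_def abs_prod by (intro prod_le_1) auto

text \<open>The Euler factors 1 - p^(-s) of this series are reciprocal to those of zeta, so the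
  partial products multiply to 1. Passing to the limit gives the value of the series and the
  non-vanishing of zeta together.\<close>

lemma mu_has_sum:
  assumes s: "Re s > 1"
  shows "((\<lambda>n. of_real (mu n) * of_nat n powr (- s)) has_sum 1 / zeta s) {0<..}"
    and zeta_nonzero_Re_gt_1: "zeta s \<noteq> 0"
    and "(\<lambda>n. norm (of_real (mu n) * of_nat n powr (- s) :: complex)) summable_on {0<..}"
proof -
  let ?f = "\<lambda>n. of_real (mu n) * of_nat n powr (- s) :: complex"
  have mf: "mult_fn ?f"
    using mult_fn_mu by (intro mult_fn_times mult_fn_powr) (auto simp: mult_fn_def)
  show sm: "(\<lambda>n. norm (?f n)) summable_on {0<..}"
    by (rule summable_on_comparison_test[OF powr_summable_on[OF s]])
      (auto simp: norm_mult norm_powr_real_powr abs_mu_le mult_left_le_one_le)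
  have loc: "(\<Sum>\<^sub>\<infinity>j. ?f (p ^ j)) = 1 - of_nat p powr (- s)" if p: "prime p" for p
  proof -
    have "(\<Sum>\<^sub>\<infinity>j. ?f (p ^ j)) = (\<Sum>\<^sub>\<infinity>j\<in>{0,1}. ?f (p ^ j))"
      by (intro infsum_cong_neutral) (auto simp: mu_prime_power[OF p])
    also have "\<dots> = 1 - of_nat p powr (- s)"
      using mu_prime_power[OF p, of 0] mu_prime_power[OF p, of 1] by simp
    finally show ?thesis .
  qed
  have "(\<Prod>p | prime p \<and> p \<le> N. \<Sum>\<^sub>\<infinity>j. ?f (p ^ j)) =
      (\<Prod>p | prime p \<and> p \<le> N. 1 - of_nat p powr (- s))" for N
    by (rule prod.cong[OF refl], rule loc) simp
  with euler_product_LIMSEQ[OF mf sm]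
  have "(\<lambda>N. \<Prod>p | prime p \<and> p \<le> N. 1 - of_nat p powr (- s)) \<longlonglongrightarrow> infsum ?f {0<..}"
    by (simp only:)
  from tendsto_mult[OF this zeta_euler_product[OF s]]
  have "(\<lambda>N. (\<Prod>p | prime p \<and> p \<le> N. 1 - of_nat p powr (- s)) * (\<Prod>p | prime p \<and> p \<le> N. 1 / (1 - of_nat p powr (- s))))
      \<longlonglongrightarrow> infsum ?f {0<..} * zeta s" .
  moreover have "(\<Prod>p | prime p \<and> p \<le> N. 1 - of_nat p powr (- s)) *
      (\<Prod>p | prime p \<and> p \<le> N. 1 / (1 - of_nat p powr (- s) :: complex)) = 1" for N
    unfolding prod.distrib[symmetric]
  proof (intro prod.neutral ballI)
    fix p :: nat assume "p \<in> {p. prime p \<and> p \<le> N}"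
    then have "of_nat p powr (- s) \<noteq> (1 :: complex)"
      using norm_prime_powr_less_1[of p s] s by auto
    then show "(1 - of_nat p powr (- s)) * (1 / (1 - of_nat p powr (- s) :: complex)) = 1" by simp
  qed
  ultimately have 1: "infsum ?f {0<..} * zeta s = 1" by (simp add: LIMSEQ_const_iff)
  then show nz: "zeta s \<noteq> 0" by auto
  then have "infsum ?f {0<..} = 1 / zeta s" using 1 by (simp add: field_simps)
  then show "(?f has_sum 1 / zeta s) {0<..}"
    using has_sum_infsum[OF abs_summable_summable[OF sm]] by simp
qed

lemma norm_zeta_le:
  assumes "\<sigma> > 1" "Re s \<ge> \<sigma>"
  shows "norm (zeta s) \<le> (\<Sum>\<^sub>\<infinity>n\<in>{0<..}. real n powr (- \<sigma>))"
    and "norm (1 / zeta s) \<le> (\<Sum>\<^sub>\<infinity>n\<in>{0<..}. real n powr (- \<sigma>))"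
proof -
  have s: "Re s > 1" using assms by simp
  have le: "real n powr (- Re s) \<le> real n powr (- \<sigma>)" if "n > 0" for n
    using that assms by (intro powr_mono) auto
  have "((\<lambda>n. real n powr (- \<sigma>)) has_sum (\<Sum>\<^sub>\<infinity>n\<in>{0<..}. real n powr (- \<sigma>))) {0<..}"
    using powr_summable_on[OF assms(1)] by (rule has_sum_infsum)
  note * = norm_infsum_le[OF _ this]
  show "norm (zeta s) \<le> (\<Sum>\<^sub>\<infinity>n\<in>{0<..}. real n powr (- \<sigma>))"
    by (rule *[OF zeta_has_sum[OF s]]) (auto simp: norm_powr_real_powr intro!: le)
  show "norm (1 / zeta s) \<le> (\<Sum>\<^sub>\<infinity>n\<in>{0<..}. real n powr (- \<sigma>))"
    by (rule *[OF mu_has_sum(1)[OF s]])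
      (auto simp: norm_mult norm_powr_real_powr intro!: order.trans[OF mult_right_mono[OF abs_mu_le]] le)
qed

section \<open>Non-vanishing on the line Re s = 1\<close>

text \<open>The real part of -log (1 - z) is the sum of Re z^n / n, and 3 + 4 cos \<theta> + cos
  2\<theta> = 2 (1 + cos \<theta>)^2 is nonnegative; with cos \<theta> = Re u^n this settles the
  sign of every term.\<close>

lemma ln_norm_one_minus_le_0:
  fixes u :: complex
  assumes u: "norm u = 1" and r: "0 < r" "r < 1"
  shows "3 * ln (1 - r) + 4 * ln (norm (1 - of_real r * u)) + ln (norm (1 - of_real r * u\<^sup>2)) \<le> 0"
proof -
  have sums: "(\<lambda>n. - (r ^ n * Re (v ^ n)) / real n) sums ln (norm (1 - of_real r * v))"
    if v: "norm v = 1" for v :: complex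
  proof -
    have "(\<lambda>n. - ((- (- (of_real r * v))) ^ n) / of_nat n) sums ln (1 + (- (of_real r * v)))"
      by (rule Ln_series') (use v r in \<open>simp add: norm_mult\<close>)
    then have "(\<lambda>n. Re (- ((of_real r * v) ^ n) / of_nat n)) sums Re (ln (1 - of_real r * v))"
      by (intro sums_Re) simp
    moreover have "Re (ln (1 - of_real r * v)) = ln (norm (1 - of_real r * v))"
    proof (rule Re_Ln)
      have "norm (of_real r * v) = r" using v r by (simp add: norm_mult)
      then have "of_real r * v \<noteq> 1" using r by (metis norm_one less_irrefl)
      then show "1 - of_real r * v \<noteq> 0" by simp
    qed
    moreover have "Re (- ((of_real r * v) ^ n) / of_nat n) = - (r ^ n * Re (v ^ n)) / real n" for n
    proof -
      have "(of_real r * v) ^ n = of_real (r ^ n) * v ^ n" by (simp add: power_mult_distrib)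
      then have "- ((of_real r * v) ^ n) / of_nat n = of_real (- (r ^ n) / real n) * v ^ n" by simp
      then show ?thesis by (simp only:) (simp del: of_real_divide of_real_minus of_real_power)
    qed
    ultimately show ?thesis by (simp only:)
  qed
  have "(\<lambda>n. - (r ^ n * Re (1 ^ n)) / real n) sums ln (norm (1 - of_real r * (1::complex)))"
    by (rule sums) simp
  moreover have "norm (1 - of_real r * (1::complex)) = 1 - r"
    using r by (metis abs_of_pos diff_gt_0_iff_gt mult.right_neutral norm_of_real of_real_1 of_real_diff)
  ultimately have S: "(\<lambda>n. 3 * (- (r ^ n * Re (1 ^ n)) / real n) + 4 * (- (r ^ n * Re (u ^ n)) / real n)
      + (- (r ^ n * Re ((u\<^sup>2) ^ n)) / real n)) sums
      (3 * ln (1 - r) + 4 * ln (norm (1 - of_real r * u)) + ln (norm (1 - of_real r * u\<^sup>2)))"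
    using u by (intro sums_add sums_mult sums) (auto simp: norm_power)
  have le: "3 * (- (r ^ n * Re (1 ^ n)) / real n) + 4 * (- (r ^ n * Re (u ^ n)) / real n)
      + (- (r ^ n * Re ((u\<^sup>2) ^ n)) / real n) \<le> 0" for n
  proof -
    define c where "c = Re (u ^ n)"
    have "(norm (u ^ n))\<^sup>2 = 1" using u by (simp add: norm_power)
    then have "(Im (u ^ n))\<^sup>2 = 1 - c\<^sup>2" by (simp add: cmod_power2 c_def)
    moreover have "(u\<^sup>2) ^ n = (u ^ n)\<^sup>2" by (simp add: power_mult[symmetric] mult.commute)
    ultimately have Re2: "Re ((u\<^sup>2) ^ n) = 2 * c\<^sup>2 - 1" by (simp add: Re_power2 c_def)
    \<comment> \<open>At n = 0 both sides vanish by division by zero, which matches the missing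
      constant term of the logarithm.\<close>
    have "3 * (- (r ^ n * Re (1 ^ n)) / real n) + 4 * (- (r ^ n * Re (u ^ n)) / real n)
      + (- (r ^ n * Re ((u\<^sup>2) ^ n)) / real n) = - (r ^ n * (2 * (1 + c)\<^sup>2) / real n)"
      unfolding Re2 c_def[symmetric] by (cases "n = 0") (simp_all add: field_simps power2_eq_square)
    also have "\<dots> \<le> 0" using r by simp
    finally show ?thesis .
  qed
  show ?thesis by (rule sums_le[OF le S sums_zero])
qed

text \<open>For a single prime this is \<open>ln_norm_one_minus_le_0\<close> with r = p^(-\<sigma>)
  and u = p^(-it), so that u^2 belongs to the ordinate 2t. The inequality is multiplied over p \<le>
  N and survives the limit.\<close>

lemma zeta_3_4_1:
  assumes "\<sigma> > 1"
  shows "norm (zeta (of_real \<sigma>)) ^ 3 * norm (zeta (Complex \<sigma> t)) ^ 4 * norm (zeta (Complex \<sigma> (2 * t))) \<ge> 1"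
proof -
  let ?P = "\<lambda>s N. \<Prod>p | prime p \<and> p \<le> N. 1 / (1 - of_nat p powr (- s)) :: complex"
  have "(\<lambda>N. norm (?P (of_real \<sigma>) N) ^ 3 * norm (?P (Complex \<sigma> t) N) ^ 4 * norm (?P (Complex \<sigma> (2 * t)) N))
      \<longlonglongrightarrow> norm (zeta (of_real \<sigma>)) ^ 3 * norm (zeta (Complex \<sigma> t)) ^ 4 * norm (zeta (Complex \<sigma> (2 * t)))"
    using assms by (intro tendsto_intros zeta_euler_product) auto
  moreover have "norm (?P (of_real \<sigma>) N) ^ 3 * norm (?P (Complex \<sigma> t) N) ^ 4 * norm (?P (Complex \<sigma> (2 * t)) N) \<ge> 1" for N
  proof -
    have "norm (?P (of_real \<sigma>) N) ^ 3 * norm (?P (Complex \<sigma> t) N) ^ 4 * norm (?P (Complex \<sigma> (2 * t)) N) =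
      (\<Prod>p | prime p \<and> p \<le> N. norm (1 / (1 - of_nat p powr (- of_real \<sigma>)) :: complex) ^ 3 *
         norm (1 / (1 - of_nat p powr (- Complex \<sigma> t)) :: complex) ^ 4 *
         norm (1 / (1 - of_nat p powr (- Complex \<sigma> (2 * t))) :: complex))"
      by (simp only: prod_norm[symmetric] prod_power_distrib[symmetric] prod.distrib)
    also have "\<dots> \<ge> 1"
    proof (intro prod_ge_1)
      fix p assume "p \<in> {p. prime p \<and> p \<le> N}"
      then have p: "prime p" by simp
      have p1: "real p > 1" using prime_gt_1_nat[OF p] by simp
      define r where "r = real p powr (- \<sigma>)"
      define u where "u = (of_nat p :: complex) powr (- (\<i> * of_real t))"
      have r: "0 < r" "r < 1" using p1 assms by (auto simp: r_def powr_less_one)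
      have u: "norm u = 1" using p1 by (simp add: u_def norm_powr_real_powr)
      have e: "(of_nat p :: complex) powr (- Complex \<sigma> y) = of_real r * of_nat p powr (- (\<i> * of_real y))" for y
      proof -
        have "- Complex \<sigma> y = of_real (- \<sigma>) + (- (\<i> * of_real y))" by (simp add: complex_eq_iff)
        then have "(of_nat p :: complex) powr (- Complex \<sigma> y) =
            of_nat p powr of_real (- \<sigma>) * of_nat p powr (- (\<i> * of_real y))"
          by (simp only: powr_add)
        also have "(of_nat p :: complex) powr of_real (- \<sigma>) = of_real r"
          unfolding r_def using p1 powr_of_real[of "real p" "- \<sigma>"] by simp
        finally show ?thesis .
      qed
      have u2: "u\<^sup>2 = (of_nat p :: complex) powr (- (\<i> * of_real (2 * t)))"
      proof -
        have "u\<^sup>2 = (of_nat p :: complex) powr (- (\<i> * of_real t) + - (\<i> * of_real t))"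
          unfolding u_def power2_eq_square by (simp only: powr_add)
        also have "- (\<i> * of_real t) + - (\<i> * of_real t) = - (\<i> * complex_of_real (2 * t))" by simp
        finally show ?thesis .
      qed
      have e0: "(of_nat p :: complex) powr (- of_real \<sigma>) = of_real r"
        unfolding r_def using p1 powr_of_real[of "real p" "- \<sigma>"] by simp
      define a b c where "a = 1 - r" and "b = norm (1 - of_real r * u)" and "c = norm (1 - of_real r * u\<^sup>2)"
      have ne: "norm (of_real r * v) < 1" if "norm v = 1" for v :: complex using that r by (simp add: norm_mult)
      have bpos: "b > 0" unfolding b_def using ne[OF u] norm_one[where 'a = complex] by fastforce
      have cpos: "c > 0" unfolding c_def using ne[of "u\<^sup>2"] u
        norm_one[where 'a = complex] by (fastforce simp: norm_power)
      have apos: "a > 0" using r by (simp add: a_def)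
      have "ln (a ^ 3 * b ^ 4 * c) = 3 * ln a + 4 * ln b + ln c"
        using apos bpos cpos by (simp add: ln_mult ln_realpow)
      also have "\<dots> \<le> 0" unfolding a_def b_def c_def by (rule ln_norm_one_minus_le_0[OF u r])
      finally have "a ^ 3 * b ^ 4 * c \<le> 1" using apos bpos cpos by (simp add: ln_le_zero_iff)
      then have "1 \<le> (1 / a) ^ 3 * (1 / b) ^ 4 * (1 / c)"
        using one_le_inverse[of "a ^ 3 * b ^ 4 * c"] apos bpos cpos
        by (simp add: inverse_eq_divide power_divide)
      also have "1 / a = norm (1 / (1 - of_nat p powr (- of_real \<sigma>)) :: complex)"
      proof -
        have "norm (1 - complex_of_real r) = a"
          using r norm_of_real[of "1 - r", where 'a = complex] by (simp add: a_def)
        then show ?thesis unfolding e0 by (simp add: norm_divide)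
      qed
      also have "1 / b = norm (1 / (1 - of_nat p powr (- Complex \<sigma> t)) :: complex)"
        by (simp only: e b_def u_def norm_divide norm_one)
      also have "1 / c = norm (1 / (1 - of_nat p powr (- Complex \<sigma> (2 * t))) :: complex)"
        by (simp only: e c_def u2 norm_divide norm_one)
      finally show "1 \<le> norm (1 / (1 - of_nat p powr (- of_real \<sigma>)) :: complex) ^ 3 *
         norm (1 / (1 - of_nat p powr (- Complex \<sigma> t)) :: complex) ^ 4 *
         norm (1 / (1 - of_nat p powr (- Complex \<sigma> (2 * t))) :: complex)" .
    qed
    finally show ?thesis .
  qed
  ultimately show ?thesis by (elim LIMSEQ_le_const) blast
qed

text \<open>\<open>riemann_hypothesis\<close> speaks of the open strip only, so the line Re s = 1 is
  treated unconditionally by the classical argument. A zero at 1 + it would contribute (\<sigma> -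
  1)^4 to the 3-4-1 product against a pole of order 3 and force it to 0 as \<sigma> tends to
  1.\<close>

lemma zeta_nonzero_Re_1:
  assumes t: "t \<noteq> 0"
  shows "zeta (Complex 1 t) \<noteq> 0"
proof
  assume z: "zeta (Complex 1 t) = 0"
  have ana: "zeta field_differentiable at (Complex 1 y)" if "y \<noteq> 0" for y
    using zeta_holomorphic that by (auto simp: holomorphic_on_open open_Compl field_differentiable_def complex_eq_iff)
  have lin: "((\<lambda>\<sigma>. Complex \<sigma> y) \<longlongrightarrow> Complex 1 y) (at_right 1)" for y
    by (intro tendsto_intros)
  have "((\<lambda>w. (zeta w - zeta (Complex 1 t)) / (w - Complex 1 t)) \<longlongrightarrow> deriv zeta (Complex 1 t)) (at (Complex 1 t))"
    using ana[OF t] by (simp add: DERIV_deriv_iff_field_differentiable flip: has_field_derivative_iff)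
  moreover have "filterlim (\<lambda>\<sigma>. Complex \<sigma> t) (at (Complex 1 t)) (at_right 1)"
    unfolding filterlim_at using lin by (auto simp: eventually_at_filter)
  ultimately have "((\<lambda>\<sigma>. (zeta (Complex \<sigma> t) - zeta (Complex 1 t)) / (Complex \<sigma> t - Complex 1 t)) \<longlongrightarrow>
      deriv zeta (Complex 1 t)) (at_right 1)"
    by (rule filterlim_compose)
  moreover have "Complex \<sigma> t - Complex 1 t = of_real (\<sigma> - 1)" for \<sigma> by (simp add: complex_eq_iff)
  ultimately have l1: "((\<lambda>\<sigma>. zeta (Complex \<sigma> t) / of_real (\<sigma> - 1)) \<longlongrightarrow> deriv zeta (Complex 1 t)) (at_right 1)"
    using z by simp
  have "isCont zeta_reg 1"
    using zeta_reg_holomorphic holomorphic_on_imp_continuous_on[of zeta_reg "{s. Re s > 0}"]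
    by (auto simp: continuous_on_eq_continuous_at open_halfspace_Re_gt)
  moreover have "((\<lambda>\<sigma>. complex_of_real \<sigma>) \<longlongrightarrow> of_real 1) (at_right 1)"
    by (intro tendsto_intros)
  ultimately have l2: "((\<lambda>\<sigma>. zeta_reg (of_real \<sigma>)) \<longlongrightarrow> zeta_reg 1) (at_right 1)"
    by (intro isCont_tendsto_compose[of 1 zeta_reg]) auto
  have "isCont zeta (Complex 1 (2 * t))"
    using ana[of "2 * t"] t by (intro field_differentiable_imp_continuous_at) auto
  then have l3: "((\<lambda>\<sigma>. zeta (Complex \<sigma> (2 * t))) \<longlongrightarrow> zeta (Complex 1 (2 * t))) (at_right 1)"
    using lin by (rule isCont_tendsto_compose)
  \<comment> \<open>The 3-4-1 product with the powers of \<sigma> - 1 redistributed: three remove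
    the pole of zeta at 1, four are divided out of the supposed zero, and one is left over.\<close>
  let ?E = "\<lambda>\<sigma>. norm (zeta_reg (of_real \<sigma>)) ^ 3 * norm (zeta (Complex \<sigma> t) / of_real (\<sigma> - 1)) ^ 4 *
      norm (zeta (Complex \<sigma> (2 * t))) * (\<sigma> - 1)"
  have "((\<lambda>\<sigma>. ?E \<sigma>) \<longlongrightarrow>
      norm (zeta_reg 1) ^ 3 * norm (deriv zeta (Complex 1 t)) ^ 4 * norm (zeta (Complex 1 (2 * t))) * (1 - 1)) (at_right 1)"
    by (intro tendsto_intros l1 l2 l3)
  moreover have "eventually (\<lambda>\<sigma>. ?E \<sigma> \<ge> 1) (at_right (1::real))"
  proof (rule eventually_at_right_less[THEN eventually_mono])
    fix \<sigma> :: real assume \<sigma>: "\<sigma> > 1"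
    have "zeta_reg (of_real \<sigma>) = of_real (\<sigma> - 1) * zeta (of_real \<sigma>)"
      using \<sigma> by (subst zeta_reg_eq) auto
    then have "norm (zeta_reg (of_real \<sigma>)) = (\<sigma> - 1) * norm (zeta (of_real \<sigma>))"
      using \<sigma> by (simp only: norm_mult norm_of_real abs_of_pos diff_gt_0_iff_gt)
    moreover have "norm (zeta (Complex \<sigma> t) / of_real (\<sigma> - 1)) = norm (zeta (Complex \<sigma> t)) / (\<sigma> - 1)"
      using \<sigma> unfolding norm_divide norm_of_real by simp
    moreover have alg: "(d * z) ^ 3 * (w / d) ^ 4 * v * d = z ^ 3 * w ^ 4 * v" if "d \<noteq> 0" for d z w v :: real
      using that by (simp add: power_mult_distrib power_divide field_simps power4_eq_xxxx power3_eq_cube)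
    ultimately have "?E \<sigma> =
      norm (zeta (of_real \<sigma>)) ^ 3 * norm (zeta (Complex \<sigma> t)) ^ 4 * norm (zeta (Complex \<sigma> (2 * t)))"
      using \<sigma> by (simp only: alg)
    with zeta_3_4_1[OF \<sigma>, of t] show "?E \<sigma> \<ge> 1" by (simp only:)
  qed
  ultimately have "1 \<le> norm (zeta_reg 1) ^ 3 * norm (deriv zeta (Complex 1 t)) ^ 4 * norm (zeta (Complex 1 (2 * t))) * (1 - 1 :: real)"
    by (rule tendsto_lowerbound) auto
  then show False by simp
qed

text \<open>Four reasons in four places: the Riemann hypothesis inside the strip, the 3-4-1
  inequality on Re s = 1, the Euler product beyond, and the value 1 at s = 1, where
  \<open>zeta\<close> itself only has its default value 0.\<close>

lemma zeta_reg_nonzero: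
  assumes "riemann_hypothesis" "Re s > 1 / 2"
  shows "zeta_reg s \<noteq> 0"
proof (cases "s = 1")
  case False
  have "zeta s \<noteq> 0"
  proof -
    consider "Re s < 1" | "Re s = 1" | "Re s > 1" by linarith
    then show ?thesis
    proof cases
      case 1 then show ?thesis using assms unfolding riemann_hypothesis_def by force
    next
      case 2
      then have s: "s = Complex 1 (Im s)" and "Im s \<noteq> 0" using False by (auto simp: complex_eq_iff)
      then show ?thesis by (subst s) (intro zeta_nonzero_Re_1)
    qed (rule zeta_nonzero_Re_gt_1)
  qed
  then show ?thesis using False assms by (subst zeta_reg_eq) auto
qed (simp add: zeta_reg_1)

section \<open>The logarithmic derivative of (s - 1) zeta(s)\<close>

text \<open>F'/F is the sum of 1/(s - 1) and zeta'/zeta, and zeta' is bounded by Cauchy's inequality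
  on discs of radius 1/2, which stay in Re s \<ge> 3/2. That B does not depend on t is what makes
  the Cayley transform small on the right edge.\<close>

lemma zeta_reg_logderiv_le:
  obtains B where "B \<ge> 1" "\<And>s. Re s \<ge> 2 \<Longrightarrow> norm (deriv zeta_reg s / zeta_reg s) \<le> B"
proof -
  define K where "K = (\<Sum>\<^sub>\<infinity>n\<in>{0<..}. real n powr (- (3 / 2)))"
  have K: "norm (zeta s) \<le> K" "norm (1 / zeta s) \<le> K" if "Re s \<ge> 3 / 2" for s
    unfolding K_def using norm_zeta_le[of "3 / 2" s] that by auto
  have K0: "K \<ge> 0" unfolding K_def by (simp add: infsum_nonneg)
  have "norm (deriv zeta_reg s / zeta_reg s) \<le> 1 + K * (2 * K)" if s: "Re s \<ge> 2" for s
  proof -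
    have d1: "(zeta has_field_derivative deriv zeta s) (at s)"
      using s by (intro holomorphic_derivI[OF zeta_holomorphic]) (auto simp: open_Compl)
    have zr: "(x - 1) * zeta x = zeta_reg x" if "Re x > 1" for x
      using zeta_reg_eq[of x] that by (cases "x = 1") auto
    have "((\<lambda>s. (s - 1) * zeta s) has_field_derivative zeta s + (s - 1) * deriv zeta s) (at s)"
      by (auto intro!: derivative_eq_intros d1)
    then have "(zeta_reg has_field_derivative zeta s + (s - 1) * deriv zeta s) (at s)"
      by (rule has_field_derivative_transform_within_open[OF _ open_halfspace_Re_gt[of 1]])
        (use s zr in auto)
    then have d: "deriv zeta_reg s = zeta s + (s - 1) * deriv zeta s" by (rule DERIV_imp_deriv)
    have nz: "zeta s \<noteq> 0" using s by (intro zeta_nonzero_Re_gt_1) simp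
    have s1: "s \<noteq> 1" using s by auto
    have eq: "deriv zeta_reg s / zeta_reg s = 1 / (s - 1) + 1 / zeta s * deriv zeta s"
      using s nz s1 unfolding d by (subst zeta_reg_eq) (auto simp: field_simps)
    have "norm ((deriv ^^ 1) zeta s) \<le> fact 1 * K / (1 / 2) ^ 1"
    proof (rule Cauchy_inequality)
      have re: "Re w \<ge> 3 / 2" if "w \<in> cball s (1 / 2)" for w
        using that s abs_Re_le_cmod[of "s - w"] by (simp add: dist_norm)
      have "cball s (1 / 2) \<subseteq> - {1}" using re by force
      then have h: "zeta holomorphic_on cball s (1 / 2)"
        using zeta_holomorphic holomorphic_on_subset by blast
      show "continuous_on (cball s (1 / 2)) zeta" by (rule holomorphic_on_imp_continuous_on[OF h])
      show "zeta holomorphic_on ball s (1 / 2)" by (rule holomorphic_on_subset[OF h]) auto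
      show "norm (zeta x) \<le> K" if "norm (s - x) = 1 / 2" for x
        using that by (intro K re) (simp add: dist_norm)
    qed simp
    then have "norm (deriv zeta s) \<le> 2 * K" by simp
    moreover have "norm (1 / zeta s) \<le> K" using s by (intro K) simp
    ultimately have "norm (1 / zeta s * deriv zeta s) \<le> K * (2 * K)"
      unfolding norm_mult using K0 by (intro mult_mono) auto
    moreover have "norm (1 / (s - 1)) \<le> 1"
      using s abs_Re_le_cmod[of "s - 1"] s1 by (simp add: norm_divide field_simps)
    ultimately show ?thesis unfolding eq by (intro order.trans[OF norm_triangle_ineq] add_mono)
  qed
  with that[of "1 + K * (2 * K)"] K0 show ?thesis by simp
qed

text \<open>Serves twice: as lower bound at the centre 2 + it of the discs on which zeros are
  divided out, and as starting value for integrating F'/F to the left.\<close>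

lemma norm_zeta_reg_ge:
  obtains K where "K \<ge> 1" "\<And>s. Re s = 2 \<Longrightarrow> norm (zeta_reg s) \<ge> norm (s - 1) / K"
proof -
  define K where "K = (\<Sum>\<^sub>\<infinity>n\<in>{0<..}. real n powr (- 2))"
  have "norm (zeta_reg s) \<ge> norm (s - 1) / (K + 1)" if s: "Re s = 2" for s
  proof -
    have "norm (1 / zeta s) \<le> K + 1" unfolding K_def using norm_zeta_le(2)[of 2 s] s by auto
    moreover have nz: "zeta s \<noteq> 0" using s by (intro zeta_nonzero_Re_gt_1) simp
    moreover have "0 < norm (1 / zeta s)" using nz by simp
    then have "K + 1 > 0" using calculation by linarith
    ultimately have "norm (zeta s) \<ge> 1 / (K + 1)"
      by (simp add: norm_divide field_simps)
    then have "norm (s - 1) * (1 / (K + 1)) \<le> norm (s - 1) * norm (zeta s)"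
      by (intro mult_left_mono) auto
    then show ?thesis using s by (subst zeta_reg_eq) (auto simp: norm_mult)
  qed
  moreover have "K + 1 \<ge> 1" unfolding K_def by (simp add: infsum_nonneg)
  ultimately show ?thesis using that by blast
qed

lemma one_le_ln: "x \<ge> 3 \<Longrightarrow> 1 \<le> ln (x :: real)"
  using exp_le by (subst ln_ge_iff) auto

lemma zeta_reg_Re_logderiv_ge:
  assumes RH: "riemann_hypothesis"
  obtains C where "C \<ge> 1"
    "\<And>s. 1 / 2 < Re s \<Longrightarrow> Re s \<le> 2 \<Longrightarrow> Re (deriv zeta_reg s / zeta_reg s) \<ge> - (C * ln (\<bar>Im s\<bar> + 3))"
proof -
  obtain C1 where C1: "C1 > 0" "\<And>s. Re s \<ge> 1 / 4 \<Longrightarrow> norm (zeta_reg s) \<le> C1 * (norm s + 1) ^ 2"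
    using norm_zeta_reg_le by metis
  obtain K where K: "K \<ge> 1" "\<And>s. Re s = 2 \<Longrightarrow> norm (zeta_reg s) \<ge> norm (s - 1) / K"
    using norm_zeta_reg_ge by metis
  \<comment> \<open>Ratio R / r of the radii R = 7/4 and r = 13/8. The radius r1 = 3/2 reaches from
    2 + it to the critical line, R keeps the disc in Re s \<ge> 1/4, and r is their
    midpoint.\<close>
  define q where "q = (14 / 13 :: real)"
  define c where "c = 4 * ln q * (13 / 8 + 3 / 2) / (13 / 8 - 3 / 2)\<^sup>2 + (13 / 8) / ((7 / 4)\<^sup>2 - (7 / 4) * (13 / 8))"
  have q: "q > 1" "ln q > 0" by (simp_all add: q_def)
  have c0: "c \<ge> 0" unfolding c_def using q by (intro add_nonneg_nonneg) (auto simp: power2_eq_square)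
  define C where "C = c * ((\<bar>ln (C1 * K)\<bar> + 4) / ln q + 2) + 1"
  have main: "Re (deriv zeta_reg s / zeta_reg s) \<ge> - (C * ln (\<bar>Im s\<bar> + 3))"
    if s: "1 / 2 < Re s" "Re s \<le> 2" for s
  proof -
    define t where "t = Im s"
    define s0 where "s0 = Complex 2 t"
    define f where "f = (\<lambda>w. zeta_reg (w + s0))"
    define M where "M = C1 * (\<bar>t\<bar> + 5)\<^sup>2"
    define S where "S = {w. Re w > - 2}"
    have l1: "ln (\<bar>t\<bar> + 3) \<ge> 1" by (intro one_le_ln) simp
    have MK: "M * K > 0" using C1 K by (simp add: M_def)
    \<comment> \<open>Chosen so that M K < q^n, where |f 0| \<ge> 1/K. Since M is polynomial in t,
      this n is O(ln (|t| + 3)).\<close>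
    define n where "n = nat \<lceil>ln (M * K) / ln q\<rceil> + 1"
    have n1: "real n > ln (M * K) / ln q" unfolding n_def by linarith
    have "ln (M * K) = ln (C1 * K) + 2 * ln (\<bar>t\<bar> + 5)"
      using C1 K by (simp add: M_def ln_mult ln_realpow)
    also have "ln (\<bar>t\<bar> + 5) \<le> ln ((\<bar>t\<bar> + 3) ^ 2)"
    proof (rule ln_le_cancel_iff[THEN iffD2])
      show "0 < (\<bar>t\<bar> + 3) ^ 2" by (intro zero_less_power) auto
      show "\<bar>t\<bar> + 5 \<le> (\<bar>t\<bar> + 3) ^ 2" by (auto simp: power2_eq_square algebra_simps)
    qed auto
    also have "\<dots> = 2 * ln (\<bar>t\<bar> + 3)" by (simp add: ln_realpow)
    finally have lnMK: "ln (M * K) \<le> \<bar>ln (C1 * K)\<bar> + 4 * ln (\<bar>t\<bar> + 3)" by simp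
    also have "\<dots> \<le> (\<bar>ln (C1 * K)\<bar> + 4) * ln (\<bar>t\<bar> + 3)"
      using mult_left_mono[OF l1, of "\<bar>ln (C1 * K)\<bar>"] by (simp add: algebra_simps)
    finally have lnMK: "ln (M * K) / ln q \<le> (\<bar>ln (C1 * K)\<bar> + 4) / ln q * ln (\<bar>t\<bar> + 3)"
      using q by (simp add: field_simps)
    have "real n \<le> max 0 (ln (M * K) / ln q) + 2" unfolding n_def by linarith
    also have "\<dots> \<le> (\<bar>ln (C1 * K)\<bar> + 4) / ln q * ln (\<bar>t\<bar> + 3) + 2 * ln (\<bar>t\<bar> + 3)"
      using lnMK l1 q by (intro add_mono max.boundedI) auto
    finally have n2: "real n \<le> ((\<bar>ln (C1 * K)\<bar> + 4) / ln q + 2) * ln (\<bar>t\<bar> + 3)"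
      by (simp add: algebra_simps)
    have "exp (ln (M * K)) < exp (real n * ln q)"
      using n1 q by (simp add: field_simps)
    then have nM: "M * K < q ^ n"
      using MK q by (simp add: exp_of_nat_mult)
    have f0: "norm (f 0) \<ge> 1 / K"
    proof -
      have "1 \<le> norm (s0 - 1)" using abs_Re_le_cmod[of "s0 - 1"] by (simp add: s0_def)
      then have "1 / K \<le> norm (s0 - 1) / K" using K by (intro divide_right_mono) auto
      also have "\<dots> \<le> norm (f 0)" using K(2)[of s0] by (simp add: f_def s0_def)
      finally show ?thesis .
    qed
    have shift: "s = (s - s0) + s0" by simp
    have "Re (deriv f (s - s0) / f (s - s0)) \<ge> - real n * (4 * ln ((7 / 4) / (13 / 8)) * (13 / 8 + 3 / 2) / (13 / 8 - 3 / 2)\<^sup>2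
        + (13 / 8) / ((7 / 4)\<^sup>2 - (7 / 4) * (13 / 8)))"
    \<comment> \<open>-3/2 = 1/2 - 2 is the critical line seen from the centre 2 + it.\<close>
    proof (rule Re_logderiv_ge[where S = S and M = M and \<beta> = "- 3 / 2"])
      show "open S" unfolding S_def by (rule open_halfspace_Re_gt)
      have re: "Re (w + s0) \<ge> 1 / 4" if "w \<in> cball 0 (7 / 4)" for w
        using that abs_Re_le_cmod[of w] by (simp add: s0_def)
      show "cball 0 (7 / 4) \<subseteq> S"
        unfolding S_def using re by (force simp: s0_def)
      have "(zeta_reg \<circ> (\<lambda>w. w + s0)) holomorphic_on S"
        by (intro holomorphic_on_compose_gen[OF _ zeta_reg_holomorphic] holomorphic_intros)
          (auto simp: S_def s0_def)
      then show "f holomorphic_on S" by (simp add: f_def o_def)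
      show "norm (f w) \<le> M" if w: "w \<in> cball 0 (7 / 4)" for w
      proof -
        have "norm s0 \<le> 2 + \<bar>t\<bar>" using cmod_le[of s0] by (simp add: s0_def)
        then have "norm (w + s0) + 1 \<le> \<bar>t\<bar> + 5" using norm_triangle_ineq[of w s0] w by simp
        then have "C1 * (norm (w + s0) + 1) ^ 2 \<le> M"
          unfolding M_def using C1 by (intro mult_left_mono power_mono) auto
        then show ?thesis unfolding f_def using C1(2)[OF re[OF w]] by linarith
      qed
      show "Re w \<le> - 3 / 2" if "w \<in> cball 0 (7 / 4)" "f w = 0" for w
      proof (rule ccontr)
        assume "\<not> Re w \<le> - 3 / 2"
        then have "Re (w + s0) > 1 / 2" by (simp add: s0_def)
        then show False using zeta_reg_nonzero[OF RH] that by (auto simp: f_def)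
      qed
      have "M < 1 / K * q ^ n" using nM K by (simp add: field_simps)
      also have "\<dots> \<le> norm (f 0) * q ^ n" using f0 q by (intro mult_right_mono) auto
      finally show "M < norm (f 0) * (7 / 4 / (13 / 8)) ^ n" by (simp add: q_def)
      have "s - s0 = of_real (Re s - 2)" by (simp add: complex_eq_iff s0_def t_def)
      then have "norm (s - s0) = \<bar>Re s - 2\<bar>" by (simp only: norm_of_real)
      then show "norm (s - s0) \<le> 3 / 2" using s by simp
      show "- 3 / 2 < Re (s - s0)" using s by (simp add: s0_def)
    qed auto
    also have "4 * ln ((7 / 4) / (13 / 8)) * (13 / 8 + 3 / 2) / (13 / 8 - 3 / 2)\<^sup>2
        + (13 / 8) / ((7 / 4)\<^sup>2 - (7 / 4) * (13 / 8)) = c" by (simp add: c_def q_def)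
    also have "deriv f (s - s0) / f (s - s0) = deriv zeta_reg s / zeta_reg s"
    proof -
      have "(zeta_reg has_field_derivative deriv zeta_reg s) (at ((s - s0) + s0))"
        using s by (simp, intro holomorphic_derivI[OF zeta_reg_holomorphic open_halfspace_Re_gt]) auto
      then have "(f has_field_derivative deriv zeta_reg s) (at (s - s0))"
        unfolding f_def by (subst (asm) DERIV_shift) simp
      then show ?thesis by (simp add: DERIV_imp_deriv f_def)
    qed
    finally have "Re (deriv zeta_reg s / zeta_reg s) \<ge> - (real n * c)" by simp
    moreover have "real n * c \<le> C * ln (\<bar>t\<bar> + 3)"
    proof -
      have "real n * c \<le> ((\<bar>ln (C1 * K)\<bar> + 4) / ln q + 2) * ln (\<bar>t\<bar> + 3) * c"
        using n2 c0 by (rule mult_right_mono)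
      also have "\<dots> = (C - 1) * ln (\<bar>t\<bar> + 3)" by (simp add: C_def)
      also have "\<dots> \<le> C * ln (\<bar>t\<bar> + 3)" using l1 by (intro mult_right_mono) auto
      finally show ?thesis .
    qed
    ultimately show ?thesis by (simp add: t_def)
  qed
  have "C \<ge> 1" using c0 q unfolding C_def by (simp add: mult_nonneg_nonneg)
  with main that show ?thesis by blast
qed

text \<open>A lower bound on \<open>Re h\<close> makes the Cayley transform \<open>h / (h + 2 N)\<close> bounded by 1, so the
  three lines theorem applies to it although nothing is known about \<open>Im h\<close>.\<close>

lemma cayley_three_lines:
  fixes h :: "complex \<Rightarrow> complex"
  assumes hol: "h holomorphic_on U" and U: "\<And>w. a \<le> Re w \<Longrightarrow> Re w \<le> 2 \<Longrightarrow> w \<in> U"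
    and a: "1 / 2 \<le> a" "a < 2" and BN: "0 < B" "B \<le> N" and V: "V > 0" "ln (N / B) \<le> V\<^sup>2"
    and low: "\<And>w. a \<le> Re w \<Longrightarrow> Re w \<le> 2 \<Longrightarrow> \<bar>Im w - t\<bar> \<le> V \<Longrightarrow> Re (h w) \<ge> - N"
    and right: "\<And>w. Re w = 2 \<Longrightarrow> norm (h w) \<le> B"
    and \<sigma>: "a \<le> \<sigma>" "\<sigma> \<le> 2"
  shows "norm (h (Complex \<sigma> t) / (h (Complex \<sigma> t) + 2 * of_real N)) \<le>
    exp (9 / 4 - ln (N / B) * (\<sigma> - a) / (2 - a))"
proof -
  define R where "R = cbox (Complex a (t - V)) (Complex 2 (t + V))"
  define z0 where "z0 = Complex \<sigma> t"
  define \<phi> where "\<phi> = (\<lambda>w. h w / (h w + 2 * of_real N))"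
  define e where "e = ln (N / B) / (2 - a)"
  \<comment> \<open>The modulus of exp (e (w - a)) grows from 1 on the left edge to N/B on the right
    edge, exactly what the bound B/N for \<phi> there allows. The Gaussian factor is 1 at z0; on the
    horizontal edges it contributes exp (-V^2), which compensates N/B because V^2 \<ge> ln (N /
    B).\<close>
  define \<psi> where "\<psi> = (\<lambda>w. \<phi> w * exp ((w - z0)\<^sup>2 + of_real e * (w - of_real a)))"
  have lnNB: "ln (N / B) \<ge> 0" using BN by simp
  have e0: "e \<ge> 0" using lnNB a by (simp add: e_def)
  have R: "a \<le> Re w" "Re w \<le> 2" "\<bar>Im w - t\<bar> \<le> V" if "w \<in> R" for w
    using that by (auto simp: R_def in_cbox_complex_iff)
  have ne: "h w + 2 * of_real N \<noteq> 0" if "w \<in> R" for w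
    using low[OF R[OF that]] BN by (auto simp: complex_eq_iff)
  have holR: "h holomorphic_on R" using R U by (intro holomorphic_on_subset[OF hol]) auto
  have hol\<psi>: "\<psi> holomorphic_on R"
    unfolding \<psi>_def \<phi>_def using ne by (intro holomorphic_intros holR) auto
  have \<phi>1: "norm (\<phi> w) \<le> 1" if "w \<in> R" for w
  proof -
    \<comment> \<open>Re h \<ge> -N says that h is no farther from 0 than from -2N.\<close>
    have "0 \<le> 4 * N * (N + Re (h w))" using low[OF R[OF that]] BN by simp
    then have "(norm (h w))\<^sup>2 \<le> (norm (h w + 2 * of_real N))\<^sup>2"
      unfolding cmod_power2 by (simp add: power2_eq_square algebra_simps)
    then have "norm (h w) \<le> norm (h w + 2 * of_real N)" by (rule power2_le_imp_le) simp
    then show ?thesis using ne[OF that] by (simp add: \<phi>_def norm_divide)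
  qed
  have \<phi>2: "norm (\<phi> w) \<le> B / N" if w: "w \<in> R" "Re w = 2" for w
  proof -
    have hB: "norm (h w) \<le> B" using w right by auto
    have "N \<le> norm (2 * of_real N :: complex) - norm (h w)" using hB BN by (simp add: norm_mult)
    also have "\<dots> \<le> norm (h w + 2 * of_real N)" by (metis norm_diff_ineq add.commute)
    finally show ?thesis unfolding \<phi>_def norm_divide using hB BN by (intro frac_le) auto
  qed
  have n\<psi>: "norm (\<psi> w) = norm (\<phi> w) * exp ((Re w - \<sigma>)\<^sup>2 - (Im w - t)\<^sup>2 + e * (Re w - a))" for w
    by (simp add: \<psi>_def norm_mult Re_power2 z0_def)
  have "norm (\<psi> z0) \<le> exp (9 / 4)"
  proof (rule maximum_modulus_frontier[of \<psi> R])
    show "\<psi> holomorphic_on interior R"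
      by (rule holomorphic_on_subset[OF hol\<psi> interior_subset])
    show "continuous_on (closure R) \<psi>"
      using holomorphic_on_imp_continuous_on[OF hol\<psi>] by (simp add: R_def)
    show "bounded R" by (simp add: R_def)
    show "z0 \<in> R" using \<sigma> V by (auto simp: R_def z0_def in_cbox_complex_iff)
    fix w assume "w \<in> frontier R"
    then have wR: "w \<in> R" and wf: "w \<notin> box (Complex a (t - V)) (Complex 2 (t + V))"
      by (auto simp: R_def frontier_def)
    \<comment> \<open>The rectangle is at most 3/2 wide because a \<ge> 1/2; hence the constant
      9/4.\<close>
    have sq: "(Re w - \<sigma>)\<^sup>2 \<le> 9 / 4"
    proof -
      have "\<bar>Re w - \<sigma>\<bar> \<le> 3 / 2" using R[OF wR] \<sigma> a by linarith
      then have "\<bar>Re w - \<sigma>\<bar>\<^sup>2 \<le> (3 / 2)\<^sup>2" by (intro power_mono) auto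
      then show ?thesis by (simp add: power2_eq_square)
    qed
    have eN: "e * (Re w - a) \<le> ln (N / B)"
    proof -
      have "e * (Re w - a) \<le> e * (2 - a)" using R[OF wR] e0 by (intro mult_left_mono) auto
      then show ?thesis using a by (simp add: e_def)
    qed
    consider "Re w = a" | "Re w = 2" | "\<bar>Im w - t\<bar> = V"
      using R[OF wR] wf by (force simp: in_box_complex_iff)
    then show "norm (\<psi> w) \<le> exp (9 / 4)"
    proof cases
      case 1
      have "norm (\<psi> w) \<le> 1 * exp (9 / 4)"
        unfolding n\<psi> using \<phi>1[OF wR] sq 1 by (intro mult_mono) (auto intro: order.trans[rotated])
      then show ?thesis by simp
    next
      case 2
      have "norm (\<psi> w) \<le> (B / N) * exp (9 / 4 + ln (N / B))"
        unfolding n\<psi> using \<phi>2[OF wR 2] sq eN BN by (intro mult_mono) (auto intro!: add_mono diff_mono[of _ "9/4" 0, simplified])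
      also have "\<dots> = exp (9 / 4)" using BN by (simp add: exp_add)
      finally show ?thesis .
    next
      case 3
      have "(Im w - t)\<^sup>2 = V\<^sup>2" using 3 by (metis power2_abs)
      then have "norm (\<psi> w) \<le> 1 * exp (9 / 4)"
        unfolding n\<psi> using \<phi>1[OF wR] sq eN V by (intro mult_mono) auto
      then show ?thesis by simp
    qed
  qed
  then have "norm (\<phi> z0) * exp (e * (\<sigma> - a)) \<le> exp (9 / 4)"
    by (simp add: n\<psi> z0_def)
  then have "norm (\<phi> z0) \<le> exp (9 / 4 - e * (\<sigma> - a))"
    unfolding exp_diff by (subst pos_le_divide_eq) auto
  then show ?thesis by (simp add: \<phi>_def z0_def e_def)
qed

section \<open>The size of 1/zeta under the Riemann hypothesis\<close>

text \<open>With g a logarithm of F, log |F(2 + it) / F(s)| is at most the integral of |F'/F| along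
  the horizontal segment. The bound for F'/F decays like exp (-(2/3) L (\<sigma> - a)), so the
  integral is O(N / L) with N of size log x and L = log log x.\<close>

lemma inverse_zeta_bound:
  assumes RH: "riemann_hypothesis"
  obtains C K x0 where "C > 0" "K \<ge> 1"
    "\<And>x s. x \<ge> x0 \<Longrightarrow> 1 / 2 + 6 / ln (ln x) \<le> Re s \<Longrightarrow> Re s \<le> 2 \<Longrightarrow> \<bar>Im s\<bar> \<le> x ^ 4 \<Longrightarrow>
       norm ((s - 1) / zeta_reg s) \<le> K * exp (C * (ln x / ln (ln x)))"
proof -
  obtain B where B: "B \<ge> 1" "\<And>s. Re s \<ge> 2 \<Longrightarrow> norm (deriv zeta_reg s / zeta_reg s) \<le> B"
    using zeta_reg_logderiv_le by metis
  obtain C1 where C1: "C1 \<ge> 1"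
    "\<And>s. 1 / 2 < Re s \<Longrightarrow> Re s \<le> 2 \<Longrightarrow> Re (deriv zeta_reg s / zeta_reg s) \<ge> - (C1 * ln (\<bar>Im s\<bar> + 3))"
    using zeta_reg_Re_logderiv_ge[OF RH] by metis
  obtain K where K: "K \<ge> 1" "\<And>s. Re s = 2 \<Longrightarrow> norm (zeta_reg s) \<ge> norm (s - 1) / K"
    using norm_zeta_reg_ge by metis
  define C0 where "C0 = C1 + B"
  have C0: "C0 > 0" "C1 \<le> C0" "B \<le> C0" using C1 B by (auto simp: C0_def)
  \<comment> \<open>Lets all ordinates up to x^4 + N, and the shift by 3, be bounded by x^5, whose
    logarithm is 5 ln x.\<close>
  have "eventually (\<lambda>x. x ^ 4 + 5 * C0 * ln x + 3 \<le> x ^ 5) at_top"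
    using C0 by real_asymp
  moreover have "eventually (\<lambda>x::real. ln (ln x) \<ge> 10) at_top" by real_asymp
  moreover have "eventually (\<lambda>x::real. x \<ge> 3) at_top" by (rule eventually_ge_at_top)
  ultimately have "eventually (\<lambda>x. x ^ 4 + 5 * C0 * ln x + 3 \<le> x ^ 5 \<and> ln (ln x) \<ge> 10 \<and> x \<ge> 3) at_top"
    by eventually_elim auto
  then obtain x0 where x0: "\<And>x. x \<ge> x0 \<Longrightarrow> x ^ 4 + 5 * C0 * ln x + 3 \<le> x ^ 5 \<and> ln (ln x) \<ge> 10 \<and> x \<ge> 3"
    by (auto simp: eventually_at_top_linorder)
  define H where "H = {s. Re s > 1 / 2}"
  have H: "open H" "convex H" unfolding H_def by (rule open_halfspace_Re_gt convex_halfspace_Re_gt)+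
  have nz: "zeta_reg s \<noteq> 0" if "s \<in> H" for s using zeta_reg_nonzero[OF RH] that by (auto simp: H_def)
  have holH: "zeta_reg holomorphic_on H"
    by (rule holomorphic_on_subset[OF zeta_reg_holomorphic]) (auto simp: H_def)
  define h where "h = (\<lambda>s. deriv zeta_reg s / zeta_reg s)"
  have holh: "h holomorphic_on H"
    unfolding h_def using nz by (intro holomorphic_intros holH H) auto
  obtain g where g: "\<And>s. s \<in> H \<Longrightarrow> exp (g s) = zeta_reg s"
      and dg: "\<And>s. s \<in> H \<Longrightarrow> (g has_field_derivative h s) (at s)"
    using holomorphic_logarithm_deriv[OF H(2,1) holH nz, of 2] by (auto simp: H_def h_def)
  have main: "norm ((s - 1) / zeta_reg s) \<le> K * exp (30 * C0 * (ln x / ln (ln x)))"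
    if x: "x \<ge> x0" and s: "1 / 2 + 6 / ln (ln x) \<le> Re s" "Re s \<le> 2" "\<bar>Im s\<bar> \<le> x ^ 4" for x s
  proof -
    define L where "L = ln (ln x)"
    \<comment> \<open>Makes -N a lower bound for Re F'/F on all relevant ordinates, which stay below
      x^5; it also serves as half-height V of the rectangle.\<close>
    define N where "N = 5 * C0 * ln x"
    \<comment> \<open>The left edge stays 1/L off the critical line and the points of interest
      another 5/L, so that L (\<sigma> - a) \<ge> 5.\<close>
    define a where "a = 1 / 2 + 1 / L"
    define t where "t = Im s"
    have L: "L \<ge> 10" and x3: "x \<ge> 3" and x5: "x ^ 4 + N + 3 \<le> x ^ 5" using x0[OF x] by (auto simp: L_def N_def)
    have lnx: "ln x \<ge> 1" using x3 by (rule one_le_ln)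
    have "5 * C0 * 1 \<le> N" unfolding N_def using lnx C0 by (intro mult_left_mono) auto
    then have N: "B \<le> N" "N \<ge> 1" using C0 B by auto
    have NB: "ln x \<le> N / B"
    proof -
      have "B * ln x \<le> 5 * C0 * ln x" using C0 lnx by (intro mult_right_mono) auto
      then show ?thesis using B by (simp add: N_def field_simps)
    qed
    have LNB: "L \<le> ln (N / B)" unfolding L_def using NB lnx by (intro ln_mono) auto
    have a: "1 / 2 < a" "a < 2" using L by (auto simp: a_def field_simps)
    have "N / B \<le> N" using B N by (simp add: field_simps)
    have "ln (N / B) \<le> ln N" using N B \<open>N / B \<le> N\<close> by (intro ln_mono) auto
    also have "\<dots> \<le> N" using N by (intro ln_bound) auto
    also have "\<dots> \<le> N\<^sup>2" using N by (simp add: power2_eq_square)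
    finally have V: "ln (N / B) \<le> N\<^sup>2" .
    have low: "Re (h w) \<ge> - N" if w: "a \<le> Re w" "Re w \<le> 2" "\<bar>Im w - t\<bar> \<le> N" for w
    proof -
      have "\<bar>Im w\<bar> + 3 \<le> x ^ 5" using w s x5 unfolding t_def by linarith
      then have "ln (\<bar>Im w\<bar> + 3) \<le> ln (x ^ 5)" by (intro ln_mono) auto
      also have "\<dots> = 5 * ln x" using x3 by (simp add: ln_realpow)
      finally have "C1 * ln (\<bar>Im w\<bar> + 3) \<le> C0 * (5 * ln x)"
        using C0 C1 by (intro mult_mono) auto
      then show ?thesis using C1(2)[of w] w a by (simp add: h_def N_def)
    qed
    have hb: "norm (h (Complex \<sigma> t)) \<le> 4 * N * exp (9 / 4 - 2 / 3 * L * (\<sigma> - a))"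
      if \<sigma>: "1 / 2 + 6 / L \<le> \<sigma>" "\<sigma> \<le> 2" for \<sigma>
    proof -
      define w where "w = Complex \<sigma> t"
      define \<phi> where "\<phi> = h w / (h w + 2 * of_real N)"
      have \<sigma>a: "\<sigma> - a \<ge> 5 / L" using \<sigma> L by (simp add: a_def field_simps)
      then have \<sigma>a0: "\<sigma> - a \<ge> 0" using L by (intro order.trans[OF _ \<sigma>a]) auto
      have "norm \<phi> \<le> exp (9 / 4 - ln (N / B) * (\<sigma> - a) / (2 - a))"
        unfolding \<phi>_def w_def
      proof (rule cayley_three_lines[OF holh])
        show "norm (h w) \<le> B" if "Re w = 2" for w using B that by (simp add: h_def)
      qed (use low a V N B \<sigma> \<sigma>a0 in \<open>auto simp: H_def\<close>)
      also have "\<dots> \<le> exp (9 / 4 - 2 / 3 * L * (\<sigma> - a))"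
      proof -
        \<comment> \<open>2 - a < 3/2 gives the factor 2/3.\<close>
        have "L * (\<sigma> - a) * (2 / 3) \<le> ln (N / B) * (\<sigma> - a) * (1 / (2 - a))"
          using LNB L \<sigma>a0 a by (intro mult_mono) (auto simp: field_simps)
        then show ?thesis by (simp add: mult_ac)
      qed
      finally have \<phi>le: "norm \<phi> \<le> exp (9 / 4 - 2 / 3 * L * (\<sigma> - a))" .
      \<comment> \<open>9/4 - 10/3 < -1. Once the Cayley transform is at most 1/2 it can be
        inverted, with |h| \<le> 4 N |\<phi>|.\<close>
      also have "\<dots> \<le> exp (- 1)"
      proof -
        have "5 \<le> L * (\<sigma> - a)" using \<sigma>a L by (simp add: field_simps)
        then show ?thesis by simp
      qed
      also have "\<dots> \<le> 1 / 2"
        using exp_ge_add_one_self[of 1] by (simp add: exp_minus field_simps)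
      finally have \<phi>half: "norm \<phi> \<le> 1 / 2" .
      have "Re (h w) \<ge> - N" using low[of w] N \<sigma> \<sigma>a0 by (auto simp: w_def)
      then have "h w + 2 * of_real N \<noteq> 0" using N by (auto simp: complex_eq_iff)
      then have "norm (h w) = norm \<phi> * norm (h w + 2 * of_real N)"
        by (simp add: \<phi>_def norm_divide)
      also have "\<dots> \<le> norm \<phi> * (norm (h w) + 2 * N)"
        using N by (intro mult_left_mono order.trans[OF norm_triangle_ineq]) (auto simp: norm_mult)
      also have "\<dots> \<le> 1 / 2 * norm (h w) + norm \<phi> * (2 * N)"
        using mult_right_mono[OF \<phi>half norm_ge_zero[of "h w"]] by (simp add: distrib_left)
      finally have "norm (h w) \<le> 4 * N * norm \<phi>" by (simp add: field_simps)
      also have "\<dots> \<le> 4 * N * exp (9 / 4 - 2 / 3 * L * (\<sigma> - a))"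
        using N by (intro mult_left_mono \<phi>le) auto
      finally show ?thesis by (simp add: w_def)
    qed
    have inH: "Complex \<sigma> t \<in> H" if "1 / 2 + 6 / L \<le> \<sigma>" for \<sigma>
    proof -
      have "6 / L > 0" using L by simp
      then have "\<sigma> > 1 / 2" using that by linarith
      then show ?thesis unfolding H_def by simp
    qed
    have s': "s = Complex (Re s) t" by (simp add: t_def complex_eq_iff)
    \<comment> \<open>Antiderivative of the bound \<open>hb\<close>. Dividing by the rate (2/3) L
      turns 4 N into 6 N / L: this is where the factor log log x is saved.\<close>
    define \<Phi> where "\<Phi> = (\<lambda>\<sigma>. - (6 * N / L) * exp (9 / 4 - 2 / 3 * L * (\<sigma> - a)))"
    have diff: "norm (g (Complex 2 t) - g (Complex (Re s) t)) \<le> 6 * N / L"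
    proof (cases "Re s < 2")
      case True
      have line: "((\<lambda>\<sigma>. g (Complex \<sigma> t)) has_vector_derivative h (Complex \<sigma> t)) (at \<sigma>)"
        if "1 / 2 + 6 / L \<le> \<sigma>" for \<sigma>
      proof -
        have "((\<lambda>\<sigma>. Complex \<sigma> t) has_vector_derivative 1) (at \<sigma>)"
          by (auto simp: complex_eq_iff Complex_eq intro!: derivative_eq_intros)
        from field_vector_diff_chain_at[OF this dg[OF inH[OF that]]] show ?thesis by (simp add: o_def)
      qed
      have "norm (g (Complex 2 t) - g (Complex (Re s) t)) \<le> \<Phi> 2 - \<Phi> (Re s)"
      proof (rule differentiable_bound_general[OF True])
        show "continuous_on {Re s..2} (\<lambda>\<sigma>. g (Complex \<sigma> t))"
        proof (intro continuous_at_imp_continuous_on ballI)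
          fix \<sigma> assume "\<sigma> \<in> {Re s..2}"
          then have "1 / 2 + 6 / L \<le> \<sigma>" using s by (simp add: L_def)
          then show "isCont (\<lambda>\<sigma>. g (Complex \<sigma> t)) \<sigma>"
            by (rule has_vector_derivative_continuous[OF line])
        qed
        show "continuous_on {Re s..2} \<Phi>" unfolding \<Phi>_def by (intro continuous_intros)
        fix \<sigma> assume \<sigma>: "Re s < \<sigma>" "\<sigma> < 2"
        then have \<sigma>': "1 / 2 + 6 / L \<le> \<sigma>" using s by (simp add: L_def)
        show "((\<lambda>\<sigma>. g (Complex \<sigma> t)) has_vector_derivative h (Complex \<sigma> t)) (at \<sigma>)"
          by (rule line[OF \<sigma>'])
        show "(\<Phi> has_vector_derivative 4 * N * exp (9 / 4 - 2 / 3 * L * (\<sigma> - a))) (at \<sigma>)"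
          unfolding \<Phi>_def has_real_derivative_iff_has_vector_derivative[symmetric]
          using L by (auto intro!: derivative_eq_intros simp: field_simps)
        show "norm (h (Complex \<sigma> t)) \<le> 4 * N * exp (9 / 4 - 2 / 3 * L * (\<sigma> - a))"
          using hb \<sigma> \<sigma>' by simp
      qed
      also have "\<dots> \<le> - \<Phi> (Re s)" using N L by (simp add: \<Phi>_def)
      also have "\<dots> = 6 * N / L * exp (9 / 4 - 2 / 3 * L * (Re s - a))" by (simp add: \<Phi>_def)
      also have "\<dots> \<le> 6 * N / L * 1"
      proof (intro mult_left_mono)
        have "Re s - a \<ge> 5 / L" using s L by (simp add: a_def field_simps flip: L_def)
        then have "5 \<le> L * (Re s - a)" using L by (simp add: field_simps)
        then show "exp (9 / 4 - 2 / 3 * L * (Re s - a)) \<le> 1" by simp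
      qed (use N L in auto)
      finally show ?thesis by simp
    next
      case False
      then show ?thesis using s N L by simp
    qed
    have sH: "s \<in> H" using inH[of "Re s"] s s' by (simp add: L_def)
    have "Re (g (Complex 2 t)) - Re (g s) \<le> 6 * N / L"
      using diff abs_Re_le_cmod[of "g (Complex 2 t) - g (Complex (Re s) t)"] s' by simp
    then have "exp (Re (g (Complex 2 t))) \<le> exp (Re (g s) + 6 * N / L)" by simp
    then have "norm (zeta_reg (Complex 2 t)) \<le> norm (zeta_reg s) * exp (6 * N / L)"
      using g[OF sH, symmetric] g[of "Complex 2 t", symmetric] by (simp add: H_def exp_add)
    moreover have "norm (s - 1) / K \<le> norm (zeta_reg (Complex 2 t))"
    proof -
      have "norm (s - 1) \<le> norm (Complex 2 t - 1)"
      proof -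
        have "Re s > 1 / 2" using sH by (simp add: H_def)
        then have "\<bar>Re s - 1\<bar> \<le> 1" using s by linarith
        then have "(Re s - 1)\<^sup>2 \<le> 1" by (simp add: abs_square_le_1)
        then show ?thesis by (simp add: cmod_def t_def)
      qed
      then have "norm (s - 1) / K \<le> norm (Complex 2 t - 1) / K" using K by (intro divide_right_mono) auto
      also have "\<dots> \<le> norm (zeta_reg (Complex 2 t))" by (rule K) simp
      finally show ?thesis .
    qed
    ultimately have "norm (s - 1) / K \<le> norm (zeta_reg s) * exp (6 * N / L)" by linarith
    then have "norm ((s - 1) / zeta_reg s) \<le> K * exp (6 * N / L)"
      using nz[OF sH] K by (simp add: norm_divide field_simps)
    also have "6 * N / L = 30 * C0 * (ln x / ln (ln x))" by (simp add: N_def L_def)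
    finally show ?thesis .
  qed
  show ?thesis
    by (rule that[of "30 * C0" K x0]) (use C0 K main in auto)
qed

text \<open>On a convex domain an integral is the increment of a primitive P, so estimating it is a
  mean value inequality on the segment p + u d, with a majorant \<Phi>' whose antiderivative is
  explicit. This avoids evaluating real integrals of norms.\<close>

lemma primitive_bound:
  fixes P f :: "complex \<Rightarrow> complex"
  assumes P: "\<And>s. s \<in> S \<Longrightarrow> (P has_field_derivative f s) (at s)"
    and ab: "\<alpha> \<le> \<beta>" and S: "\<And>u. \<alpha> \<le> u \<Longrightarrow> u \<le> \<beta> \<Longrightarrow> p + of_real u * d \<in> S"
    and \<Phi>: "\<And>u. (\<Phi> has_real_derivative \<Phi>' u) (at u)"
    and le: "\<And>u. \<alpha> \<le> u \<Longrightarrow> u \<le> \<beta> \<Longrightarrow> norm (f (p + of_real u * d)) * norm d \<le> \<Phi>' u"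
  shows "norm (P (p + of_real \<beta> * d) - P (p + of_real \<alpha> * d)) \<le> \<Phi> \<beta> - \<Phi> \<alpha>"
proof (cases "\<alpha> = \<beta>")
  case False
  then have ab: "\<alpha> < \<beta>" using ab by simp
  have d: "((\<lambda>u. P (p + of_real u * d)) has_vector_derivative d * f (p + of_real u * d)) (at u)"
    if "\<alpha> \<le> u" "u \<le> \<beta>" for u
  proof -
    have "((\<lambda>u. p + of_real u * d) has_vector_derivative d) (at u)"
      by (auto intro!: derivative_eq_intros)
    from field_vector_diff_chain_at[OF this P[OF S[OF that]]] show ?thesis by (simp add: o_def)
  qed
  show ?thesis
  proof (rule differentiable_bound_general[OF ab])
    show "continuous_on {\<alpha>..\<beta>} (\<lambda>u. P (p + of_real u * d))"
      using d by (intro continuous_at_imp_continuous_on ballI) (auto intro!: has_vector_derivative_continuous)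
    show "continuous_on {\<alpha>..\<beta>} \<Phi>"
      using \<Phi> by (intro continuous_at_imp_continuous_on ballI) (auto intro!: DERIV_isCont)
    fix u assume u: "\<alpha> < u" "u < \<beta>"
    show "((\<lambda>u. P (p + of_real u * d)) has_vector_derivative d * f (p + of_real u * d)) (at u)"
      using u by (intro d) auto
    show "(\<Phi> has_vector_derivative \<Phi>' u) (at u)"
      using \<Phi> by (simp add: has_real_derivative_iff_has_vector_derivative)
    show "norm (d * f (p + of_real u * d)) \<le> \<Phi>' u"
      using le[of u] u by (simp add: norm_mult mult.commute)
  qed
qed simp

section \<open>Perron's formula and the summatory Moebius function\<close>

text \<open>1/|s| \<le> 1/|v| on the segment, and y^u has the antiderivative y^u / ln y. The
  quotient is nonnegative for y < 1 as well as for y > 1, so one formula serves both directions of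
  closing the contour.\<close>

lemma contour_integral_horizontal_le:
  fixes y :: real
  assumes y: "y > 0" "y \<noteq> 1" and v: "v \<noteq> 0" and ab: "\<alpha> \<le> \<beta>"
  shows "norm (contour_integral (linepath (Complex \<alpha> v) (Complex \<beta> v)) (\<lambda>s. of_real y powr s / s))
           \<le> (y powr \<beta> - y powr \<alpha>) / (\<bar>v\<bar> * ln y)"
    and "norm (contour_integral (linepath (Complex \<beta> v) (Complex \<alpha> v)) (\<lambda>s. of_real y powr s / s))
           \<le> (y powr \<beta> - y powr \<alpha>) / (\<bar>v\<bar> * ln y)"
proof -
  let ?f = "\<lambda>s::complex. of_real y powr s / s"
  \<comment> \<open>The open upper or lower half-plane, according to the sign of v: it contains the
    line Im s = v and avoids the pole at 0.\<close>
  define S where "S = {s::complex. inner (Complex 0 v) s > 0}"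
  have S: "open S" "convex S" unfolding S_def by (rule open_halfspace_gt convex_halfspace_gt)+
  have S0: "s \<noteq> 0" if "s \<in> S" for s using that by (auto simp: S_def)
  have "?f holomorphic_on S" using y S0 by (intro holomorphic_intros) auto
  then obtain P where "\<And>s. s \<in> S \<Longrightarrow> (P has_field_derivative ?f s) (at s within S)"
    using holomorphic_convex_primitive'[OF S(2,1)] by blast
  then have P: "(P has_field_derivative ?f s) (at s)" if "s \<in> S" for s
    using that S(1) by (simp only: at_within_open)
  have mem: "Complex u v \<in> S" for u using v by (auto simp: S_def inner_complex_def zero_less_mult_iff)
  have seg: "closed_segment (Complex u v) (Complex u' v) \<subseteq> S" for u u'
    using mem S(2) by (simp add: closed_segment_subset)
  have int: "contour_integral (linepath (Complex u v) (Complex u' v)) ?f = P (Complex u' v) - P (Complex u v)" for u u'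
  proof (rule contour_integral_unique)
    have "(P has_field_derivative ?f s) (at s within S)" if "s \<in> S" for s
      by (rule has_field_derivative_at_within[OF P[OF that]])
    from contour_integral_primitive[OF this, of "linepath (Complex u v) (Complex u' v)"] seg
    show "(?f has_contour_integral P (Complex u' v) - P (Complex u v)) (linepath (Complex u v) (Complex u' v))"
      by simp
  qed
  have ln: "ln y \<noteq> 0" using y by simp
  have eq: "Complex 0 v + of_real u * 1 = Complex u v" for u by (simp add: complex_eq_iff)
  have "norm (P (Complex 0 v + of_real \<beta> * 1) - P (Complex 0 v + of_real \<alpha> * 1)) \<le>
      y powr \<beta> / (\<bar>v\<bar> * ln y) - y powr \<alpha> / (\<bar>v\<bar> * ln y)"
  proof (rule primitive_bound[OF P ab])
    fix u
    show "Complex 0 v + of_real u * 1 \<in> S" unfolding eq by (rule mem)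
    show "((\<lambda>u. y powr u / (\<bar>v\<bar> * ln y)) has_real_derivative y powr u / \<bar>v\<bar>) (at u)"
      using y ln v by (auto intro!: derivative_eq_intros simp: field_simps)
    have "\<bar>v\<bar> \<le> norm (Complex u v)" using abs_Im_le_cmod[of "Complex u v"] by simp
    then show "norm (?f (Complex 0 v + of_real u * 1)) * norm (1::complex) \<le> y powr u / \<bar>v\<bar>"
      unfolding eq using y v by (auto simp: norm_divide norm_powr_real_powr intro!: divide_left_mono mult_pos_pos)
  qed
  then have "norm (P (Complex \<beta> v) - P (Complex \<alpha> v)) \<le> (y powr \<beta> - y powr \<alpha>) / (\<bar>v\<bar> * ln y)"
    unfolding eq by (simp add: diff_divide_distrib)
  then show "norm (contour_integral (linepath (Complex \<alpha> v) (Complex \<beta> v)) ?f) \<le> (y powr \<beta> - y powr \<alpha>) / (\<bar>v\<bar> * ln y)"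
    "norm (contour_integral (linepath (Complex \<beta> v) (Complex \<alpha> v)) ?f) \<le> (y powr \<beta> - y powr \<alpha>) / (\<bar>v\<bar> * ln y)"
    unfolding int by (simp_all add: norm_minus_commute)
qed

lemma contour_integral_rectpath_split:
  assumes "continuous_on (path_image (rectpath (Complex a b) (Complex c d))) f" "a \<le> c" "b \<le> d"
  shows "contour_integral (rectpath (Complex a b) (Complex c d)) f =
    contour_integral (linepath (Complex a b) (Complex c b)) f + contour_integral (linepath (Complex c b) (Complex c d)) f +
    contour_integral (linepath (Complex c d) (Complex a d)) f + contour_integral (linepath (Complex a d) (Complex a b)) f"
proof -
  have "path_image (rectpath (Complex a b) (Complex c d)) = closed_segment (Complex a b) (Complex c b) \<union>
      closed_segment (Complex c b) (Complex c d) \<union> closed_segment (Complex c d) (Complex a d) \<union>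
      closed_segment (Complex a d) (Complex a b)"
    by (simp add: rectpath_def Let_def path_image_join Un_assoc)
  then have "f contour_integrable_on linepath (Complex a b) (Complex c b)"
    "f contour_integrable_on linepath (Complex c b) (Complex c d)"
    "f contour_integrable_on linepath (Complex c d) (Complex a d)"
    "f contour_integrable_on linepath (Complex a d) (Complex a b)"
    using assms(1) by (auto intro!: contour_integrable_continuous_linepath elim: continuous_on_subset)
  then show ?thesis by (simp add: rectpath_def Let_def add.assoc)
qed

text \<open>The segment is completed to a rectangle, to the left for y > 1, around the pole at 0
  with residue 1, and to the right for y < 1, where there is no pole. The horizontal sides give the
  error term; the far side contributes at most 2T/U.\<close>

lemma perron_truncated:
  fixes y c T :: real
  assumes y: "y > 0" "y \<noteq> 1" and c: "c > 0" and T: "T > 0"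
  shows "norm (contour_integral (linepath (Complex c (- T)) (Complex c T)) (\<lambda>s. of_real y powr s / s)
           - (if y > 1 then 2 * pi * \<i> else 0)) \<le> 2 * y powr c / (T * \<bar>ln y\<bar>)" (is "norm (?I - _) \<le> ?A")
proof -
  let ?f = "\<lambda>s::complex. of_real y powr s / s"
  have hol: "(\<lambda>s. of_real y powr s :: complex) holomorphic_on X" for X
    using y by (intro holomorphic_intros) auto
  have holf: "?f holomorphic_on X" if "0 \<notin> X" for X
    using that by (intro holomorphic_intros hol) auto
  have lim: "(\<lambda>n. ?A + 2 * T / (c + 1 + real n)) \<longlonglongrightarrow> ?A + 0"
    by (intro tendsto_add tendsto_const) real_asymp
  have "norm (?I - (if y > 1 then 2 * pi * \<i> else 0)) \<le> ?A + 2 * T / (c + 1 + real n)" for n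
  proof -
    \<comment> \<open>Distance of the far side from the imaginary axis. It tends to infinity with n,
      which removes that side from the final estimate.\<close>
    define U where "U = c + 1 + real n"
    have U: "U > c" "U > 0" using c by (auto simp: U_def)
    have vert: "norm (contour_integral (linepath (Complex u w) (Complex u w')) ?f) \<le> 2 * T / U"
      if "\<bar>u\<bar> = U" "y powr u \<le> 1" "(w, w') = (T, - T) \<or> (w, w') = (- T, T)" for u w w'
    proof -
      have re: "Re s = u" if "s \<in> closed_segment (Complex u w) (Complex u w')" for s
        using that by (simp add: closed_segment_same_Re)
      have "0 \<notin> closed_segment (Complex u w) (Complex u w')" using re[of 0] \<open>\<bar>u\<bar> = U\<close> U by auto
      then have "?f contour_integrable_on linepath (Complex u w) (Complex u w')"
        by (intro contour_integrable_continuous_linepath holomorphic_on_imp_continuous_on holf)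
      then have "norm (contour_integral (linepath (Complex u w) (Complex u w')) ?f) \<le>
          1 / U * norm (Complex u w' - Complex u w)"
      proof (rule contour_integral_bound_linepath)
        fix s assume "s \<in> closed_segment (Complex u w) (Complex u w')"
        then have s: "Re s = u" by (rule re)
        then have "U \<le> norm s" using abs_Re_le_cmod[of s] that by simp
        then show "norm (?f s) \<le> 1 / U"
          using y s that U unfolding norm_divide by (intro frac_le) (auto simp: norm_powr_real_powr)
      qed (use U in auto)
      also have "norm (Complex u w' - Complex u w) = 2 * T"
        using that T by (auto simp: cmod_def)
      finally show ?thesis by simp
    qed
    show ?thesis
    proof (cases "y > 1")
      case True
      have ln: "ln y > 0" using True by simp
      have pi: "path_image (rectpath (Complex (- U) (- T)) (Complex c T)) \<subseteq> - {0}"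
        using U c T by (auto simp: path_image_rectpath)
      have "((\<lambda>w. of_real y powr w / (w - 0)) has_contour_integral
          (2 * pi * \<i> * winding_number (rectpath (Complex (- U) (- T)) (Complex c T)) 0 * of_real y powr 0))
          (rectpath (Complex (- U) (- T)) (Complex c T))"
        using pi by (intro Cauchy_integral_formula_convex_simple[OF convex_UNIV hol]) auto
      moreover have "winding_number (rectpath (Complex (- U) (- T)) (Complex c T)) 0 = 1"
        using U c T by (intro winding_number_rectpath) (auto simp: in_box_complex_iff)
      ultimately have "contour_integral (rectpath (Complex (- U) (- T)) (Complex c T)) ?f = 2 * pi * \<i>"
        using y by (intro contour_integral_unique) simp
      moreover have "continuous_on (path_image (rectpath (Complex (- U) (- T)) (Complex c T))) ?f"
        using pi by (intro holomorphic_on_imp_continuous_on holf) auto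
      ultimately have "?I - 2 * pi * \<i> =
         - (contour_integral (linepath (Complex (- U) (- T)) (Complex c (- T))) ?f +
            contour_integral (linepath (Complex c T) (Complex (- U) T)) ?f +
            contour_integral (linepath (Complex (- U) T) (Complex (- U) (- T))) ?f)"
        using U T c by (subst (asm) contour_integral_rectpath_split) (auto simp: algebra_simps)
      also have "norm \<dots> \<le> (y powr c - y powr (- U)) / (\<bar>- T\<bar> * ln y) + (y powr c - y powr (- U)) / (\<bar>T\<bar> * ln y) + 2 * T / U"
        unfolding norm_minus_cancel
        using y U T c True
        by (intro order.trans[OF norm_triangle_ineq] add_mono contour_integral_horizontal_le vert)
          (auto simp: powr_le1 powr_minus inverse_le_1_iff ge_one_powr_ge_zero)
      also have "\<dots> = 2 * (y powr c - y powr (- U)) / (T * ln y) + 2 * T / U" using T by simp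
      also have "\<dots> \<le> ?A + 2 * T / U"
        using T ln y by (intro add_right_mono) (auto intro!: divide_right_mono mult_left_mono)
      finally show ?thesis using True by (simp add: U_def)
    next
      case False
      then have ln: "ln y < 0" and y1: "y < 1" using y by auto
      have alg: "i = a + t + b" if "0 = a + b + t + l" "i = - l" for i a b t l :: complex
        using that by (simp add: eq_neg_iff_add_eq_0 add_eq_0_iff)
      have pi: "path_image (rectpath (Complex c (- T)) (Complex U T)) \<subseteq> {s. Re s > 0}"
        using U c T by (auto simp: path_image_rectpath)
      have holP: "?f holomorphic_on {s. Re s > 0}" by (rule holf) auto
      have "contour_integral (rectpath (Complex c (- T)) (Complex U T)) ?f = 0"
        using pi by (intro contour_integral_unique Cauchy_theorem_convex_simple[OF holP] convex_halfspace_Re_gt) auto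
      moreover have "continuous_on (path_image (rectpath (Complex c (- T)) (Complex U T))) ?f"
        using pi by (intro holomorphic_on_imp_continuous_on holomorphic_on_subset[OF holP])
      ultimately have "0 = contour_integral (linepath (Complex c (- T)) (Complex U (- T))) ?f +
            contour_integral (linepath (Complex U (- T)) (Complex U T)) ?f +
            contour_integral (linepath (Complex U T) (Complex c T)) ?f +
            contour_integral (linepath (Complex c T) (Complex c (- T))) ?f"
        using U T c by (subst (asm) contour_integral_rectpath_split) auto
      moreover have "?I = - contour_integral (linepath (Complex c T) (Complex c (- T))) ?f"
      proof (rule contour_integral_reverse_linepath)
        have "closed_segment (Complex c (- T)) (Complex c T) \<subseteq> {s. Re s > 0}"
          using c by (auto simp: closed_segment_same_Re)
        then show "continuous_on (closed_segment (Complex c (- T)) (Complex c T)) ?f"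
          by (intro holomorphic_on_imp_continuous_on holomorphic_on_subset[OF holP])
      qed
      ultimately have "?I = contour_integral (linepath (Complex c (- T)) (Complex U (- T))) ?f +
            contour_integral (linepath (Complex U T) (Complex c T)) ?f +
            contour_integral (linepath (Complex U (- T)) (Complex U T)) ?f"
        by (rule alg)
      also have "norm \<dots> \<le> (y powr U - y powr c) / (\<bar>- T\<bar> * ln y) + (y powr U - y powr c) / (\<bar>T\<bar> * ln y) + 2 * T / U"
        using y U T c y1
        by (intro order.trans[OF norm_triangle_ineq] add_mono contour_integral_horizontal_le vert)
          (auto simp: powr_le1)
      also have "\<dots> = 2 * (y powr c - y powr U) / (T * \<bar>ln y\<bar>) + 2 * T / U" using T ln by (simp add: field_simps)
      also have "\<dots> \<le> ?A + 2 * T / U"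
        using T y by (intro add_right_mono divide_right_mono mult_left_mono) auto
      finally show ?thesis using False by (simp add: U_def)
    qed
  qed
  then have "norm (?I - (if y > 1 then 2 * pi * \<i> else 0)) \<le> ?A + 0"
    by (intro LIMSEQ_le_const[OF lim]) blast
  then show ?thesis by simp
qed

definition mertens :: "nat \<Rightarrow> real" where
  "mertens N = (\<Sum>n=1..N. mu n)"

text \<open>Perron's error contains 1 / |ln (y / n)|. With y = N + 1/2 every integer n is at
  distance at least 1/2 from y, so this logarithm is at least of order 1/y and the boundary case y =
  n cannot occur.\<close>

lemma abs_ln_half_ge:
  fixes N n :: nat
  assumes "n > 0" "N > 0"
  shows "\<bar>ln ((real N + 1 / 2) / real n)\<bar> \<ge> 1 / (4 * (real N + 1 / 2))"
    and "(real N + 1 / 2) / real n \<noteq> 1" and "(real N + 1 / 2) / real n > 1 \<longleftrightarrow> n \<le> N"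
proof -
  let ?y = "real N + 1 / 2"
  have ln_ge: "ln z \<ge> 1 - 1 / z" if "z > 0" for z :: real
    using ln_le_minus_one[of "1 / z"] that by (simp add: ln_div)
  have "real n \<noteq> ?y"
  proof
    assume "real n = ?y"
    then have "real (2 * n) = real (2 * N + 1)" by simp
    then have "2 * n = 2 * N + 1" by (simp only: of_nat_eq_iff)
    then show False by presburger
  qed
  then show "?y / real n \<noteq> 1" using assms by auto
  have "?y > real n \<longleftrightarrow> n \<le> N"
  proof
    assume "?y > real n"
    then have "real n < real (N + 1)" by simp
    then show "n \<le> N" by simp
  qed (auto intro: le_less_trans[of _ "real N"])
  then show iff: "?y / real n > 1 \<longleftrightarrow> n \<le> N" using assms by (simp add: field_simps)
  show "\<bar>ln (?y / real n)\<bar> \<ge> 1 / (4 * ?y)"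
  proof (cases "n \<le> N")
    case True
    have "1 / (4 * ?y) \<le> (1 / 2) / ?y" by (simp add: field_simps)
    also have "\<dots> \<le> (?y - real n) / ?y" using True by (intro divide_right_mono) auto
    also have "\<dots> = 1 - real n / ?y" by (simp add: diff_divide_distrib)
    also have "\<dots> \<le> ln (?y / real n)" using ln_ge[of "?y / real n"] assms by simp
    finally show ?thesis by linarith
  next
    case False
    then have n: "real n \<ge> real N + 1" by simp
    have "1 / (4 * ?y) \<le> (1 / 2) / (real N + 1)" using assms by (simp add: field_simps)
    also have "\<dots> = 1 - ?y / (real N + 1)" by (simp add: field_simps)
    also have "\<dots> \<le> 1 - ?y / real n" using n by (intro diff_mono divide_left_mono) auto
    also have "\<dots> \<le> ln (real n / ?y)" using ln_ge[of "real n / ?y"] assms by simp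
    also have "\<dots> = - ln (?y / real n)" using assms by (simp add: ln_div)
    finally show ?thesis by linarith
  qed
qed

text \<open>On Re s = 2 the series of 1/zeta converges uniformly and is integrated term by term,
  each term being Perron's integral for y/n. The errors are of size y^3 / (T n^2): the square of y/n
  from the abscissa 2, one more y from the lower bound for the logarithm.\<close>

lemma mertens_perron:
  obtains K where "K \<ge> 0"
    "\<And>N T. N > 0 \<Longrightarrow> T > 0 \<Longrightarrow>
      norm (contour_integral (linepath (Complex 2 (- T)) (Complex 2 T)) (\<lambda>s. of_real (real N + 1 / 2) powr s / s * (1 / zeta s))
        - 2 * pi * \<i> * mertens N) \<le> K * (real N + 1 / 2) ^ 3 / T"
proof -
  define Z where "Z = (\<Sum>n. real n powr (- 2))"
  have smZ: "summable (\<lambda>n. real n powr (- 2))" by (simp add: summable_real_powr_iff)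
  have Z0: "Z \<ge> 0" unfolding Z_def by (intro suminf_nonneg smZ) auto
  have main: "norm (contour_integral (linepath (Complex 2 (- T)) (Complex 2 T)) (\<lambda>s. of_real (real N + 1 / 2) powr s / s * (1 / zeta s))
        - 2 * pi * \<i> * mertens N) \<le> 8 * Z * (real N + 1 / 2) ^ 3 / T"
    if N: "N > 0" and T: "T > 0" for N :: nat and T :: real
  proof -
    define y where "y = real N + 1 / 2"
    have y: "y > 1" using N by (simp add: y_def)
    define f where "f = (\<lambda>s. of_real y powr s / s * (1 / zeta s))"
    define g where "g = (\<lambda>n s. (of_real (mu n) * of_nat n powr (- s)) * (of_real y powr s / s) :: complex)"
    let ?seg = "closed_segment (Complex 2 (- T)) (Complex 2 T)"
    let ?l = "linepath (Complex 2 (- T)) (Complex 2 T)"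
    have re: "Re s = 2" if "s \<in> ?seg" for s using that by (simp add: closed_segment_same_Re)
    have s0: "s \<noteq> 0" if "s \<in> ?seg" for s using re[OF that] by auto
    have ns: "norm (of_real y powr s / s) \<le> y powr 2 / 2" if "s \<in> ?seg" for s
    proof -
      have "2 \<le> norm s" using re[OF that] abs_Re_le_cmod[of s] by simp
      then show ?thesis
        using re[OF that] y unfolding norm_divide by (intro frac_le) (auto simp: norm_powr_real_powr)
    qed
    have u: "uniform_limit ?seg (\<lambda>J s. \<Sum>n<J. g n s) (\<lambda>s. \<Sum>n. g n s) sequentially"
    proof (rule Weierstrass_m_test)
      fix n s assume s: "s \<in> ?seg"
      have "norm (of_real (mu n) * of_nat n powr (- s) :: complex) \<le> 1 * real n powr (- 2)"
        unfolding norm_mult using re[OF s] abs_mu_le[of n]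
        by (intro mult_mono) (auto simp: norm_powr_real_powr)
      then show "norm (g n s) \<le> real n powr (- 2) * (y powr 2 / 2)"
        unfolding g_def norm_mult[of _ "_ / _"] using ns[OF s] by (intro mult_mono) auto
    qed (intro summable_mult2 smZ)
    have geq: "(\<Sum>n. g n s) = f s" if s: "s \<in> ?seg" for s
    proof -
      have "((\<lambda>n. of_real (mu n) * of_nat n powr (- s)) has_sum 1 / zeta s) {0<..}"
        using re[OF s] by (intro mu_has_sum) simp
      then have "((\<lambda>n. of_real (mu n) * of_nat n powr (- s)) has_sum 1 / zeta s) UNIV"
        by (rule has_sum_cong_neutral[THEN iffD1, rotated -1]) auto
      then have "(\<lambda>n. of_real (mu n) * of_nat n powr (- s)) sums (1 / zeta s)"
        by (rule has_sum_imp_sums)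
      then have "(\<lambda>n. g n s) sums (1 / zeta s * (of_real y powr s / s))"
        unfolding g_def by (rule sums_mult2)
      then show ?thesis by (simp add: sums_iff f_def mult.commute)
    qed
    have cont: "continuous_on ?seg (g n)" for n
    proof (cases "n = 0")
      case False
      then show ?thesis unfolding g_def using y s0
        by (intro holomorphic_on_imp_continuous_on holomorphic_intros) auto
    qed (simp add: g_def[abs_def])
    have u': "uniform_limit ?seg (\<lambda>J s. \<Sum>n<J. g n s) f sequentially"
      using u by (rule uniform_limit_cong'[THEN iffD1, rotated -1]) (auto simp: geq)
    from contour_integral_sums_linepath[OF u' cont]
    obtain J where J: "(f has_contour_integral J) ?l" "(\<lambda>n. contour_integral ?l (g n)) sums J" by blast
    have Jeq: "contour_integral ?l f = J" using J(1) by (rule contour_integral_unique)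
    define r where "r = (\<lambda>n. if n > 0 \<and> n \<le> N then of_real (mu n) * (2 * pi * \<i>) else 0 :: complex)"
    have "r sums (\<Sum>n\<in>{1..N}. r n)" by (rule sums_finite) (auto simp: r_def)
    also have "(\<Sum>n\<in>{1..N}. r n) = 2 * pi * \<i> * mertens N"
      unfolding mertens_def r_def of_real_sum sum_distrib_left by (intro sum.cong) auto
    finally have r: "r sums (2 * pi * \<i> * mertens N)" .
    have bd: "norm (contour_integral ?l (g n) - r n) \<le> real n powr (- 2) * (8 * y ^ 3 / T)" for n
    proof (cases "n = 0")
      case True
      then show ?thesis by (simp add: g_def[abs_def] r_def)
    next
      case False
      then have n: "n > 0" by simp
      define w where "w = y / real n"
      have w: "w > 0" "w \<noteq> 1" "w > 1 \<longleftrightarrow> n \<le> N" and lnw: "\<bar>ln w\<bar> \<ge> 1 / (4 * y)"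
        using abs_ln_half_ge[OF n N] y n unfolding w_def y_def by auto
      have "g n = (\<lambda>s. of_real (mu n) * (of_real w powr s / s))"
      proof
        fix s :: complex
        have "of_real (w * real n) powr s = of_real w powr s * of_nat n powr s"
          using powr_times_real[of "of_real w" "of_nat n" s] w by simp
        moreover have "w * real n = y" using n by (simp add: w_def)
        moreover have "of_nat n powr (- s) * (of_nat n powr s) = (1::complex)"
          using n by (simp add: powr_minus)
        ultimately show "g n s = of_real (mu n) * (of_real w powr s / s)"
          by (simp add: g_def)
      qed
      moreover have "(\<lambda>s. of_real w powr s / s) contour_integrable_on ?l"
        using w s0 by (intro contour_integrable_continuous_linepath holomorphic_on_imp_continuous_on holomorphic_intros) auto
      ultimately have "contour_integral ?l (g n) = of_real (mu n) * contour_integral ?l (\<lambda>s. of_real w powr s / s)"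
        by (simp only: contour_integral_lmul)
      moreover have "r n = of_real (mu n) * (if w > 1 then 2 * pi * \<i> else 0)"
        using n w by (simp add: r_def)
      ultimately have "norm (contour_integral ?l (g n) - r n) =
          \<bar>mu n\<bar> * norm (contour_integral ?l (\<lambda>s. of_real w powr s / s) - (if w > 1 then 2 * pi * \<i> else 0))"
        by (simp only: right_diff_distrib[symmetric] norm_mult norm_of_real)
      also have "\<dots> \<le> 1 * (2 * w powr 2 / (T * \<bar>ln w\<bar>))"
        using w T by (intro mult_mono abs_mu_le perron_truncated) auto
      also have "\<dots> \<le> 2 * w powr 2 / (T * (1 / (4 * y)))"
      proof -
        have "0 < 1 / (4 * y)" using y by simp
        with lnw have "0 < \<bar>ln w\<bar>" by linarith
        then have "2 * w powr 2 / (T * \<bar>ln w\<bar>) \<le> 2 * w powr 2 / (T * (1 / (4 * y)))"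
          using lnw T y by (intro divide_left_mono mult_left_mono mult_pos_pos) auto
        then show ?thesis by simp
      qed
      also have "w powr 2 = y ^ 2 * real n powr (- 2)"
        using y n by (simp add: w_def powr_divide powr_minus field_simps powr_numeral)
      also have "2 * (y ^ 2 * real n powr (- 2)) / (T * (1 / (4 * y))) = real n powr (- 2) * (8 * y ^ 3 / T)"
        using T y by (simp add: field_simps power2_eq_square power3_eq_cube)
      finally show ?thesis .
    qed
    have "norm (J - 2 * pi * \<i> * mertens N) \<le> Z * (8 * y ^ 3 / T)"
    proof (rule norm_sums_le)
      show "(\<lambda>n. contour_integral ?l (g n) - r n) sums (J - 2 * pi * \<i> * mertens N)"
        by (intro sums_diff J r)
      show "(\<lambda>n. real n powr (- 2) * (8 * y ^ 3 / T)) sums (Z * (8 * y ^ 3 / T))"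
        unfolding Z_def by (intro sums_mult2 summable_sums smZ)
    qed (rule bd)
    then show ?thesis by (simp add: Jeq[symmetric] f_def y_def mult_ac)
  qed
  show ?thesis by (rule that[of "8 * Z"]) (use Z0 main in auto)
qed

section \<open>The bound for the summatory Moebius function\<close>

lemma arsinh_le_ln: 
  assumes "u \<ge> 0" shows "arsinh u \<le> ln (2 * u + 1 :: real)"
proof -
  have "sqrt (u\<^sup>2 + 1) \<le> sqrt ((u + 1)\<^sup>2)" using assms by (intro real_sqrt_le_mono) (simp add: power2_eq_square algebra_simps)
  then have "sqrt (u\<^sup>2 + 1) \<le> u + 1" using assms by simp
  moreover have "0 < u + sqrt (u\<^sup>2 + 1)" using assms by (intro add_nonneg_pos) (auto simp: add_nonneg_pos)
  ultimately show ?thesis unfolding arsinh_real_def by (intro ln_mono) auto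
qed

text \<open>1/zeta = (s - 1)/F is holomorphic in Re s > 1/2, so moving the segment from Re s = 2 to
  Re s = \<sigma> meets no pole, and the integrals over all sides are differences of a single
  primitive P. The exponential is taken at x so that one factor serves every N \<le> x.\<close>

theorem mertens_bound:
  assumes RH: "riemann_hypothesis"
  obtains C K x0 where "C > 0" "K \<ge> 1" "x0 \<ge> 3"
    "\<And>x N. x \<ge> x0 \<Longrightarrow> 1 \<le> N \<Longrightarrow> real N \<le> x \<Longrightarrow>
       \<bar>mertens N\<bar> \<le> K * sqrt (real N) * exp (C * (ln x / ln (ln x)))"
proof -
  obtain C1 K1 x1 where C1: "C1 > 0" and K1: "K1 \<ge> 1"
    and inv: "\<And>x s. x \<ge> x1 \<Longrightarrow> 1 / 2 + 6 / ln (ln x) \<le> Re s \<Longrightarrow> Re s \<le> 2 \<Longrightarrow> \<bar>Im s\<bar> \<le> x ^ 4 \<Longrightarrow>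
       norm ((s - 1) / zeta_reg s) \<le> K1 * exp (C1 * (ln x / ln (ln x)))"
    using inverse_zeta_bound[OF RH] by metis
  obtain K2 where K2: "K2 \<ge> 0" and per: "\<And>N T. N > 0 \<Longrightarrow> T > 0 \<Longrightarrow>
      norm (contour_integral (linepath (Complex 2 (- T)) (Complex 2 T)) (\<lambda>s. of_real (real N + 1 / 2) powr s / s * (1 / zeta s))
        - 2 * pi * \<i> * mertens N) \<le> K2 * (real N + 1 / 2) ^ 3 / T"
    by (rule mertens_perron) (rule that)
  \<comment> \<open>The last condition amounts to ln x \<le> exp (ln x / ln (ln x)); it absorbs the
    logarithm coming from the vertical side.\<close>
  have "eventually (\<lambda>x::real. x \<ge> max 3 x1 \<and> ln (ln x) \<ge> 10 \<and> ln (ln x) \<le> ln x / ln (ln x)) at_top"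
  proof (intro eventually_conj)
    show "eventually (\<lambda>x::real. ln (ln x) \<ge> 10) at_top" by real_asymp
    show "eventually (\<lambda>x::real. ln (ln x) \<le> ln x / ln (ln x)) at_top" by real_asymp
  qed (rule eventually_ge_at_top)
  then obtain x0 where x0: "\<And>x. x \<ge> x0 \<Longrightarrow> x \<ge> 3 \<and> x \<ge> x1 \<and> ln (ln x) \<ge> 10 \<and> ln (ln x) \<le> ln x / ln (ln x)"
    by (auto simp: eventually_at_top_linorder)
  define H where "H = {s. Re s > 1 / 2}"
  have H: "open H" "convex H" unfolding H_def by (rule open_halfspace_Re_gt convex_halfspace_Re_gt)+
  have nz: "zeta_reg s \<noteq> 0" if "s \<in> H" for s using zeta_reg_nonzero[OF RH] that by (auto simp: H_def)
  have holH: "zeta_reg holomorphic_on H"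
    by (rule holomorphic_on_subset[OF zeta_reg_holomorphic]) (auto simp: H_def)
  have main: "\<bar>mertens N\<bar> \<le> K1 * (40 + 8 * K2) * sqrt (real N) * exp ((C1 + 13) * (ln x / ln (ln x)))"
    if x: "x \<ge> max 3 x0" and N: "1 \<le> N" "real N \<le> x" for x N
  proof -
    define L where "L = ln (ln x)"
    define R where "R = ln x / L"
    \<comment> \<open>The greatest height at which 1/zeta has been bounded; it outweighs the y^3 of
      Perron's formula and the y^2 of the horizontal sides.\<close>
    define T where "T = x ^ 4"
    define y where "y = real N + 1 / 2"
    define \<sigma> where "\<sigma> = 1 / 2 + 6 / L"
    define E where "E = K1 * exp (C1 * R)"
    have x3: "x \<ge> 3" and x1: "x \<ge> x1" and L: "L \<ge> 10" "L \<le> R"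
      using x0[of x] x by (auto simp: L_def R_def)
    have T: "T > 0" using x3 by (simp add: T_def)
    have y: "y > 1" "y \<le> 2 * real N" "y \<le> 2 * x" using N by (auto simp: y_def)
    have \<sigma>: "\<sigma> > 1 / 2" "\<sigma> < 2" using L by (auto simp: \<sigma>_def field_simps)
    have "1 * 1 \<le> K1 * exp (C1 * R)" using K1 C1 L by (intro mult_mono) auto
    then have E: "E \<ge> 1" by (simp add: E_def)
    define G where "G = (\<lambda>s. (s - 1) / zeta_reg s)"
    have GE: "norm (G s) \<le> E" if "\<sigma> \<le> Re s" "Re s \<le> 2" "\<bar>Im s\<bar> \<le> T" for s
      using inv[OF x1, of s] that by (simp add: G_def E_def R_def L_def \<sigma>_def T_def)
    define f where "f = (\<lambda>s. of_real y powr s / s * G s)"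
    have "f holomorphic_on H"
      unfolding f_def G_def using nz y by (intro holomorphic_intros holH) (auto simp: H_def)
    then obtain P where P0: "\<And>s. s \<in> H \<Longrightarrow> (P has_field_derivative f s) (at s within H)"
      using holomorphic_convex_primitive'[OF H(2,1)] by blast
    then have P: "(P has_field_derivative f s) (at s)" if "s \<in> H" for s
      using that H(1) by (simp only: at_within_open)
    have inH: "Complex u v \<in> H" if "\<sigma> \<le> u" for u v using that \<sigma> by (simp add: H_def)
    have nf: "norm (f s) \<le> y powr Re s / norm s * E" if "\<sigma> \<le> Re s" "Re s \<le> 2" "\<bar>Im s\<bar> \<le> T" for s
      unfolding f_def norm_mult norm_divide using y GE[OF that]
      by (intro mult_mono) (auto simp: norm_powr_real_powr)
    \<comment> \<open>arsinh (2u) is an antiderivative of a majorant of 1/|s|: since \<sigma> \<ge>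
      1/2, the modulus of \<sigma> + iu is at least sqrt (4 u^2 + 1) / 2.\<close>
    have left: "norm (P (Complex \<sigma> 0 + of_real T * \<i>) - P (Complex \<sigma> 0 + of_real (- T) * \<i>)) \<le>
        y powr \<sigma> * E * arsinh (2 * T) - y powr \<sigma> * E * arsinh (2 * (- T))"
    proof (rule primitive_bound[OF P])
      show "- T \<le> T" using T by linarith
    next
      fix u :: real
      have e: "Complex \<sigma> 0 + of_real u * \<i> = Complex \<sigma> u" by (simp add: complex_eq_iff)
      show "((\<lambda>u. y powr \<sigma> * E * arsinh (2 * u)) has_real_derivative y powr \<sigma> * E * (2 / sqrt ((2 * u)\<^sup>2 + 1))) (at u)"
      proof (rule DERIV_cmult)
        have "((\<lambda>u. arsinh (2 * u)) has_real_derivative 1 / sqrt ((2 * u)\<^sup>2 + 1) * 2) (at u)"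
          by (rule DERIV_chain2[OF arsinh_real_has_field_derivative]) (auto intro!: derivative_eq_intros)
        then show "((\<lambda>u. arsinh (2 * u)) has_real_derivative 2 / sqrt ((2 * u)\<^sup>2 + 1)) (at u)" by simp
      qed
      show "Complex \<sigma> 0 + of_real u * \<i> \<in> H" unfolding e by (rule inH) simp
      assume u: "- T \<le> u" "u \<le> T"
      have "(sqrt ((2 * u)\<^sup>2 + 1) / 2)\<^sup>2 \<le> (norm (Complex \<sigma> u))\<^sup>2"
      proof -
        have "(1 / 2)\<^sup>2 \<le> \<sigma>\<^sup>2" using \<sigma> by (intro power_mono) auto
        then show ?thesis by (simp add: cmod_power2 power_divide)
      qed
      then have "sqrt ((2 * u)\<^sup>2 + 1) / 2 \<le> norm (Complex \<sigma> u)" by (rule power2_le_imp_le) simp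
      moreover have "0 < sqrt ((2 * u)\<^sup>2 + 1)" by (simp add: add_nonneg_pos)
      ultimately have "y powr \<sigma> / norm (Complex \<sigma> u) \<le> y powr \<sigma> / (sqrt ((2 * u)\<^sup>2 + 1) / 2)"
        by (intro divide_left_mono) (auto intro!: mult_pos_pos)
      then have "y powr \<sigma> / norm (Complex \<sigma> u) * E \<le> y powr \<sigma> / (sqrt ((2 * u)\<^sup>2 + 1) / 2) * E"
        using E by (intro mult_right_mono) auto
      moreover have "norm (f (Complex \<sigma> u)) \<le> y powr \<sigma> / norm (Complex \<sigma> u) * E"
        using nf[of "Complex \<sigma> u"] u \<sigma> by (simp add: abs_le_iff)
      ultimately have "norm (f (Complex \<sigma> u)) \<le> y powr \<sigma> / (sqrt ((2 * u)\<^sup>2 + 1) / 2) * E" by linarith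
      also have "\<dots> = y powr \<sigma> * E * (2 / sqrt ((2 * u)\<^sup>2 + 1))" by simp
      finally show "norm (f (Complex \<sigma> 0 + of_real u * \<i>)) * norm \<i> \<le> y powr \<sigma> * E * (2 / sqrt ((2 * u)\<^sup>2 + 1))"
        unfolding e by simp
    qed
    have hor: "norm (P (Complex 2 v) - P (Complex \<sigma> v)) \<le> 2 * (y\<^sup>2 * E / T)" if v: "\<bar>v\<bar> = T" for v
    proof -
      have e: "Complex 0 v + of_real u * 1 = Complex u v" for u by (simp add: complex_eq_iff)
      have "norm (P (Complex 0 v + of_real 2 * 1) - P (Complex 0 v + of_real \<sigma> * 1)) \<le>
          2 * (y\<^sup>2 * E / T) - \<sigma> * (y\<^sup>2 * E / T)"
      proof (rule primitive_bound[OF P])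
        show "\<sigma> \<le> 2" using \<sigma> by linarith
      next
        fix u :: real
        show "((\<lambda>u. u * (y\<^sup>2 * E / T)) has_real_derivative (y\<^sup>2 * E / T)) (at u)"
          using T by (auto intro!: derivative_eq_intros)
        assume u: "\<sigma> \<le> u" "u \<le> 2"
        show "Complex 0 v + of_real u * 1 \<in> H" unfolding e by (rule inH[OF u(1)])
        have "T \<le> norm (Complex u v)" using abs_Im_le_cmod[of "Complex u v"] v by simp
        moreover have "y powr u \<le> y\<^sup>2" using powr_mono[OF u(2), of y] y by (simp add: powr_numeral)
        ultimately have "y powr u / norm (Complex u v) * E \<le> y\<^sup>2 / T * E"
          using T E y by (intro mult_right_mono frac_le) auto
        moreover have "norm (f (Complex u v)) \<le> y powr u / norm (Complex u v) * E"
          using nf[of "Complex u v"] u v by simp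
        ultimately have "norm (f (Complex u v)) \<le> y\<^sup>2 / T * E" by linarith
        then show "norm (f (Complex 0 v + of_real u * 1)) * norm (1::complex) \<le> y\<^sup>2 * E / T"
          unfolding e by simp
      qed
      also have "\<dots> \<le> 2 * (y\<^sup>2 * E / T)" using \<sigma> E T by simp
      finally show ?thesis by (simp only: e)
    qed
    have seg: "closed_segment (Complex 2 (- T)) (Complex 2 T) \<subseteq> H"
      using \<sigma> by (auto simp: closed_segment_same_Re H_def)
    have "(f has_contour_integral (P (Complex 2 T) - P (Complex 2 (- T)))) (linepath (Complex 2 (- T)) (Complex 2 T))"
      using contour_integral_primitive[OF P0, of "linepath (Complex 2 (- T)) (Complex 2 T)"] seg by simp
    moreover have "of_real (real N + 1 / 2) powr s / s * (1 / zeta s) = f s"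
      if "s \<in> path_image (linepath (Complex 2 (- T)) (Complex 2 T))" for s
    proof -
      have "Re s = 2" using that by (simp add: closed_segment_same_Re)
      then have "s \<noteq> 1" by auto
      then show ?thesis using \<open>Re s = 2\<close> by (simp add: f_def G_def y_def zeta_reg_eq)
    qed
    ultimately have "contour_integral (linepath (Complex 2 (- T)) (Complex 2 T)) (\<lambda>s. of_real (real N + 1 / 2) powr s / s * (1 / zeta s))
        = P (Complex 2 T) - P (Complex 2 (- T))"
      by (intro contour_integral_unique) (rule has_contour_integral_eq, auto)
    with per[of N T] N T have pm: "norm (P (Complex 2 T) - P (Complex 2 (- T)) - 2 * pi * \<i> * mertens N) \<le> K2 * y ^ 3 / T"
      by (simp add: y_def)
    have yx: "y ^ 3 / T \<le> 8" "y\<^sup>2 / T \<le> 4"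
    proof -
      have "y ^ 3 \<le> (2 * x) ^ 3" "y\<^sup>2 \<le> (2 * x)\<^sup>2" using y by (intro power_mono; simp)+
      moreover have "(2 * x) ^ 3 \<le> 8 * T" "(2 * x)\<^sup>2 \<le> 4 * T"
        using x3 power_increasing[of 3 4 x] power_increasing[of 2 4 x] by (auto simp: T_def power_mult_distrib)
      ultimately show "y ^ 3 / T \<le> 8" "y\<^sup>2 / T \<le> 4" using T by (auto simp: field_simps)
    qed
    have lnx: "ln x \<le> exp R"
    proof -
      have "ln x = exp L" using x3 one_le_ln[OF x3] by (simp add: L_def)
      then show ?thesis using L by simp
    qed
    have ar: "arsinh (2 * T) \<le> 6 * exp R"
    proof -
      have "arsinh (2 * T) \<le> ln (2 * (2 * T) + 1)" using T by (intro arsinh_le_ln) simp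
      also have "\<dots> \<le> ln (x ^ 6)"
      proof (intro ln_mono)
        have "9 * T \<le> x ^ 2 * x ^ 4" unfolding T_def using x3 power_mono[of 3 x 2] by (intro mult_right_mono) auto
        moreover have "1 \<le> T" unfolding T_def using x3 by (intro one_le_power) auto
        ultimately show "2 * (2 * T) + 1 \<le> x ^ 6" by (simp add: power_add[symmetric])
      qed (use T x3 in auto)
      also have "\<dots> = 6 * ln x" using x3 by (simp add: ln_realpow)
      finally show ?thesis using lnx by simp
    qed
    have ar0: "0 \<le> arsinh (2 * T)"
    proof -
      have "1 \<le> sqrt ((2 * T)\<^sup>2 + 1)" by simp
      then have "1 \<le> 2 * T + sqrt ((2 * T)\<^sup>2 + 1)" using T by linarith
      then show ?thesis unfolding arsinh_real_def by (rule ln_ge_zero)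
    qed
    \<comment> \<open>y^(1/2) yields sqrt N. With y \<le> x^2 the factor y^(6/L) becomes exp (12 R),
      the price for staying 6/L off the critical line.\<close>
    have ys: "y powr \<sigma> \<le> 2 * sqrt (real N) * exp (12 * R)"
    proof -
      have "y powr (1 / 2) \<le> (4 * real N) powr (1 / 2)" using y by (intro powr_mono2) auto
      also have "\<dots> = 2 * sqrt (real N)" by (simp add: powr_half_sqrt real_sqrt_mult)
      finally have a: "y powr (1 / 2) \<le> 2 * sqrt (real N)" .
      have "2 * x \<le> x\<^sup>2" using x3 by (simp add: power2_eq_square)
      then have "y powr (6 / L) \<le> (x\<^sup>2) powr (6 / L)" using y L by (intro powr_mono2) auto
      also have "\<dots> = exp (12 * R)"
        using x3 by (simp add: powr_def ln_realpow R_def)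
      finally have "y powr (6 / L) \<le> exp (12 * R)" .
      with a show ?thesis unfolding \<sigma>_def powr_add by (intro mult_mono) auto
    qed
    \<comment> \<open>Common size of all contributions: 13 = 12 + 1, with 12 from y^\<sigma> and 1
      from arsinh (2T).\<close>
    define W where "W = sqrt (real N) * E * exp (13 * R)"
    have e: "Complex \<sigma> 0 + of_real u * \<i> = Complex \<sigma> u" for u by (simp add: complex_eq_iff)
    have "norm (P (Complex \<sigma> T) - P (Complex \<sigma> (- T))) \<le> 2 * (y powr \<sigma> * E * arsinh (2 * T))"
      using left unfolding e by (simp add: mult_ac)
    also have "\<dots> \<le> 2 * ((2 * sqrt (real N) * exp (12 * R)) * E * (6 * exp R))"
      using ys ar ar0 E by (intro mult_left_mono mult_mono) auto
    also have "\<dots> = 24 * W"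
    proof -
      have "exp (13 * R) = exp (12 * R) * exp R" by (simp flip: exp_add)
      then show ?thesis by (simp add: W_def)
    qed
    finally have b1: "norm (P (Complex \<sigma> T) - P (Complex \<sigma> (- T))) \<le> 24 * W" .
    have EW: "E \<le> W"
    proof -
      have "1 * 1 \<le> sqrt (real N) * exp (13 * R)" using N L by (intro mult_mono) auto
      then have "E * 1 \<le> E * (sqrt (real N) * exp (13 * R))" using E by (intro mult_left_mono) auto
      then show ?thesis by (simp add: W_def mult_ac)
    qed
    have b2: "norm (P (Complex 2 v) - P (Complex \<sigma> v)) \<le> 8 * W" if "\<bar>v\<bar> = T" for v
    proof -
      have "y\<^sup>2 / T * E \<le> 4 * W" using yx EW E y T by (intro mult_mono) auto
      then show ?thesis using hor[OF that] by simp
    qed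
    have b3: "K2 * y ^ 3 / T \<le> 8 * K2 * W"
    proof -
      have "K2 * (y ^ 3 / T) \<le> K2 * (8 * W)" using yx(1) EW E K2 by (intro mult_left_mono) auto
      then show ?thesis by simp
    qed
    have "2 * pi * \<i> * mertens N = (P (Complex 2 T) - P (Complex \<sigma> T)) + (P (Complex \<sigma> T) - P (Complex \<sigma> (- T)))
        - (P (Complex 2 (- T)) - P (Complex \<sigma> (- T))) - (P (Complex 2 T) - P (Complex 2 (- T)) - 2 * pi * \<i> * mertens N)"
      by simp
    also have "norm \<dots> \<le> 8 * W + 24 * W + 8 * W + 8 * K2 * W"
      using T by (intro order.trans[OF norm_triangle_ineq4] order.trans[OF norm_triangle_ineq] add_mono b1 b2
          order.trans[OF pm b3]) auto
    finally have "2 * pi * \<bar>mertens N\<bar> \<le> (40 + 8 * K2) * W"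
      by (simp add: norm_mult algebra_simps)
    moreover have "1 * \<bar>mertens N\<bar> \<le> 2 * pi * \<bar>mertens N\<bar>"
      using pi_gt3 by (intro mult_right_mono) auto
    ultimately have "\<bar>mertens N\<bar> \<le> (40 + 8 * K2) * W" by linarith
    also have "W = sqrt (real N) * K1 * exp ((C1 + 13) * R)"
      by (simp add: W_def E_def exp_add distrib_right)
    finally show ?thesis by (simp add: R_def L_def mult_ac)
  qed
  have "1 * 1 \<le> K1 * (40 + 8 * K2)" using K1 K2 by (intro mult_mono) auto
  then show ?thesis
    by (intro that[of "C1 + 13" "K1 * (40 + 8 * K2)" "max 3 x0"]) (use C1 main in auto)
qed

section \<open>Counting k-free numbers\<close>

definition kfree :: "nat \<Rightarrow> nat \<Rightarrow> real" where
  "kfree k = mfun (\<lambda>j. if j < k then 1 else 0)"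

text \<open>Coefficients of 1 / zeta(k s): for k > 0 they live on k-th powers, with value
  \<open>mu e\<close> at e^k. As a multiplicative function of d, it allows the identity with
  \<open>kfree\<close> to be checked on prime powers.\<close>

definition mu_pow :: "nat \<Rightarrow> nat \<Rightarrow> real" where
  "mu_pow k = mfun (\<lambda>j. if j = 0 then 1 else if j = k then -1 else 0)"

lemma mult_fn_kfree: "k > 0 \<Longrightarrow> mult_fn (kfree k)"
  and kfree_prime_power: "k > 0 \<Longrightarrow> prime p \<Longrightarrow> kfree k (p ^ j) = (if j < k then 1 else 0)"
  unfolding kfree_def by (rule mult_fn_mfun mfun_prime_power; simp)+

lemma mult_fn_mu_pow: "mult_fn (mu_pow k)"
  and mu_pow_prime_power: "prime p \<Longrightarrow> mu_pow k (p ^ j) = (if j = 0 then 1 else if j = k then -1 else 0)"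
  unfolding mu_pow_def by (rule mult_fn_mfun mfun_prime_power; simp)+

lemma kfree_conv_mu_pow:
  assumes k: "k > 0" and n: "n > 0"
  shows "kfree k n = (\<Sum>d | d dvd n. mu_pow k d)"
proof -
  have one: "mult_fn (\<lambda>n. 1 :: real)" by (simp add: mult_fn_def)
  have "kfree k n = dconv (mu_pow k) (\<lambda>n. 1) n"
  proof (rule mult_fn_cong[OF mult_fn_kfree[OF k] mult_fn_dconv[OF mult_fn_mu_pow one] _ n])
    fix p j :: nat assume p: "prime p"
    have "(\<Sum>i\<le>j. mu_pow k (p ^ i)) = (\<Sum>i\<le>j. (if i = 0 then 1 else 0) + (if i = k then -1 else 0))"
      using k by (intro sum.cong) (auto simp: mu_pow_prime_power[OF p])
    also have "\<dots> = (if j < k then 1 else 0)"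
      by (simp add: sum.distrib)
    finally show "kfree k (p ^ j) = dconv (mu_pow k) (\<lambda>n. 1) (p ^ j)"
      by (simp add: dconv_prime_power[OF mult_fn_mu_pow one p] kfree_prime_power[OF k p])
  qed
  then show ?thesis by (simp add: dconv_def)
qed

lemma mu_pow_power:
  assumes k: "k > 0" and e: "e > 0"
  shows "mu_pow k (e ^ k) = mu e"
proof (rule mult_fn_cong[OF _ mult_fn_mu _ e])
  show "mult_fn (\<lambda>e. mu_pow k (e ^ k))"
    unfolding mult_fn_def
  proof (intro conjI allI impI)
    fix p j n :: nat assume p: "prime p" "\<not> p dvd n"
    then have "\<not> p dvd n ^ k" using prime_dvd_power by blast
    then show "mu_pow k ((p ^ j * n) ^ k) = mu_pow k ((p ^ j) ^ k) * mu_pow k (n ^ k)"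
      using mult_fn_mult[OF mult_fn_mu_pow p(1), of "n ^ k" k "j * k"]
      by (simp add: power_mult_distrib power_mult)
  qed (use mult_fn_1[OF mult_fn_mu_pow] in simp)
  fix p j :: nat assume p: "prime p"
  show "mu_pow k ((p ^ j) ^ k) = mu (p ^ j)"
    using k mu_pow_prime_power[OF p, of k "j * k"] mu_prime_power[OF p, of j]
    by (auto simp flip: power_mult)
qed

lemma mu_pow_nonzero_imp_power:
  assumes "d > 0" "mu_pow k d \<noteq> 0"
  obtains e where "d = e ^ k"
proof -
  have mult: "multiplicity p d = k" if "p \<in> prime_factors d" for p
  proof -
    have "(if multiplicity p d = 0 then 1 else if multiplicity p d = k then -1 else 0) \<noteq> (0::real)"
      using assms(2) that unfolding mu_pow_def mfun_def by (auto simp: prod_zero_iff split: if_splits)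
    moreover have "multiplicity p d \<noteq> 0" using that by (simp add: prime_factors_multiplicity)
    ultimately show ?thesis by (auto split: if_splits)
  qed
  have "d = (\<Prod>p\<in>prime_factors d. p ^ multiplicity p d)"
    using assms(1) by (simp add: prod_prime_factors)
  also have "\<dots> = (\<Prod>p\<in>prime_factors d. p) ^ k"
    unfolding prod_power_distrib by (intro prod.cong) (simp_all add: mult)
  finally show ?thesis by (rule that)
qed

text \<open>The sum runs over 1..N and not over a set depending on n, which permits the exchange of
  summations in the count.\<close>

lemma kfree_conv_mu:
  assumes k: "k > 0" and n: "0 < n" "n \<le> N"
  shows "kfree k n = (\<Sum>e=1..N. if e ^ k dvd n then mu e else 0)"
proof -
  have le: "e \<le> N" if "e ^ k dvd n" for e
  proof -
    have "e dvd n" using that k by (meson dvd_power dvd_trans)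
    then show ?thesis using n by (meson dvd_imp_le le_trans)
  qed
  have inj: "inj_on (\<lambda>e. e ^ k) {e. 0 < e \<and> e ^ k dvd n}"
  proof (rule inj_onI)
    fix a b :: nat assume "a ^ k = b ^ k"
    then show "a = b" using power_eq_iff_eq_base[of k a b] k by simp
  qed
  have "kfree k n = (\<Sum>d | d dvd n. mu_pow k d)" by (rule kfree_conv_mu_pow) (use assms in auto)
  also have "\<dots> = (\<Sum>d\<in>(\<lambda>e. e ^ k) ` {e. 0 < e \<and> e ^ k dvd n}. mu_pow k d)"
  proof (rule sum.mono_neutral_right)
    show "finite {d. d dvd n}" using n by simp
    show "\<forall>d\<in>{d. d dvd n} - (\<lambda>e. e ^ k) ` {e. 0 < e \<and> e ^ k dvd n}. mu_pow k d = 0"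
    proof (rule ballI, rule ccontr)
      fix d assume d: "d \<in> {d. d dvd n} - (\<lambda>e. e ^ k) ` {e. 0 < e \<and> e ^ k dvd n}" and nz: "mu_pow k d \<noteq> 0"
      have d0: "d > 0" using d n by (auto dest: dvd_pos_nat)
      obtain e where e: "d = e ^ k" using mu_pow_nonzero_imp_power[OF d0 nz] .
      have "e > 0" using e d0 k by (cases e) auto
      then show False using d e by auto
    qed
  qed auto
  also have "\<dots> = (\<Sum>e | 0 < e \<and> e ^ k dvd n. mu e)"
    unfolding sum.reindex[OF inj] using k by (intro sum.cong) (auto simp: mu_pow_power)
  also have "\<dots> = (\<Sum>e=1..N. if e ^ k dvd n then mu e else 0)"
    using le by (subst sum.inter_filter[symmetric]) (auto intro!: sum.cong)
  finally show ?thesis .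
qed

lemma sum_multiples:
  fixes D :: nat
  assumes D: "D > 0"
  shows "(\<Sum>n=1..N. if D dvd n then h n else 0) = (\<Sum>l=1..N div D. h (D * l))"
proof -
  have "{n \<in> {1..N}. D dvd n} = (\<lambda>l. D * l) ` {1..N div D}"
  proof (intro equalityI subsetI)
    fix n assume "n \<in> {n \<in> {1..N}. D dvd n}"
    then obtain l where "n = D * l" "1 \<le> n" "n \<le> N" by auto
    then show "n \<in> (\<lambda>l. D * l) ` {1..N div D}"
      using D by (auto simp: less_eq_div_iff_mult_less_eq mult.commute intro!: Nat.gr0I)
  qed (use D in \<open>auto simp: less_eq_div_iff_mult_less_eq mult.commute\<close>)
  moreover have "inj_on (\<lambda>l. D * l) {1..N div D}" using D by (auto intro: inj_onI)
  ultimately show ?thesis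
    by (subst sum.inter_filter[symmetric]) (simp_all add: sum.reindex)
qed

lemma sum_kfree:
  assumes k: "k > 0"
  shows "(\<Sum>n=1..N. kfree k n) = (\<Sum>e=1..N. mu e * real (N div e ^ k))"
proof -
  have "(\<Sum>n=1..N. kfree k n) = (\<Sum>n=1..N. \<Sum>e=1..N. if e ^ k dvd n then mu e else 0)"
    by (intro sum.cong refl kfree_conv_mu k) auto
  also have "\<dots> = (\<Sum>e=1..N. \<Sum>n=1..N. if e ^ k dvd n then mu e else 0)"
    by (rule sum.swap)
  also have "\<dots> = (\<Sum>e=1..N. mu e * real (N div e ^ k))"
    by (intro sum.cong refl, subst sum_multiples) auto
  finally show ?thesis .
qed

section \<open>Partial summation with the Moebius function\<close>

lemma sum_inverse_squares_le:
  assumes "Z \<ge> 1" shows "(\<Sum>e=Z+1..D. 1 / (real e)\<^sup>2) \<le> 1 / real Z"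
proof (cases "Z \<le> D")
  case True
  then have "(\<Sum>e=Z+1..D. 1 / (real e)\<^sup>2) \<le> 1 / real Z - 1 / real D"
  proof (induction D rule: dec_induct)
    case (step D)
    have D: "D > 0" using step assms by simp
    have "1 / (real (Suc D))\<^sup>2 \<le> 1 / (real D * real (Suc D))"
      using D by (intro divide_left_mono) (auto simp: power2_eq_square)
    also have "\<dots> = 1 / real D - 1 / real (Suc D)" using D by (simp add: field_simps)
    finally show ?case using step by simp
  qed simp
  also have "\<dots> \<le> 1 / real Z" by simp
  finally show ?thesis .
qed simp

lemma sum_diff_by_parts:
  fixes a :: "nat \<Rightarrow> real"
  assumes "Z \<le> D"
  shows "(\<Sum>e=Z+1..D. (F e - F (e - 1)) * a e) = F D * a (D + 1) - F Z * a (Z + 1) + (\<Sum>e=Z+1..D. F e * (a e - a (e + 1)))"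
  using assms
  by (induction D rule: dec_induct) (auto simp: algebra_simps)

text \<open>Abel summation forth and back: since a decreases, the Mertens function may be replaced
  by its majorant W sqrt e, and summing by parts in reverse leaves the increments sqrt e - sqrt (e -
  1) \<le> 1 / sqrt e. Only monotonicity and 0 \<le> a e \<le> y / e^k are asked of a, so that
  \<open>N div e ^ k\<close> qualifies as well as y / e^k.\<close>

lemma abs_sum_mu_antimono_le:
  fixes a :: "nat \<Rightarrow> real"
  assumes Z: "Z \<ge> 1" and k: "k \<ge> 2" and y: "y \<ge> 0" and W: "W \<ge> 0"
    and dec: "\<And>e. e \<ge> 1 \<Longrightarrow> a (e + 1) \<le> a e" and a: "\<And>e. e \<ge> 1 \<Longrightarrow> 0 \<le> a e \<and> a e \<le> y / real e ^ k"
    and M: "\<And>e. 1 \<le> e \<Longrightarrow> e \<le> D \<Longrightarrow> \<bar>mertens e\<bar> \<le> W * sqrt (real e)"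
  shows "\<bar>\<Sum>e=Z+1..D. mu e * a e\<bar> \<le> 4 * W * y * (real Z + 1) powr (1 / 2 - real k)"
proof (cases "Z \<le> D")
  case True
  define B where "B = y * (real Z + 1) powr (1 / 2 - real k)"
  have B: "B \<ge> 0" using y by (simp add: B_def)
  have "(\<Sum>e=Z+1..D. mu e * a e) = (\<Sum>e=Z+1..D. (mertens e - mertens (e - 1)) * a e)"
  proof (intro sum.cong refl)
    fix e assume "e \<in> {Z+1..D}"
    then obtain i where "e = Suc i" by (cases e) auto
    then show "mu e * a e = (mertens e - mertens (e - 1)) * a e" by (simp add: mertens_def)
  qed
  also have "\<dots> = mertens D * a (D + 1) - mertens Z * a (Z + 1) + (\<Sum>e=Z+1..D. mertens e * (a e - a (e + 1)))"
    by (rule sum_diff_by_parts[OF True])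
  finally have "\<bar>\<Sum>e=Z+1..D. mu e * a e\<bar> \<le> \<bar>mertens D * a (D + 1)\<bar> + \<bar>mertens Z * a (Z + 1)\<bar> +
      \<bar>\<Sum>e=Z+1..D. mertens e * (a e - a (e + 1))\<bar>" by linarith
  also have "\<dots> \<le> W * sqrt (real D) * a (D + 1) + W * sqrt (real Z) * a (Z + 1) +
      (\<Sum>e=Z+1..D. W * sqrt (real e) * (a e - a (e + 1)))"
  proof (intro add_mono order.trans[OF sum_abs] sum_mono)
    show "\<bar>mertens D * a (D + 1)\<bar> \<le> W * sqrt (real D) * a (D + 1)"
      unfolding abs_mult using M[of D] a[of "D + 1"] True Z by (intro mult_mono) auto
    show "\<bar>mertens Z * a (Z + 1)\<bar> \<le> W * sqrt (real Z) * a (Z + 1)"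
      unfolding abs_mult using M[of Z] a[of "Z + 1"] True Z by (intro mult_mono) auto
    show "\<bar>mertens e * (a e - a (e + 1))\<bar> \<le> W * sqrt (real e) * (a e - a (e + 1))" if "e \<in> {Z+1..D}" for e
      unfolding abs_mult using M[of e] dec[of e] that Z by (intro mult_mono) auto
  qed
  \<comment> \<open>Summation by parts in reverse, with sqrt in place of the Mertens function; the
    boundary term at Z now occurs twice.\<close>
  also have "\<dots> = W * (2 * sqrt (real Z) * a (Z + 1) + (\<Sum>e=Z+1..D. (sqrt (real e) - sqrt (real (e - 1))) * a e))"
    unfolding sum_diff_by_parts[OF True, of "\<lambda>e. sqrt (real e)" a]
    by (simp add: algebra_simps sum_distrib_left)
  also have "\<dots> \<le> W * (2 * B + 2 * B)"
  proof (intro mult_left_mono add_mono W)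
    have powr: "sqrt (real e) / real e ^ k = real e powr (1 / 2 - real k)" if "e \<ge> 1" for e
      using that by (simp add: powr_diff powr_realpow powr_half_sqrt)
    have "sqrt (real Z) * a (Z + 1) \<le> sqrt (real (Z + 1)) * (y / real (Z + 1) ^ k)"
      using a[of "Z + 1"] by (intro mult_mono) auto
    also have "\<dots> = y * (sqrt (real (Z + 1)) / real (Z + 1) ^ k)" by simp
    also have "\<dots> = B" by (subst powr) (simp_all add: B_def add.commute)
    finally show "2 * sqrt (real Z) * a (Z + 1) \<le> 2 * B" by simp
    \<comment> \<open>e^(-1/2-k) is split as e^(3/2-k) e^(-2); the first factor is largest at e = Z
      + 1 because k \<ge> 2.\<close>
    have "(\<Sum>e=Z+1..D. (sqrt (real e) - sqrt (real (e - 1))) * a e) \<le>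
        (\<Sum>e=Z+1..D. y * (real Z + 1) powr (3 / 2 - real k) * (1 / (real e)\<^sup>2))"
    proof (intro sum_mono)
      fix e assume e: "e \<in> {Z+1..D}"
      then have e1: "e \<ge> 1" by simp
      have "sqrt (real e) - sqrt (real (e - 1)) \<le> 1 / sqrt (real e)"
      proof -
        have "sqrt (real e) * sqrt (real (e - 1)) \<ge> sqrt (real (e - 1)) * sqrt (real (e - 1))"
          by (intro mult_right_mono real_sqrt_le_mono) auto
        then have "sqrt (real e) * (sqrt (real e) - sqrt (real (e - 1))) \<le> 1"
          using e1 by (simp add: right_diff_distrib of_nat_diff)
        then show ?thesis using e1 by (simp add: field_simps)
      qed
      then have "(sqrt (real e) - sqrt (real (e - 1))) * a e \<le> 1 / sqrt (real e) * (y / real e ^ k)"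
        using a[OF e1] by (intro mult_mono) auto
      also have "\<dots> = y * real e powr (3 / 2 - real k) * (1 / (real e)\<^sup>2)"
      proof -
        have "1 / sqrt (real e) * (1 / real e ^ k) = real e powr (- (1 / 2) - real k)"
        proof -
          have "real e powr (- (1 / 2)) = 1 / sqrt (real e)"
            using powr_minus[of "real e" "1 / 2"] by (simp add: powr_half_sqrt inverse_eq_divide)
          moreover have "real e powr real k = real e ^ k" using e1 by (intro powr_realpow) simp
          ultimately show ?thesis using powr_diff[of "real e" "- (1 / 2)" "real k"] by simp
        qed
        also have "\<dots> = real e powr (3 / 2 - real k) * real e powr (- 2)"
          by (simp flip: powr_add)
        also have "real e powr (- 2) = 1 / (real e)\<^sup>2"
          using e1 by (simp add: powr_minus powr_numeral field_simps)
        finally have eq: "1 / sqrt (real e) * (1 / real e ^ k) = real e powr (3 / 2 - real k) * (1 / (real e)\<^sup>2)" .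
        have "1 / sqrt (real e) * (y / real e ^ k) = y * (1 / sqrt (real e) * (1 / real e ^ k))" by simp
        then show ?thesis by (simp only: eq mult.assoc)
      qed
      also have "\<dots> \<le> y * (real Z + 1) powr (3 / 2 - real k) * (1 / (real e)\<^sup>2)"
        using e y k by (intro mult_right_mono mult_left_mono powr_mono2') auto
      finally show "(sqrt (real e) - sqrt (real (e - 1))) * a e \<le> y * (real Z + 1) powr (3 / 2 - real k) * (1 / (real e)\<^sup>2)" .
    qed
    also have "\<dots> = y * (real Z + 1) powr (3 / 2 - real k) * (\<Sum>e=Z+1..D. 1 / (real e)\<^sup>2)"
      by (simp add: sum_distrib_left)
    also have "\<dots> \<le> y * (real Z + 1) powr (3 / 2 - real k) * (2 / (real Z + 1))"
    proof (intro mult_left_mono)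
      have "1 / real Z \<le> 2 / (real Z + 1)" using Z by (simp add: field_simps)
      then show "(\<Sum>e=Z+1..D. 1 / (real e)\<^sup>2) \<le> 2 / (real Z + 1)"
        using sum_inverse_squares_le[OF Z, of D] by linarith
    qed (use y in auto)
    also have "\<dots> = 2 * B"
    proof -
      have "(real Z + 1) powr (3 / 2 - real k) = (real Z + 1) powr (1 / 2 - real k) * (real Z + 1) powr 1"
        unfolding powr_add[symmetric] by simp
      then show ?thesis using Z by (simp add: B_def)
    qed
    finally show "(\<Sum>e=Z+1..D. (sqrt (real e) - sqrt (real (e - 1))) * a e) \<le> 2 * B" .
  qed
  finally show ?thesis by (simp add: B_def)
qed (use y W in simp)

text \<open>For k \<ge> 2 this is 1 / zeta(k) as a real number, so that the counting estimates stay
  over the reals.\<close>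

definition mu_sum :: "nat \<Rightarrow> real" where
  "mu_sum k = (\<Sum>\<^sub>\<infinity>n\<in>{0<..}. mu n / real n ^ k)"

text \<open>Comparison with 1 / n^2 makes both the bound 2 and the truncation error 1/N independent
  of k.\<close>

lemma mu_sum_props:
  assumes "k \<ge> 2"
  shows "\<bar>mu_sum k\<bar> \<le> 2"
    and "1 / zeta (of_nat k) = of_real (mu_sum k)"
    and "N \<ge> 1 \<Longrightarrow> \<bar>mu_sum k - (\<Sum>n=1..N. mu n / real n ^ k)\<bar> \<le> 1 / real N"
proof -
  define f where "f = (\<lambda>n. mu n / real n ^ k)"
  have k1: "Re (of_nat k :: complex) > 1" using assms by simp
  have eq: "complex_of_real (f n) = of_real (mu n) * of_nat n powr (- of_nat k)" if "n > 0" for n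
    using that by (simp add: f_def powr_minus powr_nat' divide_inverse)
  have sm: "(\<lambda>n. norm (f n)) summable_on {0<..}"
    using mu_has_sum(3)[OF k1]
    by (rule summable_on_cong[THEN iffD1, rotated]) (simp only: greaterThan_iff eq[symmetric] norm_of_real real_norm_def)
  have hs: "(f has_sum infsum f {0<..}) {0<..}" by (rule has_sum_infsum[OF abs_summable_summable[OF sm]])
  then have "((\<lambda>n. complex_of_real (f n)) has_sum of_real (infsum f {0<..})) {0<..}"
    by (rule has_sum_of_real)
  then have "((\<lambda>n. of_real (mu n) * of_nat n powr (- of_nat k)) has_sum complex_of_real (infsum f {0<..})) {0<..}"
    by (rule has_sum_cong[THEN iffD1, rotated]) (simp add: eq)
  with mu_has_sum(1)[OF k1] have "1 / zeta (of_nat k) = of_real (infsum f {0<..})"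
    by (rule has_sum_unique)
  then show "1 / zeta (of_nat k) = of_real (mu_sum k)"
    by (simp only: f_def mu_sum_def)
  have lim: "(\<lambda>M. \<Sum>n=1..M. f n) \<longlonglongrightarrow> infsum f {0<..}"
    by (rule has_sum_pos_imp_LIMSEQ[OF hs])
  have fle: "\<bar>f n\<bar> \<le> 1 / (real n)\<^sup>2" if "n \<ge> 1" for n
  proof -
    have "\<bar>f n\<bar> = \<bar>mu n\<bar> / real n ^ k" by (simp add: f_def)
    also have "\<dots> \<le> 1 / (real n)\<^sup>2"
      using that assms abs_mu_le[of n] by (intro frac_le power_increasing) auto
    finally show ?thesis .
  qed
  have tail: "\<bar>infsum f {0<..} - (\<Sum>n=1..N. f n)\<bar> \<le> 1 / real N" if N: "N \<ge> 1" for N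
  proof (rule LIMSEQ_le_const2)
    show "(\<lambda>M. \<bar>(\<Sum>n=1..M. f n) - (\<Sum>n=1..N. f n)\<bar>) \<longlonglongrightarrow> \<bar>infsum f {0<..} - (\<Sum>n=1..N. f n)\<bar>"
      by (intro tendsto_intros lim)
    show "\<exists>L. \<forall>M\<ge>L. \<bar>(\<Sum>n=1..M. f n) - (\<Sum>n=1..N. f n)\<bar> \<le> 1 / real N"
    proof (intro exI[of _ N] allI impI)
      fix M assume M: "N \<le> M"
      have "{1..M} = {1..N} \<union> {N+1..M}" using M by auto
      then have "(\<Sum>n=1..M. f n) = (\<Sum>n=1..N. f n) + (\<Sum>n=N+1..M. f n)"
        by (simp only:) (rule sum.union_disjoint, auto)
      then have "\<bar>(\<Sum>n=1..M. f n) - (\<Sum>n=1..N. f n)\<bar> = \<bar>\<Sum>n=N+1..M. f n\<bar>" by simp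
      also have "\<dots> \<le> (\<Sum>n=N+1..M. 1 / (real n)\<^sup>2)"
        by (intro order.trans[OF sum_abs] sum_mono fle) auto
      also have "\<dots> \<le> 1 / real N" by (rule sum_inverse_squares_le[OF N])
      finally show "\<bar>(\<Sum>n=1..M. f n) - (\<Sum>n=1..N. f n)\<bar> \<le> 1 / real N" .
    qed
  qed
  then show "\<bar>mu_sum k - (\<Sum>n=1..N. mu n / real n ^ k)\<bar> \<le> 1 / real N" if "N \<ge> 1"
    using that by (simp add: f_def mu_sum_def)
  have "\<bar>infsum f {0<..}\<bar> \<le> 2" using tail[of 1] fle[of 1] by simp
  then show "\<bar>mu_sum k\<bar> \<le> 2" by (simp only: f_def mu_sum_def)
qed

text \<open>For e \<le> Z the floor in \<open>N div e ^ k\<close> is dropped at a cost of at most 1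
  per term; for e > Z the sums with and without the floor are each small by cancellation in
  \<open>mu\<close>. The costs Z and y Z^(1/2-k) balance when Z^(k+1/2) = y, that is Z =
  y^\<theta>.\<close>

lemma sum_kfree_bound:
  fixes y :: real and k :: nat
  defines "\<kappa> \<equiv> mu_sum k" and "\<theta> \<equiv> 2 / (2 * real k + 1)"
  assumes k: "k \<ge> 2" and y: "y \<ge> 1" and W: "W \<ge> 1"
    and M: "\<And>e. 1 \<le> e \<Longrightarrow> real e \<le> y \<Longrightarrow> \<bar>mertens e\<bar> \<le> W * sqrt (real e)"
  shows "\<bar>(\<Sum>n=1..nat \<lfloor>y\<rfloor>. kfree k n) - y * \<kappa>\<bar> \<le> 11 * W * y powr \<theta>"
proof -
  define N where "N = nat \<lfloor>y\<rfloor>"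
  define Z where "Z = nat \<lfloor>y powr \<theta>\<rfloor>"
  have \<theta>: "0 < \<theta>" "\<theta> < 1" "\<theta> * (real k + 1 / 2) = 1" using k by (auto simp: \<theta>_def field_simps)
  have N: "real N \<le> y" "y < real N + 1" "N \<ge> 1" using y by (auto simp: N_def) linarith+
  have yth: "1 \<le> y powr \<theta>" "y powr \<theta> \<le> y"
    using y \<theta> powr_mono[of \<theta> 1 y] by (auto simp: ge_one_powr_ge_zero)
  have Z: "real Z \<le> y powr \<theta>" "y powr \<theta> < real Z + 1" "Z \<ge> 1" using yth by (auto simp: Z_def) linarith+
  have ZN: "Z \<le> N" unfolding Z_def N_def using yth by (intro nat_mono floor_mono)
  define a where "a = (\<lambda>e. real (N div e ^ k))"
  define b where "b = (\<lambda>e. y / real e ^ k)"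
  have a_le_b: "a e \<le> b e" and b_le_a: "b e \<le> a e + 1" if "e \<ge> 1" for e
  proof -
    have pos: "real e ^ k > 0" using that by simp
    have "real (N div e ^ k) \<le> real N / real (e ^ k)" by (rule of_nat_div_le_of_nat) 
    also have "\<dots> \<le> b e" unfolding b_def using N by (simp add: divide_right_mono)
    finally show "a e \<le> b e" by (simp add: a_def)
    have "N < (N div e ^ k + 1) * e ^ k" using that dividend_less_div_times[of "e ^ k" N] by simp
    then have "N + 1 \<le> (N div e ^ k + 1) * e ^ k" by simp
    then have "real (N + 1) \<le> real ((N div e ^ k + 1) * e ^ k)" by (simp only: of_nat_le_iff)
    moreover have "real ((N div e ^ k + 1) * e ^ k) = (a e + 1) * real e ^ k"
      by (simp add: a_def algebra_simps)
    ultimately have "y \<le> (a e + 1) * real e ^ k" using N by linarith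
    then show "b e \<le> a e + 1" using pos by (simp add: b_def field_simps)
  qed
  have split: "(\<Sum>e=1..N. mu e * h e) = (\<Sum>e=1..Z. mu e * h e) + (\<Sum>e=Z+1..N. mu e * h e)" for h
  proof -
    have "{1..N} = {1..Z} \<union> {Z+1..N}" using ZN by auto
    then show ?thesis by (simp only:) (rule sum.union_disjoint, auto)
  qed
  have MN: "\<bar>mertens e\<bar> \<le> W * sqrt (real e)" if "1 \<le> e" "e \<le> N" for e
    using that N by (intro M) auto
  have powb: "y * (real Z + 1) powr (1 / 2 - real k) \<le> y powr \<theta>"
  proof -
    have "(real Z + 1) powr (1 / 2 - real k) \<le> (y powr \<theta>) powr (1 / 2 - real k)"
      using Z yth k by (intro powr_mono2') auto
    then have "y * (real Z + 1) powr (1 / 2 - real k) \<le> y powr 1 * y powr (\<theta> * (1 / 2 - real k))"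
      using y by (simp add: powr_powr)
    also have "\<dots> = y powr (1 + \<theta> * (1 / 2 - real k))" by (simp add: powr_add)
    also have "1 + \<theta> * (1 / 2 - real k) = \<theta>" using \<theta>(3) by (simp add: algebra_simps)
    finally show ?thesis .
  qed
  have tailbd: "\<bar>\<Sum>e=Z+1..N. mu e * h e\<bar> \<le> 4 * W * y powr \<theta>"
    if "\<And>e. e \<ge> 1 \<Longrightarrow> h (e + 1) \<le> h e" "\<And>e. e \<ge> 1 \<Longrightarrow> 0 \<le> h e \<and> h e \<le> y / real e ^ k" for h
  proof -
    have "\<bar>\<Sum>e=Z+1..N. mu e * h e\<bar> \<le> 4 * W * y * (real Z + 1) powr (1 / 2 - real k)"
      using that y W by (intro abs_sum_mu_antimono_le[OF Z(3) k _ _ _ _ MN]) auto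
    also have "\<dots> = 4 * W * (y * (real Z + 1) powr (1 / 2 - real k))" by simp
    also have "\<dots> \<le> 4 * W * y powr \<theta>" using W by (intro mult_left_mono powb) auto
    finally show ?thesis .
  qed
  have pw: "e ^ k \<le> (e + 1) ^ k" for e :: nat by (intro power_mono) auto
  have ta: "\<bar>\<Sum>e=Z+1..N. mu e * a e\<bar> \<le> 4 * W * y powr \<theta>"
  proof (rule tailbd)
    fix e :: nat assume "e \<ge> 1"
    then show "a (e + 1) \<le> a e" using pw[of e] by (simp add: a_def div_le_mono2)
    show "0 \<le> a e \<and> a e \<le> y / real e ^ k" using a_le_b[OF \<open>e \<ge> 1\<close>] by (simp add: a_def b_def)
  qed
  have tb: "\<bar>\<Sum>e=Z+1..N. mu e * b e\<bar> \<le> 4 * W * y powr \<theta>"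
  proof (rule tailbd)
    fix e :: nat assume "e \<ge> 1"
    then show "b (e + 1) \<le> b e"
      unfolding b_def using y by (intro divide_left_mono power_mono) auto
    show "0 \<le> b e \<and> b e \<le> y / real e ^ k" using y by (simp add: b_def)
  qed
  have t1: "\<bar>\<Sum>e=1..Z. mu e * (a e - b e)\<bar> \<le> real Z"
  proof -
    have "\<bar>\<Sum>e=1..Z. mu e * (a e - b e)\<bar> \<le> (\<Sum>e=1..Z. 1 * 1)"
    proof (intro order.trans[OF sum_abs] sum_mono)
      fix e assume "e \<in> {1..Z}"
      then have "\<bar>a e - b e\<bar> \<le> 1" using a_le_b[of e] b_le_a[of e] by simp
      then show "\<bar>mu e * (a e - b e)\<bar> \<le> 1 * 1" unfolding abs_mult by (intro mult_mono abs_mu_le) auto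
    qed
    then show ?thesis by simp
  qed
  \<comment> \<open>Completing the series beyond N costs y / N, which is at most 2 because y < N +
    1.\<close>
  have t2: "\<bar>y * \<kappa> - (\<Sum>e=1..N. mu e * b e)\<bar> \<le> 2"
  proof -
    have "(\<Sum>e=1..N. mu e * b e) = y * (\<Sum>e=1..N. mu e / real e ^ k)"
      unfolding b_def sum_distrib_left by (intro sum.cong) auto
    then have "\<bar>y * \<kappa> - (\<Sum>e=1..N. mu e * b e)\<bar> = y * \<bar>\<kappa> - (\<Sum>e=1..N. mu e / real e ^ k)\<bar>"
      using y by (simp add: abs_mult flip: right_diff_distrib)
    also have "\<dots> \<le> y * (1 / real N)"
      unfolding \<kappa>_def using y N by (intro mult_left_mono mu_sum_props(3)[OF k]) auto
    also have "\<dots> \<le> 2" using N by (simp add: field_simps)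
    finally show ?thesis .
  qed
  have "(\<Sum>n=1..N. kfree k n) = (\<Sum>e=1..N. mu e * a e)"
    unfolding a_def using k by (intro sum_kfree) simp
  moreover have "(\<Sum>e=1..Z. mu e * (a e - b e)) = (\<Sum>e=1..Z. mu e * a e) - (\<Sum>e=1..Z. mu e * b e)"
    by (simp add: right_diff_distrib sum_subtractf)
  ultimately have "\<bar>(\<Sum>n=1..N. kfree k n) - y * \<kappa>\<bar> \<le> real Z + 4 * W * y powr \<theta> + 4 * W * y powr \<theta> + 2"
    using split[of a] split[of b] ta tb t1 t2 by linarith
  \<comment> \<open>11 = 1 + 4 + 4 + 2: from Z, from the two tails, and from completing the
    series.\<close>
  also have "\<dots> \<le> 11 * (W * y powr \<theta>)"
  proof -
    have "1 * y powr \<theta> \<le> W * y powr \<theta>" using W by (intro mult_right_mono) auto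
    then show ?thesis using Z(1) yth(1) by linarith
  qed
  finally show ?thesis by (simp add: N_def)
qed

section \<open>Exponents restricted modulo m\<close>

text \<open>The disjunct j = 0 stands for primes not dividing n, on which no condition is imposed;
  positive multiples of m are excluded.\<close>

definition qloc :: "nat \<Rightarrow> nat \<Rightarrow> nat \<Rightarrow> real" where
  "qloc k m j = (if j = 0 \<or> j mod m \<in> {1..k - 1} then 1 else 0)"

lemma qstar_eq_mfun:
  assumes "n > 0"
  shows "qstar k m n = mfun (qloc k m) n"
proof (cases "n \<in> Qstar k m")
  case True
  then have "qloc k m (multiplicity p n) = 1" if "p \<in> prime_factors n" for p
    using that by (auto simp: Qstar_def qloc_def in_prime_factors_iff)
  then show ?thesis using True by (simp add: qstar_def mfun_def)
next
  case False
  then obtain p where p: "prime p" "p dvd n" "multiplicity p n mod m \<notin> {1..k - 1}"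
    using assms by (auto simp: Qstar_def)
  then have pf: "p \<in> prime_factors n" using assms by (simp add: in_prime_factors_iff)
  then have "multiplicity p n \<noteq> 0" by (simp add: prime_factors_multiplicity)
  then have "qloc k m (multiplicity p n) = 0" using p by (auto simp: qloc_def)
  then show ?thesis using False pf by (auto simp: qstar_def mfun_def prod_zero_iff)
qed

text \<open>Coefficients of the power series \<open>(\<Sum>j. qloc k m j u^j) (1 - u) / (1 - u^k)\<close>, the local
  factor left over when the \<open>k\<close>-free numbers are split off.\<close>

fun gam :: "nat \<Rightarrow> nat \<Rightarrow> nat \<Rightarrow> real" where
  "gam k m j = qloc k m j - (if j \<ge> 1 then qloc k m (j - 1) else 0) + (if 1 \<le> k \<and> k \<le> j then gam k m (j - k) else 0)"

declare gam.simps [simp del]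

lemma gam_0: "k \<ge> 1 \<Longrightarrow> gam k m 0 = 1"
  by (subst gam.simps) (simp add: qloc_def)

text \<open>Each step of the recurrence lowers j by k and adds a difference of two values in {0, 1}.
  Linear growth suffices for convergence in the whole open unit disc.\<close>

lemma abs_gam_le: "\<bar>gam k m j\<bar> \<le> real j + 1"
proof (induction j rule: less_induct)
  case (less j)
  have q: "\<bar>qloc k m j - (if j \<ge> 1 then qloc k m (j - 1) else 0)\<bar> \<le> 1" by (auto simp: qloc_def)
  show ?case
  proof (cases "1 \<le> k \<and> k \<le> j")
    case True
    then have "\<bar>gam k m (j - k)\<bar> \<le> real (j - k) + 1" by (intro less) auto
    also have "\<dots> \<le> real j" using True by (simp add: of_nat_diff)
    finally have "\<bar>gam k m (j - k)\<bar> \<le> real j" .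
    moreover have "gam k m j = qloc k m j - (if j \<ge> 1 then qloc k m (j - 1) else 0) + gam k m (j - k)"
      using True by (subst gam.simps) (simp only: if_True simp_thms)
    ultimately show ?thesis using q by linarith
  qed (use q in \<open>subst gam.simps, auto\<close>)
qed

text \<open>Up to degree m the values of \<open>qloc\<close> are the coefficients of 1 + u + ... +
  u^(k-1), since j = m has the excluded residue 0. Hence the quotient is 1 + O(u^(m+1)), the source
  of the abscissa 1/(m+1) for g.\<close>

lemma gam_eq_0:
  assumes "2 \<le> k" "k < m" "1 \<le> j" "j \<le> m"
  shows "gam k m j = 0"
  using assms(3,4)
proof (induction j rule: less_induct)
  case (less j)
  have q: "qloc k m i = (if i < k then 1 else 0)" if "i \<le> m" for i
    using that assms by (cases "i = m") (auto simp: qloc_def)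
  have e: "qloc k m j = (if j < k then 1 else 0)" "qloc k m (j - 1) = (if j - 1 < k then 1 else 0)"
    using less.prems by (intro q; simp)+
  consider "j < k" | "j = k" | "k < j" by linarith
  then show ?case
  proof cases
    case 3
    then have "gam k m (j - k) = 0" using less.prems assms by (intro less.IH) auto
    then show ?thesis using 3 less.prems assms by (subst gam.simps) (simp only: e, auto)
  next
    case 2
    then show ?thesis using less.prems assms e gam_0[of k m] by (subst gam.simps) auto
  next
    case 1
    then show ?thesis using less.prems assms e by (subst gam.simps) auto
  qed
qed

text \<open>Multiplying back by (1 - u^k) / (1 - u) = 1 + ... + u^(k-1) means summing over a window
  of length k. Moving the window by one gains \<open>gam k m (Suc j)\<close> and loses
  \<open>gam k m (Suc j - k)\<close>, and by the recurrence the net change is that of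
  \<open>qloc\<close>.\<close>

lemma sum_gam_window:
  assumes "k \<ge> 1"
  shows "(\<Sum>i\<le>j. (if i < k then 1 else 0) * gam k m (j - i)) = qloc k m j"
proof -
  have rev: "(\<Sum>i\<le>j. (if i < k then 1 else 0) * gam k m (j - i)) = (\<Sum>i\<le>j. (if j - i < k then 1 else 0) * gam k m i)" for j
    by (rule sum.reindex_bij_witness[of _ "\<lambda>i. j - i" "\<lambda>i. j - i"]) auto
  have "(\<Sum>i\<le>j. (if j - i < k then 1 else 0) * gam k m i) = qloc k m j"
  proof (induction j)
    case 0
    then show ?case using assms by (simp add: gam_0 qloc_def)
  next
    case (Suc j)
    have "(\<Sum>i\<le>Suc j. (if Suc j - i < k then 1 else 0) * gam k m i) =
        gam k m (Suc j) + (\<Sum>i\<le>j. (if Suc j - i < k then 1 else 0) * gam k m i)"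
      using assms by simp
    also have "(\<Sum>i\<le>j. (if Suc j - i < k then 1 else 0) * gam k m i) =
        (\<Sum>i\<le>j. (if j - i < k then 1 else 0) * gam k m i - (if i = Suc j - k \<and> k \<le> Suc j then gam k m i else 0))"
      using assms by (intro sum.cong) auto
    also have "\<dots> = qloc k m j - (if k \<le> Suc j then gam k m (Suc j - k) else 0)"
      unfolding sum_subtractf Suc.IH using assms by (auto simp: if_distrib sum.delta' cong: if_cong)
    finally show ?case using assms by (subst (asm) (1) gam.simps) auto
  qed
  then show ?thesis using rev[of j] by simp
qed

definition gfun :: "nat \<Rightarrow> nat \<Rightarrow> nat \<Rightarrow> real" where
  "gfun k m = mfun (gam k m)"

lemma mult_fn_gfun: "k \<ge> 1 \<Longrightarrow> mult_fn (gfun k m)"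
  and gfun_prime_power: "k \<ge> 1 \<Longrightarrow> prime p \<Longrightarrow> gfun k m (p ^ j) = gam k m j"
  unfolding gfun_def by (rule mult_fn_mfun mfun_prime_power; simp add: gam_0)+

lemma qstar_conv:
  assumes k: "k \<ge> 1" and n: "n > 0"
  shows "qstar k m n = (\<Sum>d | d dvd n. gfun k m d * kfree k (n div d))"
proof -
  have q0: "qloc k m 0 = 1" by (simp add: qloc_def)
  have kf: "mult_fn (kfree k)" using k by (intro mult_fn_kfree) simp
  have "mfun (qloc k m) n = dconv (gfun k m) (kfree k) n"
  proof (rule mult_fn_cong[OF mult_fn_mfun[where c = "qloc k m", OF q0] mult_fn_dconv[OF mult_fn_gfun[OF k] kf] _ n])
    fix p j :: nat assume p: "prime p"
    have "dconv (gfun k m) (kfree k) (p ^ j) = (\<Sum>i\<le>j. gam k m i * (if j - i < k then 1 else 0))"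
      using k by (simp add: dconv_prime_power[OF mult_fn_gfun[OF k] kf p] gfun_prime_power[OF k p] kfree_prime_power p)
    also have "\<dots> = (\<Sum>i\<le>j. (if i < k then 1 else 0) * gam k m (j - i))"
      by (rule sum.reindex_bij_witness[of _ "\<lambda>i. j - i" "\<lambda>i. j - i"]) auto
    finally show "mfun (qloc k m) (p ^ j) = dconv (gfun k m) (kfree k) (p ^ j)"
      using k by (simp only: sum_gam_window mfun_prime_power[where c = "qloc k m", OF q0 p])
  qed
  then show ?thesis by (simp add: qstar_eq_mfun[OF n] dconv_def)
qed

lemma sum_dconv:
  fixes f g :: "nat \<Rightarrow> real"
  shows "(\<Sum>n=1..N. \<Sum>d | d dvd n. f d * g (n div d)) = (\<Sum>d=1..N. f d * (\<Sum>l=1..N div d. g l))"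
proof -
  have "(\<Sum>d | d dvd n. f d * g (n div d)) = (\<Sum>d=1..N. if d dvd n then f d * g (n div d) else 0)"
    if n: "n \<in> {1..N}" for n
  proof -
    have "d \<in> {1..N}" if "d dvd n" for d
      using that n dvd_imp_le[of d n] dvd_pos_nat[of n d] by auto
    then have "{d. d dvd n} = {d \<in> {1..N}. d dvd n}" by blast
    then show ?thesis by (simp only: sum.inter_filter[OF finite_atLeastAtMost])
  qed
  then have "(\<Sum>n=1..N. \<Sum>d | d dvd n. f d * g (n div d)) =
      (\<Sum>n=1..N. \<Sum>d=1..N. if d dvd n then f d * g (n div d) else 0)"
    by (rule sum.cong[OF refl])
  also have "\<dots> = (\<Sum>d=1..N. \<Sum>n=1..N. if d dvd n then f d * g (n div d) else 0)"
    by (rule sum.swap)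
  also have "\<dots> = (\<Sum>d=1..N. f d * (\<Sum>l=1..N div d. g l))"
    by (intro sum.cong refl, subst sum_multiples) (auto simp: sum_distrib_left)
  finally show ?thesis .
qed

section \<open>The local power series and the constant of the main term\<close>

text \<open>Two shift relations determine the series G of \<open>gam\<close> and C of
  \<open>qloc\<close>: the recurrence gives G (1 - u^k) = C (1 - u), and the periodicity of the
  exponent condition evaluates C (1 - u^m).\<close>

lemma gam_sums:
  assumes u: "0 < u" "u < 1" and k: "2 \<le> k" "k < m"
  shows "summable (\<lambda>j. \<bar>gam k m j\<bar> * u ^ j)"
    and "(\<lambda>j. gam k m j * u ^ j) sums ((1 - u ^ m * (1 - u) / (1 - u ^ k)) / (1 - u ^ m))"
proof -
  have base: "summable (\<lambda>j. (real j + 1) * u ^ j)"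
    using geometric_deriv_sums[of u] u by (simp add: sums_iff add.commute)
  show sg: "summable (\<lambda>j. \<bar>gam k m j\<bar> * u ^ j)"
  proof (rule summable_comparison_test'[OF base])
    show "norm (\<bar>gam k m j\<bar> * u ^ j) \<le> (real j + 1) * u ^ j" for j
      using mult_right_mono[OF abs_gam_le[of k m j], of "u ^ j"] u by (simp add: abs_mult)
  qed
  have "summable (\<lambda>j. \<bar>qloc k m j\<bar> * u ^ j)"
  proof (rule summable_comparison_test'[OF base])
    have "\<bar>qloc k m j\<bar> \<le> real j + 1" for j by (simp add: qloc_def)
    then show "norm (\<bar>qloc k m j\<bar> * u ^ j) \<le> (real j + 1) * u ^ j" for j
      using mult_right_mono[of "\<bar>qloc k m j\<bar>" "real j + 1" "u ^ j"] u by (simp add: abs_mult)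
  qed
  then have sq: "summable (\<lambda>j. qloc k m j * u ^ j)"
    by (rule summable_rabs_cancel[OF summable_cong[THEN iffD1, rotated]]) (use u in \<open>simp add: abs_mult\<close>)
  have sgam: "summable (\<lambda>j. gam k m j * u ^ j)"
    using sg by (rule summable_rabs_cancel[OF summable_cong[THEN iffD1, rotated]]) (use u in \<open>simp add: abs_mult\<close>)
  have shift: "(\<lambda>j. (if d \<le> j then a (j - d) else 0) * u ^ j) sums (u ^ d * A)"
    if "(\<lambda>j. a j * u ^ j) sums A" for a :: "nat \<Rightarrow> real" and d A
  proof -
    have "(\<lambda>j. u ^ d * (a j * u ^ j)) sums (u ^ d * A)" by (rule sums_mult[OF that])
    then have "(\<lambda>j. (if d \<le> j + d then a (j + d - d) else 0) * u ^ (j + d)) sums (u ^ d * A)"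
      by (simp add: power_add mult_ac)
    then show ?thesis
      by (subst (asm) sums_iff_shift) simp
  qed
  define C where "C = (\<Sum>j. qloc k m j * u ^ j)"
  define G where "G = (\<Sum>j. gam k m j * u ^ j)"
  have C: "(\<lambda>j. qloc k m j * u ^ j) sums C" and G: "(\<lambda>j. gam k m j * u ^ j) sums G"
    unfolding C_def G_def by (intro summable_sums sq sgam)+
  have um: "1 - u ^ m > 0" "1 - u ^ k > 0" using u k by (auto intro: power_less_one_iff[THEN iffD2])
  have "gam k m j * u ^ j - (if k \<le> j then gam k m (j - k) else 0) * u ^ j =
      qloc k m j * u ^ j - (if 1 \<le> j then qloc k m (j - 1) else 0) * u ^ j" for j
    using k by (subst gam.simps) (simp add: algebra_simps)
  moreover have "(\<lambda>j. gam k m j * u ^ j - (if k \<le> j then gam k m (j - k) else 0) * u ^ j) sums (G - u ^ k * G)"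
    by (intro sums_diff G shift)
  ultimately have "(\<lambda>j. qloc k m j * u ^ j - (if 1 \<le> j then qloc k m (j - 1) else 0) * u ^ j) sums (G - u ^ k * G)"
    by (simp only:)
  moreover have "(\<lambda>j. qloc k m j * u ^ j - (if 1 \<le> j then qloc k m (j - 1) else 0) * u ^ j) sums (C - u ^ 1 * C)"
    by (intro sums_diff C shift)
  ultimately have "G - u ^ k * G = C - u ^ 1 * C" by (rule sums_unique2)
  then have GC: "G * (1 - u ^ k) = C * (1 - u)" by (simp add: algebra_simps)
  \<comment> \<open>\<open>qloc\<close> is periodic modulo m except that it is 1 at index 0 and 0 at
    index m; this defect is the isolated term -u^m.\<close>
  have "qloc k m j * u ^ j - (if m \<le> j then qloc k m (j - m) else 0) * u ^ j =
      (if j \<in> {..<k} then u ^ j else 0) - (if j \<in> {m} then u ^ j else 0)" for j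
    using k by (cases "m \<le> j"; cases "j = m") (auto simp: qloc_def le_mod_geq)
  moreover have "(\<lambda>j. qloc k m j * u ^ j - (if m \<le> j then qloc k m (j - m) else 0) * u ^ j) sums (C - u ^ m * C)"
    by (intro sums_diff C shift)
  ultimately have "(\<lambda>j. (if j \<in> {..<k} then u ^ j else 0) - (if j \<in> {m} then u ^ j else 0)) sums (C - u ^ m * C)"
    by (simp only:)
  moreover have "(\<lambda>j. (if j \<in> {..<k} then u ^ j else 0) - (if j \<in> {m} then u ^ j else 0)) sums
      ((\<Sum>j<k. u ^ j) - (\<Sum>j\<in>{m}. u ^ j))"
    by (intro sums_diff sums_If_finite_set) auto
  ultimately have "C - u ^ m * C = (\<Sum>j<k. u ^ j) - (\<Sum>j\<in>{m}. u ^ j)" by (rule sums_unique2)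
  then have "C * (1 - u ^ m) = (1 - u ^ k) / (1 - u) - u ^ m"
    using u by (simp add: sum_gp_strict algebra_simps)
  then have Ceq: "C = ((1 - u ^ k) / (1 - u) - u ^ m) / (1 - u ^ m)" using um by (simp add: eq_divide_eq)
  have alg: "(P / v - w) / Q * v / P = (1 - w * v / P) / Q" if "P > 0" "Q > 0" "v > 0" for P Q v w :: real
    using that by (simp add: field_simps)
  have "G = C * (1 - u) / (1 - u ^ k)" using GC um by (simp add: eq_divide_eq)
  also have "\<dots> = (1 - u ^ m * (1 - u) / (1 - u ^ k)) / (1 - u ^ m)"
    unfolding Ceq using um u by (intro alg) auto
  finally show "(\<lambda>j. gam k m j * u ^ j) sums ((1 - u ^ m * (1 - u) / (1 - u ^ k)) / (1 - u ^ m))"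
    using G by simp
qed

text \<open>The coefficients 1 to m vanish and the others are at most j + 1, so r^(m+1) can be taken
  out. The constant is formed with a fixed r0 < 1, later the value at p = 2, to be the same for all
  primes.\<close>

lemma gam_local_bound:
  assumes r: "0 < r" "r \<le> r0" "r0 < 1" and k: "2 \<le> k" "k < m"
  shows "(\<Sum>j. \<bar>gam k m j\<bar> * r ^ j) \<le> 1 + (real m + 2) / (1 - r0)\<^sup>2 * r ^ (m + 1)"
proof -
  have r1: "r < 1" using r by simp
  have sg: "summable (\<lambda>j. \<bar>gam k m j\<bar> * r ^ j)" by (rule gam_sums[OF r(1) r1 k])
  have gs: "(\<lambda>j. real (Suc j) * r0 ^ j) sums (1 / (1 - r0)\<^sup>2)"
    using geometric_deriv_sums[of r0] r by simp
  have le: "\<bar>gam k m (j + (m + 1))\<bar> * r ^ (j + (m + 1)) \<le> (real m + 2) * r ^ (m + 1) * (real (Suc j) * r0 ^ j)" for j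
  proof -
    have "\<bar>gam k m (j + (m + 1))\<bar> \<le> real (j + (m + 1)) + 1" by (rule abs_gam_le)
    also have "\<dots> \<le> (real m + 2) * real (Suc j)" by (simp add: algebra_simps)
    finally have "\<bar>gam k m (j + (m + 1))\<bar> * r ^ (j + (m + 1)) \<le> (real m + 2) * real (Suc j) * r ^ (j + (m + 1))"
      using r by (intro mult_right_mono) auto
    also have "\<dots> = (real m + 2) * r ^ (m + 1) * (real (Suc j) * r ^ j)" by (simp add: power_add mult_ac)
    also have "\<dots> \<le> (real m + 2) * r ^ (m + 1) * (real (Suc j) * r0 ^ j)"
      using r by (intro mult_left_mono power_mono) auto
    finally show ?thesis .
  qed
  have "(\<Sum>j. \<bar>gam k m j\<bar> * r ^ j) = (\<Sum>j. \<bar>gam k m (j + (m + 1))\<bar> * r ^ (j + (m + 1))) + (\<Sum>j<m+1. \<bar>gam k m j\<bar> * r ^ j)"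
    by (rule suminf_split_initial_segment[OF sg])
  also have "(\<Sum>j<m+1. \<bar>gam k m j\<bar> * r ^ j) = (\<Sum>j\<in>{0}. \<bar>gam k m j\<bar> * r ^ j)"
    using gam_eq_0[OF k] by (intro sum.mono_neutral_right) auto
  also have "\<dots> = 1" using k by (simp add: gam_0)
  also have "(\<Sum>j. \<bar>gam k m (j + (m + 1))\<bar> * r ^ (j + (m + 1))) \<le> (\<Sum>j. (real m + 2) * r ^ (m + 1) * (real (Suc j) * r0 ^ j))"
  proof (rule suminf_le[OF le])
    show "summable (\<lambda>j. \<bar>gam k m (j + (m + 1))\<bar> * r ^ (j + (m + 1)))"
      using sg by (subst summable_iff_shift)
    show "summable (\<lambda>j. (real m + 2) * r ^ (m + 1) * (real (Suc j) * r0 ^ j))"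
      using gs by (intro summable_mult) (auto simp: sums_iff)
  qed
  also have "\<dots> = (real m + 2) * r ^ (m + 1) * (1 / (1 - r0)\<^sup>2)"
    using sums_mult[OF gs, of "(real m + 2) * r ^ (m + 1)"] by (simp only: sums_iff)
  finally show ?thesis by simp
qed

lemma real_powr_mult_fn: "mult_fn (\<lambda>n. real n powr s)"
  by (simp add: mult_fn_def powr_mult)

text \<open>The local sums are 1 + O(p^(-\<theta>(m+1))) with \<theta>(m+1) > 1. For \<theta> =
  2/(2k+1) this condition follows from k < m.\<close>

lemma gfun_summable:
  fixes \<theta> :: real
  assumes k: "2 \<le> k" "k < m" and \<theta>: "\<theta> > 0" "\<theta> * real (m + 1) > 1"
  shows "(\<lambda>n. norm (gfun k m n * real n powr (- \<theta>))) summable_on {0<..}"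
proof (rule mult_fn_abs_summable)
  define r where "r = (\<lambda>p::nat. real p powr (- \<theta>))"
  have k1: "k \<ge> 1" using k by simp
  show "mult_fn (\<lambda>n. gfun k m n * real n powr (- \<theta>))"
    by (intro mult_fn_times mult_fn_gfun real_powr_mult_fn k1)
  have r: "0 < r p" "r p \<le> r 2" "r p < 1" if "prime p" for p
    using prime_ge_2_nat[OF that] \<theta> by (auto simp: r_def powr_less_one intro!: powr_mono2')
  have r2: "r 2 < 1" using \<theta> by (simp add: r_def powr_less_one)
  show "((\<lambda>j. norm (gfun k m (p ^ j) * real (p ^ j) powr (- \<theta>))) has_sum (\<Sum>j. \<bar>gam k m j\<bar> * r p ^ j)) UNIV"
    if p: "prime p" for p
  proof -
    have "real (p ^ j) powr (- \<theta>) = r p ^ j" for j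
      unfolding r_def using prime_gt_0_nat[OF p]
      by (simp add: powr_power powr_realpow[symmetric] powr_powr mult.commute)
    then have eq: "norm (gfun k m (p ^ j) * real (p ^ j) powr (- \<theta>)) = \<bar>gam k m j\<bar> * r p ^ j" for j
      using r(1)[OF p] by (simp add: gfun_prime_power[OF k1 p] abs_mult)
    have sm: "summable (\<lambda>j. \<bar>gam k m j\<bar> * r p ^ j)" by (rule gam_sums[OF r(1,3)[OF p] k])
    then have "((\<lambda>j. \<bar>gam k m j\<bar> * r p ^ j) has_sum (\<Sum>j. \<bar>gam k m j\<bar> * r p ^ j)) UNIV"
      using r(1)[OF p] by (intro norm_summable_imp_has_sum summable_sums) (auto simp: abs_mult)
    then show ?thesis unfolding eq .
  qed
  show "(\<Sum>j. \<bar>gam k m j\<bar> * r p ^ j) \<le> 1 + (real m + 2) / (1 - r 2)\<^sup>2 * real p powr (- (\<theta> * real (m + 1)))"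
    if p: "prime p" for p
  proof -
    have "r p ^ (m + 1) = real p powr (- (\<theta> * real (m + 1)))"
      unfolding r_def using prime_gt_0_nat[OF p] by (subst powr_realpow[symmetric]) (auto simp: powr_powr)
    then show ?thesis using gam_local_bound[OF r(1,2)[OF p] r2 k] by simp
  qed
  show "summable (\<lambda>p. (real m + 2) / (1 - r 2)\<^sup>2 * real p powr (- (\<theta> * real (m + 1))))"
    using \<theta> by (intro summable_mult) (simp add: summable_real_powr_iff)
qed simp

text \<open>With u = 1/p the fraction in the definition of \<open>alpha\<close> is u^m (1 - u) / (1
  - u^k), the expression occurring in the local factor of g.\<close>

lemma sum_powers_reciprocal:
  assumes p: "p > 1" and k: "1 \<le> k" "k \<le> m"
  shows "1 / (\<Sum>i=m-k+1..m. real p ^ i) = (1 / real p) ^ m * (1 - 1 / real p) / (1 - (1 / real p) ^ k)"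
proof -
  have p1: "real p > 1" using p by simp
  have "(\<Sum>i=m-k+1..m. real p ^ i) = (\<Sum>i<k. real p ^ (m - k + 1) * real p ^ i)"
    unfolding power_add[symmetric] using k
    by (intro sum.reindex_bij_witness[of _ "\<lambda>i. m - k + 1 + i" "\<lambda>i. i - (m - k + 1)"]) (auto simp del: power_Suc)
  also have "\<dots> = real p ^ (m - k + 1) * ((real p ^ k - 1) / (real p - 1))"
    using p1 by (simp add: sum_distrib_left[symmetric] geometric_sum)
  finally have eq: "(\<Sum>i=m-k+1..m. real p ^ i) = real p ^ (m - k + 1) * ((real p ^ k - 1) / (real p - 1))" .
  have pk: "real p ^ k > 1" using p1 k by (intro one_less_power) auto
  have pm: "real p ^ m = real p ^ (m - k) * real p ^ k" using k by (simp flip: power_add)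
  have alg: "1 / (a * P * ((K - 1) / (P - 1))) = 1 / (a * K) * (1 - 1 / P) / (1 - 1 / K)"
    if "a > 0" "P > 1" "K > 1" for a P K :: real
    using that by (simp add: field_simps)
  have "1 / (real p ^ (m - k) * real p * ((real p ^ k - 1) / (real p - 1))) =
      1 / (real p ^ (m - k) * real p ^ k) * (1 - 1 / real p) / (1 - 1 / real p ^ k)"
    using p1 pk by (intro alg) auto
  then show ?thesis unfolding eq by (simp add: power_divide pm mult_ac)
qed

text \<open>Euler product at s = 1: each local factor is the one of \<open>alpha\<close> divided by
  1 - p^(-m), and the divisors make up zeta(m). Together with 1 / zeta(k) from the k-free count this
  is the constant of the main term.\<close>

lemma gfun_sum_eq:
  assumes k: "2 \<le> k" "k < m"
  shows "complex_of_real (\<Sum>\<^sub>\<infinity>n\<in>{0<..}. gfun k m n / real n) = of_real (alpha k m) * zeta (of_nat m)"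
proof -
  have k1: "k \<ge> 1" using k by simp
  define f where "f = (\<lambda>n. gfun k m n * real n powr (- 1))"
  define D where "D = (\<lambda>p::nat. 1 / (\<Sum>i=m-k+1..m. real p ^ i))"
  define h where "h = (\<lambda>p. if prime p then 1 - D p else 1)"
  have f: "(\<lambda>n. norm (f n)) summable_on {0<..}" unfolding f_def using k by (intro gfun_summable) auto
  have mf: "mult_fn f" unfolding f_def by (intro mult_fn_times mult_fn_gfun real_powr_mult_fn k1)
  have loc: "(\<Sum>\<^sub>\<infinity>j. f (p ^ j)) = (1 - D p) / (1 - (1 / real p) ^ m)" if p: "prime p" for p
  proof -
    define u where "u = 1 / real p"
    have p1: "p > 1" by (rule prime_gt_1_nat[OF p])
    have u: "0 < u" "u < 1" using p1 by (auto simp: u_def)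
    have eq: "f (p ^ j) = gam k m j * u ^ j" for j
      using p1 by (simp add: f_def gfun_prime_power[OF k1 p] u_def powr_minus divide_inverse power_inverse)
    have "(\<lambda>j. gam k m j * u ^ j) sums ((1 - u ^ m * (1 - u) / (1 - u ^ k)) / (1 - u ^ m))"
      by (rule gam_sums[OF u k])
    then have "((\<lambda>j. gam k m j * u ^ j) has_sum ((1 - u ^ m * (1 - u) / (1 - u ^ k)) / (1 - u ^ m))) UNIV"
      using gam_sums(1)[OF u k] u by (intro norm_summable_imp_has_sum) (auto simp: abs_mult)
    then have "(\<Sum>\<^sub>\<infinity>j. f (p ^ j)) = (1 - u ^ m * (1 - u) / (1 - u ^ k)) / (1 - u ^ m)"
      unfolding eq by (rule infsumI)
    then show ?thesis using sum_powers_reciprocal[OF p1 k1, of m] k by (simp add: D_def u_def)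
  qed
  have A: "(\<lambda>N. \<Prod>p | prime p \<and> p \<le> N. \<Sum>\<^sub>\<infinity>j. f (p ^ j)) \<longlonglongrightarrow> infsum f {0<..}"
    by (rule euler_product_LIMSEQ[OF mf f])
  have hprod: "(\<Prod>i\<le>N. h i) = (\<Prod>p | prime p \<and> p \<le> N. 1 - D p)" for N
    unfolding h_def by (rule prod.mono_neutral_cong_right) auto
  have Dle: "\<bar>D p\<bar> \<le> real p powr (- 2)" if "p > 0" for p
  proof -
    have "real p ^ 2 \<le> real p ^ m" using that k by (intro power_increasing) auto
    also have "\<dots> \<le> (\<Sum>i=m-k+1..m. real p ^ i)"
      using k by (intro member_le_sum) auto
    finally have S: "real p ^ 2 \<le> (\<Sum>i=m-k+1..m. real p ^ i)" .
    have "0 < real p ^ 2" using that by simp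
    then have "1 / (\<Sum>i=m-k+1..m. real p ^ i) \<le> 1 / real p ^ 2" using S by (intro frac_le) auto
    moreover have "0 \<le> D p" unfolding D_def by (intro divide_nonneg_nonneg sum_nonneg) auto
    ultimately have "\<bar>D p\<bar> \<le> 1 / real p ^ 2" by (simp add: D_def)
    then show ?thesis using that by (simp add: powr_minus powr_numeral divide_inverse)
  qed
  \<comment> \<open>A \<open>prodinf\<close> is tied to its partial products only once convergence
    is known; D p \<le> p^(-2) supplies it.\<close>
  have "convergent_prod h"
  proof (rule abs_convergent_prod_imp_convergent_prod, unfold abs_convergent_prod_conv_summable)
    show "summable (\<lambda>n. norm (h n - 1))"
    proof (rule summable_comparison_test')
      show "summable (\<lambda>n. real n powr (- 2))" by (simp add: summable_real_powr_iff)
      show "norm (norm (h n - 1)) \<le> real n powr (- 2)" for n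
        using Dle[of n] prime_gt_0_nat[of n] by (auto simp: h_def)
    qed
  qed
  then have B: "(\<lambda>N. \<Prod>i\<le>N. h i) \<longlonglongrightarrow> alpha k m"
    unfolding alpha_def h_def D_def by (rule convergent_prod_LIMSEQ)
  have "(\<lambda>N. of_real (\<Prod>i\<le>N. h i) * (\<Prod>p | prime p \<and> p \<le> N. 1 / (1 - of_nat p powr (- of_nat m)))) \<longlonglongrightarrow>
      of_real (alpha k m) * zeta (of_nat m)"
    using k by (intro tendsto_mult tendsto_of_real B zeta_euler_product) auto
  moreover have "of_real (\<Prod>i\<le>N. h i) * (\<Prod>p | prime p \<and> p \<le> N. 1 / (1 - of_nat p powr (- of_nat m))) =
      complex_of_real (\<Prod>p | prime p \<and> p \<le> N. \<Sum>\<^sub>\<infinity>j. f (p ^ j))" for N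
    unfolding hprod of_real_prod prod.distrib[symmetric]
  proof (intro prod.cong refl)
    fix p assume "p \<in> {p. prime p \<and> p \<le> N}"
    then have p: "prime p" by simp
    have "(of_nat p :: complex) powr (- of_nat m) = of_real ((1 / real p) ^ m)"
      using prime_gt_0_nat[OF p] by (simp add: powr_minus powr_nat' power_divide divide_inverse power_inverse)
    then show "of_real (1 - D p) * (1 / (1 - of_nat p powr (- of_nat m))) = complex_of_real (\<Sum>\<^sub>\<infinity>j. f (p ^ j))"
      by (simp add: loc[OF p])
  qed
  ultimately have "(\<lambda>N. complex_of_real (\<Prod>p | prime p \<and> p \<le> N. \<Sum>\<^sub>\<infinity>j. f (p ^ j))) \<longlonglongrightarrow>
      of_real (alpha k m) * zeta (of_nat m)" by (simp only:)
  moreover have "(\<lambda>N. complex_of_real (\<Prod>p | prime p \<and> p \<le> N. \<Sum>\<^sub>\<infinity>j. f (p ^ j))) \<longlonglongrightarrow> of_real (infsum f {0<..})"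
    by (intro tendsto_of_real A)
  ultimately have "complex_of_real (infsum f {0<..}) = of_real (alpha k m) * zeta (of_nat m)"
    using LIMSEQ_unique by blast
  moreover have "infsum f {0<..} = (\<Sum>\<^sub>\<infinity>n\<in>{0<..}. gfun k m n / real n)"
    by (rule infsum_cong) (simp add: f_def powr_minus divide_inverse)
  ultimately show ?thesis by simp
qed

section \<open>Combining the convolution with the k-free count\<close>

text \<open>The k-free count is applied at x/d and weighted by g(d). Its errors add up to x^\<theta>
  times the sum G of |g(d)| d^(-\<theta>). The main terms lack the part d > x of the series S, which
  is again at most x^\<theta> G, up to |\<kappa>| \<le> 2; hence 13 = 11 + 2.\<close>

lemma sum_qstar_bound:
  fixes x W :: real and k m :: nat
  defines "\<kappa> \<equiv> mu_sum k" and "\<theta> \<equiv> 2 / (2 * real k + 1)"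
    and "S \<equiv> \<Sum>\<^sub>\<infinity>n\<in>{0<..}. gfun k m n / real n"
    and "G \<equiv> \<Sum>\<^sub>\<infinity>n\<in>{0<..}. norm (gfun k m n * real n powr (- (2 / (2 * real k + 1))))"
  assumes k: "2 \<le> k" "k < m" and x: "x \<ge> 1" and W: "W \<ge> 1"
    and M: "\<And>e. 1 \<le> e \<Longrightarrow> real e \<le> x \<Longrightarrow> \<bar>mertens e\<bar> \<le> W * sqrt (real e)"
  shows "\<bar>(\<Sum>n=1..nat \<lfloor>x\<rfloor>. qstar k m n) - x * S * \<kappa>\<bar> \<le> 13 * G * (x powr \<theta> * W)"
proof -
  define N where "N = nat \<lfloor>x\<rfloor>"
  define g where "g = gfun k m"
  define w where "w = (\<lambda>n. norm (g n * real n powr (- \<theta>)))"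
  have N: "real N \<le> x" "x < real N + 1" using x by (auto simp: N_def)
  have \<theta>: "0 < \<theta>" "\<theta> < 1" "\<theta> * real (m + 1) > 1" using k by (auto simp: \<theta>_def field_simps)
  have w: "w summable_on {0<..}" unfolding w_def g_def by (rule gfun_summable[OF k \<theta>(1,3)])
  have wi: "w summable_on A" "infsum w A \<le> G" if "A \<subseteq> {0<..}" for A
  proof -
    show "w summable_on A" using w that by (rule summable_on_subset_banach)
    then show "infsum w A \<le> G"
      unfolding G_def \<theta>_def[symmetric] g_def[symmetric] w_def[symmetric]
      using w that by (intro infsum_mono2) (auto simp: w_def)
  qed
  have G0: "G \<ge> 0" unfolding G_def by (intro infsum_nonneg) auto
  have g1: "(\<lambda>n. norm (g n / real n)) summable_on {0<..}"
  proof (rule summable_on_comparison_test[OF w])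
    fix n :: nat assume n: "n \<in> {0<..}"
    have "real n powr (- 1) \<le> real n powr (- \<theta>)" using n \<theta> by (intro powr_mono) auto
    then show "norm (g n / real n) \<le> w n"
      using n by (simp add: w_def abs_mult powr_minus divide_inverse mult_left_mono)
  qed simp
  have gA: "(\<lambda>n. norm (g n / real n)) summable_on A" if "A \<subseteq> {0<..}" for A
    using g1 that by (rule summable_on_subset_banach)
  have "{0<..} = {1..N} \<union> {N<..}" by auto
  then have "S = infsum (\<lambda>n. g n / real n) ({1..N} \<union> {N<..})" by (simp add: S_def g_def)
  also have "\<dots> = infsum (\<lambda>n. g n / real n) {1..N} + infsum (\<lambda>n. g n / real n) {N<..}"
    by (rule infsum_Un_disjoint) (auto intro!: abs_summable_summable[OF gA])
  also have "infsum (\<lambda>n. g n / real n) {1..N} = (\<Sum>n=1..N. g n / real n)" by simp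
  finally have Ssplit: "S = (\<Sum>n=1..N. g n / real n) + infsum (\<lambda>n. g n / real n) {N<..}" .
  have tail: "\<bar>x * infsum (\<lambda>n. g n / real n) {N<..}\<bar> \<le> x powr \<theta> * G"
  proof -
    have "\<bar>infsum (\<lambda>n. g n / real n) {N<..}\<bar> \<le> infsum (\<lambda>n. norm (g n / real n)) {N<..}"
      using norm_infsum_bound[OF gA[of "{N<..}"]] by auto
    also have "\<dots> \<le> infsum (\<lambda>n. x powr (\<theta> - 1) * w n) {N<..}"
    proof (rule infsum_mono)
      show "(\<lambda>n. norm (g n / real n)) summable_on {N<..}" by (rule gA) auto
      show "(\<lambda>n. x powr (\<theta> - 1) * w n) summable_on {N<..}"
        by (intro summable_on_cmult_right wi) auto
      fix n assume n: "n \<in> {N<..}"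
      then have xn: "x \<le> real n" using N by auto
      have n0: "real n > 0" using n by auto
      \<comment> \<open>1/n = n^(\<theta>-1) n^(-\<theta>), and the first factor is at most
        x^(\<theta>-1) because \<theta> < 1 and n \<ge> x.\<close>
      have "norm (g n / real n) = real n powr (\<theta> - 1) * w n"
      proof -
        have "real n powr (\<theta> - 1) * real n powr (- \<theta>) = 1 / real n"
          unfolding powr_add[symmetric] using n0 by (simp add: powr_minus divide_inverse)
        then show ?thesis by (simp add: w_def abs_mult mult_ac)
      qed
      also have "\<dots> \<le> x powr (\<theta> - 1) * w n"
        using xn x \<theta> by (intro mult_right_mono powr_mono2') (auto simp: w_def)
      finally show "norm (g n / real n) \<le> x powr (\<theta> - 1) * w n" .
    qed
    also have "\<dots> = x powr (\<theta> - 1) * infsum w {N<..}" 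
      by (rule infsum_cmult_right) (use wi in auto)
    also have "\<dots> \<le> x powr (\<theta> - 1) * G" by (intro mult_left_mono wi) auto
    finally have "x * \<bar>infsum (\<lambda>n. g n / real n) {N<..}\<bar> \<le> x * (x powr (\<theta> - 1) * G)"
      using x by (intro mult_left_mono) auto
    also have "\<dots> = x powr \<theta> * G" using x by (simp add: powr_diff)
    finally show ?thesis using x by (simp add: abs_mult)
  qed
  have "(\<Sum>n=1..N. qstar k m n) = (\<Sum>n=1..N. \<Sum>d | d dvd n. g d * kfree k (n div d))"
    unfolding g_def using k by (intro sum.cong refl qstar_conv) auto
  also have "\<dots> = (\<Sum>d=1..N. g d * (\<Sum>l=1..N div d. kfree k l))" by (rule sum_dconv)
  finally have q: "(\<Sum>n=1..N. qstar k m n) = (\<Sum>d=1..N. g d * (\<Sum>l=1..N div d. kfree k l))" .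
  have main: "\<bar>(\<Sum>n=1..N. qstar k m n) - x * \<kappa> * (\<Sum>n=1..N. g n / real n)\<bar> \<le> 11 * W * x powr \<theta> * G"
  proof -
    have "(\<Sum>n=1..N. qstar k m n) - x * \<kappa> * (\<Sum>n=1..N. g n / real n) =
        (\<Sum>d=1..N. g d * ((\<Sum>l=1..N div d. kfree k l) - x / real d * \<kappa>))"
      unfolding q sum_distrib_left[of "x * \<kappa>"] sum_subtractf[symmetric]
      by (intro sum.cong) (auto simp: algebra_simps)
    also have "\<bar>\<dots>\<bar> \<le> (\<Sum>d=1..N. 11 * W * x powr \<theta> * w d)"
    proof (intro order.trans[OF sum_abs] sum_mono)
      fix d assume d: "d \<in> {1..N}"
      then have d1: "real d \<ge> 1" and dx: "real d \<le> x" using N by auto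
      have fl: "nat \<lfloor>x / real d\<rfloor> = N div d"
      proof -
        have "\<lfloor>x / real d\<rfloor> = \<lfloor>x\<rfloor> div int d" using floor_divide_real_eq_div[of "int d" x] by simp
        then show ?thesis using x by (simp add: N_def nat_div_distrib)
      qed
      have "\<bar>(\<Sum>l=1..nat \<lfloor>x / real d\<rfloor>. kfree k l) - x / real d * \<kappa>\<bar> \<le> 11 * W * (x / real d) powr \<theta>"
        unfolding \<kappa>_def \<theta>_def
      proof (rule sum_kfree_bound[OF k(1) _ W])
        show "1 \<le> x / real d" using d1 dx by simp
        \<comment> \<open>One W serves all d: the hypothesis covers every e up to x, hence up to
          x/d.\<close>
        have "x / real d \<le> x" using d1 x by (simp add: field_simps)
        then show "\<bar>mertens e\<bar> \<le> W * sqrt (real e)" if "1 \<le> e" "real e \<le> x / real d" for e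
          using that by (intro M) auto
      qed
      then have "\<bar>g d\<bar> * \<bar>(\<Sum>l=1..N div d. kfree k l) - x / real d * \<kappa>\<bar> \<le> \<bar>g d\<bar> * (11 * W * (x / real d) powr \<theta>)"
        unfolding fl by (intro mult_left_mono) auto
      also have "\<dots> = 11 * W * x powr \<theta> * w d"
      proof -
        have "(x / real d) powr \<theta> = x powr \<theta> * real d powr (- \<theta>)"
          using x by (subst powr_divide) (simp_all add: powr_minus_divide)
        then show ?thesis by (simp add: w_def abs_mult)
      qed
      finally show "\<bar>g d * ((\<Sum>l=1..N div d. kfree k l) - x / real d * \<kappa>)\<bar> \<le> 11 * W * x powr \<theta> * w d"
        by (simp add: abs_mult)
    qed
    also have "\<dots> = 11 * W * x powr \<theta> * infsum w {1..N}" by (simp add: sum_distrib_left)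
    also have "\<dots> \<le> 11 * W * x powr \<theta> * G" using W by (intro mult_left_mono wi) auto
    finally show ?thesis .
  qed
  have "\<bar>\<kappa>\<bar> \<le> 2" unfolding \<kappa>_def by (rule mu_sum_props(1)[OF k(1)])
  then have "\<bar>\<kappa>\<bar> * \<bar>x * infsum (\<lambda>n. g n / real n) {N<..}\<bar> \<le> 2 * (x powr \<theta> * G)"
    using tail by (intro mult_mono) auto
  also have "\<dots> \<le> 2 * (x powr \<theta> * G) * W" using G0 W mult_left_mono[of 1 W "2 * (x powr \<theta> * G)"] by simp
  finally have t: "\<bar>\<kappa> * (x * infsum (\<lambda>n. g n / real n) {N<..})\<bar> \<le> 2 * (x powr \<theta> * G) * W" by (simp add: abs_mult)
  have "(\<Sum>n=1..N. qstar k m n) - x * S * \<kappa> =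
      ((\<Sum>n=1..N. qstar k m n) - x * \<kappa> * (\<Sum>n=1..N. g n / real n)) - \<kappa> * (x * infsum (\<lambda>n. g n / real n) {N<..})"
    unfolding Ssplit by (simp add: algebra_simps)
  then have "\<bar>(\<Sum>n=1..N. qstar k m n) - x * S * \<kappa>\<bar> \<le> 11 * W * x powr \<theta> * G + 2 * (x powr \<theta> * G) * W"
    using main t by linarith
  also have "\<dots> = 13 * G * (x powr \<theta> * W)" by (simp add: algebra_simps)
  finally show ?thesis by (simp add: N_def)
qed

lemma qstar_sum_error:
  assumes k: "2 \<le> k" "k < m" and C: "C > 0" and K: "K \<ge> 1" and x0: "x0 \<ge> 3"
    and M: "\<And>x N. x \<ge> x0 \<Longrightarrow> 1 \<le> N \<Longrightarrow> real N \<le> x \<Longrightarrow>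
       \<bar>mertens N\<bar> \<le> K * sqrt (real N) * exp (C * (ln x / ln (ln x)))"
  obtains B where "B \<ge> 0" "\<And>x. x \<ge> 3 \<Longrightarrow>
      norm (complex_of_real (\<Sum>r | 0 < r \<and> real r \<le> x. qstar k m r)
                 - complex_of_real (x * alpha k m) * zeta (of_nat m) / zeta (of_nat k))
             \<le> B * (x powr (2 / (2 * real k + 1)) * omega C x)"
proof -
  define \<kappa> where "\<kappa> = mu_sum k"
  define S where "S = (\<Sum>\<^sub>\<infinity>n\<in>{0<..}. gfun k m n / real n)"
  define G where "G = (\<Sum>\<^sub>\<infinity>n\<in>{0<..}. norm (gfun k m n * real n powr (- (2 / (2 * real k + 1)))))"
  define \<theta> where "\<theta> = 2 / (2 * real k + 1)"
  define B where "B = 13 * G * K + x0 * (1 + \<bar>S * \<kappa>\<bar>)"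
  have G0: "G \<ge> 0" unfolding G_def by (intro infsum_nonneg) auto
  have main: "norm (complex_of_real (\<Sum>r | 0 < r \<and> real r \<le> x. qstar k m r)
                 - complex_of_real (x * alpha k m) * zeta (of_nat m) / zeta (of_nat k))
             \<le> B * (x powr \<theta> * omega C x)" if x: "x \<ge> 3" for x
  proof -
    \<comment> \<open>Strictly above 1, so that ln (ln x) is positive and \<open>omega\<close> is at
      least 1 from x = 3 on.\<close>
    have lnx: "ln x > 1"
    proof -
      have "exp 1 < (3::real)" by (rule e_less_272[THEN less_trans]) simp
      then have "ln (exp 1) < ln x" using x by (subst ln_less_cancel_iff) auto
      then show ?thesis by simp
    qed
    have om: "omega C x = exp (C * (ln x / ln (ln x)))" by (simp add: omega_def divide_inverse mult.assoc)
    have om1: "omega C x \<ge> 1" unfolding om using C lnx by simp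
    have th1: "x powr \<theta> \<ge> 1" using x by (simp add: \<theta>_def ge_one_powr_ge_zero)
    define V where "V = x powr \<theta> * omega C x"
    have V: "V \<ge> 1" using mult_mono[OF th1 om1] th1 by (simp add: V_def)
    have set: "{r. 0 < r \<and> real r \<le> x} = {1..nat \<lfloor>x\<rfloor>}"
      using x by (auto simp: le_nat_iff le_floor_iff)
    have "complex_of_real (x * alpha k m) * zeta (of_nat m) / zeta (of_nat k) =
        of_real x * (of_real (alpha k m) * zeta (of_nat m)) * (1 / zeta (of_nat k))" by simp
    also have "\<dots> = of_real (x * S * \<kappa>)"
      unfolding gfun_sum_eq[OF k, symmetric] mu_sum_props(2)[OF k(1)] S_def \<kappa>_def by simp
    finally have "norm (complex_of_real (\<Sum>r | 0 < r \<and> real r \<le> x. qstar k m r)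
                 - complex_of_real (x * alpha k m) * zeta (of_nat m) / zeta (of_nat k)) =
        norm (complex_of_real ((\<Sum>n=1..nat \<lfloor>x\<rfloor>. qstar k m n) - x * S * \<kappa>))"
      unfolding set by simp
    also have "\<dots> = \<bar>(\<Sum>n=1..nat \<lfloor>x\<rfloor>. qstar k m n) - x * S * \<kappa>\<bar>" by (simp only: norm_of_real)
    also have "\<dots> \<le> B * V"
    proof (cases "x \<ge> x0")
      case True
      have "\<bar>(\<Sum>n=1..nat \<lfloor>x\<rfloor>. qstar k m n) - x * S * \<kappa>\<bar> \<le> 13 * G * (x powr \<theta> * (K * omega C x))"
        unfolding S_def \<kappa>_def G_def \<theta>_def
      proof (rule sum_qstar_bound[OF k])
        show "1 \<le> K * omega C x" using mult_mono[OF K om1] K by simp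
        show "\<bar>mertens e\<bar> \<le> K * omega C x * sqrt (real e)" if "1 \<le> e" "real e \<le> x" for e
          using M[OF True that] by (simp add: om mult_ac)
      qed (use x in simp)
      also have "\<dots> = 13 * G * K * V" by (simp add: V_def)
      also have "\<dots> \<le> B * V" using V x0 by (intro mult_right_mono) (auto simp: B_def)
      finally show ?thesis .
    next
      \<comment> \<open>Below x0 the trivial bounds 0 and 1 for \<open>qstar\<close> suffice, at the
        price of a constant depending on k and m.\<close>
      case False
      have q01: "0 \<le> qstar k m n" "qstar k m n \<le> 1" for n by (auto simp: qstar_def indicator_def)
      have "(\<Sum>n=1..nat \<lfloor>x\<rfloor>. qstar k m n) \<le> (\<Sum>n=1..nat \<lfloor>x\<rfloor>. 1)" by (intro sum_mono q01)
      also have "\<dots> \<le> x" using x by simp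
      finally have s: "(\<Sum>n=1..nat \<lfloor>x\<rfloor>. qstar k m n) \<le> x" .
      have "0 \<le> (\<Sum>n=1..nat \<lfloor>x\<rfloor>. qstar k m n)" by (intro sum_nonneg q01)
      then have "\<bar>(\<Sum>n=1..nat \<lfloor>x\<rfloor>. qstar k m n) - x * S * \<kappa>\<bar> \<le> x + \<bar>x * S * \<kappa>\<bar>" using s by linarith
      also have "\<dots> = x * (1 + \<bar>S * \<kappa>\<bar>)" using x by (simp add: abs_mult distrib_left)
      also have "\<dots> \<le> x0 * (1 + \<bar>S * \<kappa>\<bar>)" using False by (intro mult_right_mono) auto
      also have "\<dots> \<le> B" using G0 K by (simp add: B_def)
      also have "\<dots> \<le> B * V" using V x0 G0 K mult_left_mono[OF V, of B] by (simp add: B_def)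
      finally show ?thesis .
    qed
    finally show ?thesis by (simp only: V_def)
  qed
  show ?thesis by (rule that[of B]) (use main G0 K x0 in \<open>auto simp: B_def \<theta>_def\<close>)
qed

theorem theorem4:
  assumes "riemann_hypothesis"
  shows "\<exists>A>0. \<forall>m. \<exists>C. \<forall>k x. 2 \<le> k \<and> k < m \<and> 3 \<le> x \<longrightarrow>
           norm (complex_of_real (\<Sum>r | 0 < r \<and> real r \<le> x. qstar k m r)
                 - complex_of_real (x * alpha k m) * zeta (of_nat m) / zeta (of_nat k))
             \<le> C * (x powr (2 / (2 * real k + 1)) * omega A x)"
proof -
  obtain A K x0 where A: "A > 0" and K: "K \<ge> 1" and x0: "x0 \<ge> 3"
    and M: "\<And>x N. x \<ge> x0 \<Longrightarrow> 1 \<le> N \<Longrightarrow> real N \<le> x \<Longrightarrow>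
       \<bar>mertens N\<bar> \<le> K * sqrt (real N) * exp (A * (ln x / ln (ln x)))"
    by (rule mertens_bound[OF assms]) (rule that)
  define err where "err = (\<lambda>k m x. norm (complex_of_real (\<Sum>r | 0 < r \<and> real r \<le> x. qstar k m r)
                 - complex_of_real (x * alpha k m) * zeta (of_nat m) / zeta (of_nat k)))"
  have "\<exists>C. \<forall>k x. 2 \<le> k \<and> k < m \<and> 3 \<le> x \<longrightarrow> err k m x \<le> C * (x powr (2 / (2 * real k + 1)) * omega A x)" for m
  proof -
    have "\<exists>B\<ge>0. \<forall>x\<ge>3. err k m x \<le> B * (x powr (2 / (2 * real k + 1)) * omega A x)" if "k \<in> {2..<m}" for k
      unfolding err_def by (rule qstar_sum_error[OF _ _ A K x0 M, of k m]) (use that in auto)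
    \<comment> \<open>For given m only finitely many k occur; the sum of the nonnegative constants
      \<open>B k\<close> depends on m alone.\<close>
    then obtain B where B: "\<And>k. k \<in> {2..<m} \<Longrightarrow> B k \<ge> 0 \<and>
        (\<forall>x\<ge>3. err k m x \<le> B k * (x powr (2 / (2 * real k + 1)) * omega A x))"
      by metis
    have "err k m x \<le> (\<Sum>k\<in>{2..<m}. B k) * (x powr (2 / (2 * real k + 1)) * omega A x)"
      if "2 \<le> k" "k < m" "3 \<le> x" for k x
    proof -
      have "err k m x \<le> B k * (x powr (2 / (2 * real k + 1)) * omega A x)" using B[of k] that by auto
      also have "\<dots> \<le> (\<Sum>k\<in>{2..<m}. B k) * (x powr (2 / (2 * real k + 1)) * omega A x)"
        using B that by (intro mult_right_mono member_le_sum) (auto simp: omega_def)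
      finally show ?thesis .
    qed
    then show ?thesis by blast
  qed
  then show ?thesis using A unfolding err_def by blast
qed

end
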